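(* Let $\mathcal{C}$ be a triangulated category with suspension functor $\Sigma$, and let $T\in\mathcal{C}$ be a rigid object which is contravariantly finite. Let $\mathcal{W}$ be the class of morphisms $f:X\to Y$ such that, for any triangle $Z\xrightarrow{g}X\xrightarrow{f}Y\xrightarrow{h}\Sigma Z$, both $g$ and $h$ belong to the ideal $(T^\perp)$. Then the inclusion of $T\ast\Sigma T$ into $\mathcal{C}$ induces an equivalence of categories from $T\ast\Sigma T/(\Sigma T)$ to $\mathcal{C}[\mathcal{W}^{-1}]$. In particular, the localisation of $\mathcal{C}$ at $\mathcal{W}$ exists.
   Context: $T$ is rigid if $\mathcal{C}(T,\Sigma T)=0$. $\operatorname{add}T$ is the full subcategory of direct summands of finite direct sums of copies of $T$. $T$ is contravariantly finite if for every $X\in\mathcal{C}$ there is a morphism $D\to X$ with $D\in\operatorname{add}T$ through which every morphism $D'\to X$ with $D'\in\operatorname{add}T$ factors. $T\ast\Sigma T$ is the full subcategory of $\mathcal{C}$ whose objects are cones of morphisms in $\operatorname{add}T$. $T^\perp$ is the full subcategory of objects $X$ with $\mathcal{C}(T,X)=0$, and $(T^\perp)$ is the ideal of morphisms factoring through an object of $T^\perp$. $(\Sigma T)$ is the ideal of morphisms factoring through an object of $\operatorname{add}\Sigma T$, and $T\ast\Sigma T/(\Sigma T)$ is the ideal quotient. The localisation of $\mathcal{C}$ at $\mathcal{W}$ is a functor $L:\mathcal{C}\to\mathcal{C}[\mathcal{W}^{-1}]$ that sends morphisms in $\mathcal{W}$ to isomorphisms and has the property that any functor $F:\mathcal{C}\to\mathcal{D}$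 sending morphisms in $\mathcal{W}$ to isomorphisms factors as $F=GL$ (strict equality) for a unique functor $G$. A formal construction (words in morphisms and formal inverses, modulo relations) always exists up to set-theoretic issues; "exists" means that it is a genuine category, i.e. that morphisms between two objects form a set. The functor "induced by the inclusion" is the one obtained from $T\ast\Sigma T\hookrightarrow\mathcal{C}\xrightarrow{L}\mathcal{C}[\mathcal{W}^{-1}]$ by passing to the quotient. *)

theory Defs
  imports "HOL-Library.Equipollence" "HOL-Library.FuncSet" "HOL-Algebra.FiniteProduct"
begin

section \<open>Categories and functors\<close>

text \<open>Objects and arrows are collected in carrier sets, which may be proper classes from the point
  of view of the universe used in \<open>locally_small\<close> below. Composition is written in the order of
  functions: in \<open>g \<cdot> f\<close> the arrow \<open>f\<close> comes first.\<close>

record ('o, 'm) cat =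
  Obj :: "'o set"
  Arr :: "'m set"
  Dom :: "'m \<Rightarrow> 'o"
  Cod :: "'m \<Rightarrow> 'o"
  Idn :: "'o \<Rightarrow> 'm"
  Cmp :: "'m \<Rightarrow> 'm \<Rightarrow> 'm"  (infixl "\<cdot>\<index>" 70)

definition hom_set :: "('o, 'm, 'z) cat_scheme \<Rightarrow> 'o \<Rightarrow> 'o \<Rightarrow> 'm set" where
  "hom_set C X Y = {f \<in> Arr C. Dom C f = X \<and> Cod C f = Y}"

locale category =
  fixes C :: "('o, 'm, 'z) cat_scheme" (structure)
  assumes dom_obj: "f \<in> Arr C \<Longrightarrow> Dom C f \<in> Obj C"
    and cod_obj: "f \<in> Arr C \<Longrightarrow> Cod C f \<in> Obj C"
    and idn_hom: "X \<in> Obj C \<Longrightarrow> Idn C X \<in> hom_set C X X"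
    and cmp_hom: "\<lbrakk>f \<in> hom_set C X Y; g \<in> hom_set C Y Z\<rbrakk> \<Longrightarrow> g \<cdot> f \<in> hom_set C X Z"
    and cmp_idn: "f \<in> hom_set C X Y \<Longrightarrow> f \<cdot> Idn C X = f"
    and idn_cmp: "f \<in> hom_set C X Y \<Longrightarrow> Idn C Y \<cdot> f = f"
    and cmp_assoc: "\<lbrakk>f \<in> hom_set C X Y; g \<in> hom_set C Y Z; h \<in> hom_set C Z V\<rbrakk>
      \<Longrightarrow> (h \<cdot> g) \<cdot> f = h \<cdot> (g \<cdot> f)"

definition iso_arr :: "('o, 'm, 'z) cat_scheme \<Rightarrow> 'm \<Rightarrow> bool" where
  "iso_arr C f \<longleftrightarrow> f \<in> Arr C \<and> (\<exists>g \<in> hom_set C (Cod C f) (Dom C f).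
     g \<cdot>\<^bsub>C\<^esub> f = Idn C (Dom C f) \<and> f \<cdot>\<^bsub>C\<^esub> g = Idn C (Cod C f))"

text \<open>A set \<open>U\<close> plays the role of a universe. By the principle of limitation of size, a collection
  counts as a set if it is strictly smaller than \<open>U\<close>.\<close>

definition locally_small :: "'u set \<Rightarrow> ('o, 'm, 'z) cat_scheme \<Rightarrow> bool" where
  "locally_small U C \<longleftrightarrow> (\<forall>X \<in> Obj C. \<forall>Y \<in> Obj C. hom_set C X Y \<prec> U)"

text \<open>The two maps of a functor are extensional, that is, \<open>undefined\<close> outside the source
  category, so that equality of functors is equality in the logic.\<close>

record ('o, 'm, 'p, 'n) fctr =
  ObjMap :: "'o \<Rightarrow> 'p"
  ArrMap :: "'m \<Rightarrow> 'n"

locale is_functor = C: category C + D: category D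
  for C :: "('o, 'm, 'z) cat_scheme" and D :: "('p, 'n, 'y) cat_scheme" +
  fixes F :: "('o, 'm, 'p, 'n) fctr"
  assumes obj_map: "ObjMap F \<in> Obj C \<rightarrow>\<^sub>E Obj D"
    and arr_map: "ArrMap F \<in> Arr C \<rightarrow>\<^sub>E Arr D"
    and map_hom: "f \<in> hom_set C X Y \<Longrightarrow> ArrMap F f \<in> hom_set D (ObjMap F X) (ObjMap F Y)"
    and map_idn: "X \<in> Obj C \<Longrightarrow> ArrMap F (Idn C X) = Idn D (ObjMap F X)"
    and map_cmp: "\<lbrakk>f \<in> hom_set C X Y; g \<in> hom_set C Y Z\<rbrakk>
      \<Longrightarrow> ArrMap F (g \<cdot>\<^bsub>C\<^esub> f) = ArrMap F g \<cdot>\<^bsub>D\<^esub> ArrMap F f"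

text \<open>\<open>functor_comp C G F\<close> is \<open>G\<close> after \<open>F\<close>, where \<open>F\<close> has source \<open>C\<close>.\<close>

definition functor_comp ::
  "('o, 'm, 'z) cat_scheme \<Rightarrow> ('p, 'n, 'q, 'l) fctr \<Rightarrow> ('o, 'm, 'p, 'n) fctr \<Rightarrow> ('o, 'm, 'q, 'l) fctr"
  where "functor_comp C G F =
    \<lparr>ObjMap = compose (Obj C) (ObjMap G) (ObjMap F), ArrMap = compose (Arr C) (ArrMap G) (ArrMap F)\<rparr>"

definition inclusion :: "('o, 'm, 'z) cat_scheme \<Rightarrow> ('o, 'm, 'o, 'm) fctr" where
  "inclusion A = \<lparr>ObjMap = (\<lambda>X \<in> Obj A. X), ArrMap = (\<lambda>f \<in> Arr A. f)\<rparr>"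

abbreviation (input) id_functor :: "('o, 'm, 'z) cat_scheme \<Rightarrow> ('o, 'm, 'o, 'm) fctr" where
  "id_functor \<equiv> inclusion"

definition natural_iso ::
  "('o, 'm, 'z) cat_scheme \<Rightarrow> ('p, 'n, 'y) cat_scheme \<Rightarrow> ('o, 'm, 'p, 'n) fctr \<Rightarrow>
    ('o, 'm, 'p, 'n) fctr \<Rightarrow> ('o \<Rightarrow> 'n) \<Rightarrow> bool" where
  "natural_iso C D F G \<eta> \<longleftrightarrow>
    (\<forall>X \<in> Obj C. \<eta> X \<in> hom_set D (ObjMap F X) (ObjMap G X) \<and> iso_arr D (\<eta> X)) \<and>
    (\<forall>f \<in> Arr C. \<eta> (Cod C f) \<cdot>\<^bsub>D\<^esub> ArrMap F f = ArrMap G f \<cdot>\<^bsub>D\<^esub> \<eta> (Dom C f))"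

definition is_equivalence ::
  "('o, 'm, 'z) cat_scheme \<Rightarrow> ('p, 'n, 'y) cat_scheme \<Rightarrow> ('o, 'm, 'p, 'n) fctr \<Rightarrow> bool" where
  "is_equivalence C D F \<longleftrightarrow> is_functor C D F \<and>
    (\<exists>G \<eta> \<epsilon>. is_functor D C G \<and>
      natural_iso C C (id_functor C) (functor_comp C G F) \<eta> \<and>
      natural_iso D D (functor_comp D F G) (id_functor D) \<epsilon>)"

definition full_subcat :: "('o, 'm, 'z) cat_scheme \<Rightarrow> 'o set \<Rightarrow> ('o, 'm, 'z) cat_scheme" where
  "full_subcat C S = C\<lparr>Obj := S, Arr := {f \<in> Arr C. Dom C f \<in> S \<and> Cod C f \<in> S}\<rparr>"

section \<open>Quotients and localisations\<close>

text \<open>The quotient by a congruence \<open>R\<close> has the same objects, and equivalence classes as arrows.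
  All elements of a class have the same domain and codomain, and the union in the composition is
  one of equal classes.\<close>

definition quotient_cat :: "('o, 'm, 'z) cat_scheme \<Rightarrow> ('m \<times> 'm) set \<Rightarrow> ('o, 'm set) cat" where
  "quotient_cat C R =
    \<lparr>Obj = Obj C, Arr = Arr C // R,
     Dom = (\<lambda>c. the_elem (Dom C ` c)), Cod = (\<lambda>c. the_elem (Cod C ` c)),
     Idn = (\<lambda>X. R `` {Idn C X}),
     Cmp = (\<lambda>d c. \<Union>g \<in> d. \<Union>f \<in> c. R `` {g \<cdot>\<^bsub>C\<^esub> f})\<rparr>"

definition quotient_functor ::
  "('o, 'm, 'z) cat_scheme \<Rightarrow> ('m \<times> 'm) set \<Rightarrow> ('o, 'm, 'o, 'm set) fctr" where
  "quotient_functor C R = \<lparr>ObjMap = (\<lambda>X \<in> Obj C. X), ArrMap = (\<lambda>f \<in> Arr C. R `` {f})\<rparr>"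

inductive_set congruence_closure ::
  "('o, 'm, 'z) cat_scheme \<Rightarrow> ('m \<times> 'm) set \<Rightarrow> ('m \<times> 'm) set"
  for C :: "('o, 'm, 'z) cat_scheme" and R :: "('m \<times> 'm) set" where
  base: "(f, g) \<in> R \<Longrightarrow> (f, g) \<in> congruence_closure C R"
| refl: "f \<in> Arr C \<Longrightarrow> (f, f) \<in> congruence_closure C R"
| sym: "(f, g) \<in> congruence_closure C R \<Longrightarrow> (g, f) \<in> congruence_closure C R"
| trans: "\<lbrakk>(f, g) \<in> congruence_closure C R; (g, h) \<in> congruence_closure C R\<rbrakk>
    \<Longrightarrow> (f, h) \<in> congruence_closure C R"
| cmp: "\<lbrakk>(f, f') \<in> congruence_closure C R; (g, g') \<in> congruence_closure C R; Cod C f = Dom C g\<rbrakk>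
    \<Longrightarrow> (g \<cdot>\<^bsub>C\<^esub> f, g' \<cdot>\<^bsub>C\<^esub> f') \<in> congruence_closure C R"

text \<open>Words in the arrows of \<open>C\<close> and formal inverses of the arrows in \<open>W\<close>; the first letter of a
  word is the first step of the path. A path is stored with its end points.\<close>

datatype 'm letter = Fwd 'm | Bwd 'm

fun is_word :: "('o, 'm, 'z) cat_scheme \<Rightarrow> 'm set \<Rightarrow> 'o \<Rightarrow> 'm letter list \<Rightarrow> 'o \<Rightarrow> bool" where
  "is_word C W X [] Y \<longleftrightarrow> X \<in> Obj C \<and> X = Y"
| "is_word C W X (Fwd f # w) Y \<longleftrightarrow> f \<in> Arr C \<and> Dom C f = X \<and> is_word C W (Cod C f) w Y"
| "is_word C W X (Bwd f # w) Y \<longleftrightarrow> f \<in> W \<and> Cod C f = X \<and> is_word C W (Dom C f) w Y"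

definition word_cat ::
  "('o, 'm, 'z) cat_scheme \<Rightarrow> 'm set \<Rightarrow> ('o, 'o \<times> 'm letter list \<times> 'o) cat" where
  "word_cat C W =
    \<lparr>Obj = Obj C, Arr = {(X, w, Y). is_word C W X w Y},
     Dom = (\<lambda>(X, w, Y). X), Cod = (\<lambda>(X, w, Y). Y), Idn = (\<lambda>X. (X, [], X)),
     Cmp = (\<lambda>(Y, v, Z) (X, w, Y'). (X, w @ v, Z))\<rparr>"

inductive_set localisation_relations ::
  "('o, 'm, 'z) cat_scheme \<Rightarrow> 'm set \<Rightarrow>
    (('o \<times> 'm letter list \<times> 'o) \<times> ('o \<times> 'm letter list \<times> 'o)) set"
  for C :: "('o, 'm, 'z) cat_scheme" and W :: "'m set" where
  "X \<in> Obj C \<Longrightarrow> ((X, [Fwd (Idn C X)], X), (X, [], X)) \<in> localisation_relations C W"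
| "\<lbrakk>f \<in> hom_set C X Y; g \<in> hom_set C Y Z\<rbrakk>
    \<Longrightarrow> ((X, [Fwd f, Fwd g], Z), (X, [Fwd (g \<cdot>\<^bsub>C\<^esub> f)], Z)) \<in> localisation_relations C W"
| "\<lbrakk>w \<in> W; w \<in> hom_set C X Y\<rbrakk>
    \<Longrightarrow> ((X, [Fwd w, Bwd w], X), (X, [], X)) \<in> localisation_relations C W"
| "\<lbrakk>w \<in> W; w \<in> hom_set C X Y\<rbrakk>
    \<Longrightarrow> ((Y, [Bwd w, Fwd w], Y), (Y, [], Y)) \<in> localisation_relations C W"

definition localisation_congruence where
  "localisation_congruence C W = congruence_closure (word_cat C W) (localisation_relations C W)"

definition localisation ::
  "('o, 'm, 'z) cat_scheme \<Rightarrow> 'm set \<Rightarrow> ('o, ('o \<times> 'm letter list \<times> 'o) set) cat" where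
  "localisation C W = quotient_cat (word_cat C W) (localisation_congruence C W)"

definition localisation_functor ::
  "('o, 'm, 'z) cat_scheme \<Rightarrow> 'm set \<Rightarrow> ('o, 'm, 'o, ('o \<times> 'm letter list \<times> 'o) set) fctr" where
  "localisation_functor C W =
    \<lparr>ObjMap = (\<lambda>X \<in> Obj C. X),
     ArrMap = (\<lambda>f \<in> Arr C. localisation_congruence C W `` {(Dom C f, [Fwd f], Cod C f)})\<rparr>"

text \<open>The universal property, tested on the categories whose objects and arrows are taken from two
  given types. Quantification over types is not possible inside a formula; a theorem with type
  variables in these two places covers all categories.\<close>

definition is_localisation ::
  "'p itself \<Rightarrow> 'n itself \<Rightarrow> ('o, 'm, 'z) cat_scheme \<Rightarrow> 'm set \<Rightarrow> ('q, 'l, 'y) cat_scheme \<Rightarrow>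
    ('o, 'm, 'q, 'l) fctr \<Rightarrow> bool" where
  "is_localisation _ _ C W D L \<longleftrightarrow>
    is_functor C D L \<and> (\<forall>w \<in> W. iso_arr D (ArrMap L w)) \<and>
    (\<forall>(E :: ('p, 'n) cat) F. is_functor C E F \<and> (\<forall>w \<in> W. iso_arr E (ArrMap F w)) \<longrightarrow>
      (\<exists>!G. is_functor D E G \<and> F = functor_comp C G L))"

section \<open>Additive categories\<close>

record ('o, 'm) add_cat = "('o, 'm) cat" +
  Add :: "'m \<Rightarrow> 'm \<Rightarrow> 'm"
  Zero :: "'o \<Rightarrow> 'o \<Rightarrow> 'm"

text \<open>The abelian group of arrows from \<open>X\<close> to \<open>Y\<close>; its operation is the addition of arrows.\<close>

definition hom_group :: "('o, 'm, 'z) add_cat_scheme \<Rightarrow> 'o \<Rightarrow> 'o \<Rightarrow> 'm monoid" where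
  "hom_group C X Y = \<lparr>carrier = hom_set C X Y, mult = Add C, one = Zero C X Y\<rparr>"

definition neg :: "('o, 'm, 'z) add_cat_scheme \<Rightarrow> 'm \<Rightarrow> 'm" where
  "neg C f = m_inv (hom_group C (Dom C f) (Cod C f)) f"

definition is_direct_sum ::
  "('o, 'm, 'z) add_cat_scheme \<Rightarrow> 'o list \<Rightarrow> 'o \<Rightarrow> (nat \<Rightarrow> 'm) \<Rightarrow> (nat \<Rightarrow> 'm) \<Rightarrow> bool" where
  "is_direct_sum C Xs S i p \<longleftrightarrow>
    set Xs \<subseteq> Obj C \<and> S \<in> Obj C \<and>
    (\<forall>k < length Xs. i k \<in> hom_set C (Xs ! k) S \<and> p k \<in> hom_set C S (Xs ! k)) \<and>
    (\<forall>k < length Xs. \<forall>l < length Xs. p k \<cdot>\<^bsub>C\<^esub> i l =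
      (if k = l then Idn C (Xs ! k) else Zero C (Xs ! l) (Xs ! k))) \<and>
    finprod (hom_group C S S) (\<lambda>k. i k \<cdot>\<^bsub>C\<^esub> p k) {..<length Xs} = Idn C S"

locale additive_category = category C
  for C :: "('o, 'm, 'z) add_cat_scheme" (structure) +
  assumes hom_comm_group: "\<lbrakk>X \<in> Obj C; Y \<in> Obj C\<rbrakk> \<Longrightarrow> comm_group (hom_group C X Y)"
    and cmp_add_left: "\<lbrakk>f \<in> hom_set C X Y; g \<in> hom_set C Y Z; g' \<in> hom_set C Y Z\<rbrakk>
      \<Longrightarrow> Add C g g' \<cdot> f = Add C (g \<cdot> f) (g' \<cdot> f)"
    and cmp_add_right: "\<lbrakk>f \<in> hom_set C X Y; f' \<in> hom_set C X Y; g \<in> hom_set C Y Z\<rbrakk>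
      \<Longrightarrow> g \<cdot> Add C f f' = Add C (g \<cdot> f) (g \<cdot> f')"
    and direct_sums: "set Xs \<subseteq> Obj C \<Longrightarrow> \<exists>S i p. is_direct_sum C Xs S i p"

definition zero_object :: "('o, 'm, 'z) add_cat_scheme \<Rightarrow> 'o \<Rightarrow> bool" where
  "zero_object C N \<longleftrightarrow> N \<in> Obj C \<and>
    (\<forall>X \<in> Obj C. hom_set C X N = {Zero C X N} \<and> hom_set C N X = {Zero C N X})"

text \<open>The objects of \<open>add T\<close>.\<close>

definition add_objs :: "('o, 'm, 'z) add_cat_scheme \<Rightarrow> 'o \<Rightarrow> 'o set" where
  "add_objs C T = {D. \<exists>n S i p D' i' p'.
     is_direct_sum C (replicate n T) S i p \<and> is_direct_sum C [D, D'] S i' p'}"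

definition contravariantly_finite :: "('o, 'm, 'z) add_cat_scheme \<Rightarrow> 'o \<Rightarrow> bool" where
  "contravariantly_finite C T \<longleftrightarrow>
    (\<forall>X \<in> Obj C. \<exists>D \<in> add_objs C T. \<exists>d \<in> hom_set C D X.
      \<forall>D' \<in> add_objs C T. \<forall>f \<in> hom_set C D' X. \<exists>g \<in> hom_set C D' D. f = d \<cdot>\<^bsub>C\<^esub> g)"

definition perp_objs :: "('o, 'm, 'z) add_cat_scheme \<Rightarrow> 'o \<Rightarrow> 'o set" where
  "perp_objs C T = {X \<in> Obj C. hom_set C T X = {Zero C T X}}"

text \<open>The arrows that factor through an object in \<open>S\<close>.\<close>

definition factoring :: "('o, 'm, 'z) cat_scheme \<Rightarrow> 'o set \<Rightarrow> 'm set" where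
  "factoring C S = {f \<in> Arr C. \<exists>N \<in> S. \<exists>a \<in> hom_set C (Dom C f) N. \<exists>b \<in> hom_set C N (Cod C f).
     f = b \<cdot>\<^bsub>C\<^esub> a}"

text \<open>The congruence of an ideal \<open>I\<close>; only the arrows of \<open>I\<close> that lie in \<open>C\<close> matter.\<close>

definition ideal_congruence :: "('o, 'm, 'z) add_cat_scheme \<Rightarrow> 'm set \<Rightarrow> ('m \<times> 'm) set" where
  "ideal_congruence C I =
    {(f, g). f \<in> Arr C \<and> g \<in> hom_set C (Dom C f) (Cod C f) \<and> Add C f (neg C g) \<in> I}"

section \<open>Triangulated categories\<close>

text \<open>\<open>(f, g, h) \<in> Tri C\<close> means that \<open>X \<rightarrow> Y \<rightarrow> Z \<rightarrow> \<Sigma>X\<close>, with arrows \<open>f\<close>, \<open>g\<close>, \<open>h\<close>,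
  is a (distinguished) triangle.\<close>

record ('o, 'm) tri_cat = "('o, 'm) add_cat" +
  Shift :: "('o, 'm, 'o, 'm) fctr"
  Tri :: "('m \<times> 'm \<times> 'm) set"

abbreviation shift_obj :: "('o, 'm, 'z) tri_cat_scheme \<Rightarrow> 'o \<Rightarrow> 'o" where
  "shift_obj C \<equiv> ObjMap (Shift C)"

abbreviation shift_arr :: "('o, 'm, 'z) tri_cat_scheme \<Rightarrow> 'm \<Rightarrow> 'm" where
  "shift_arr C \<equiv> ArrMap (Shift C)"

definition candidate :: "('o, 'm, 'z) tri_cat_scheme \<Rightarrow> 'm \<Rightarrow> 'm \<Rightarrow> 'm \<Rightarrow> bool" where
  "candidate C f g h \<longleftrightarrow> f \<in> Arr C \<and> g \<in> hom_set C (Cod C f) (Dom C h) \<and>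
     h \<in> hom_set C (Cod C g) (shift_obj C (Dom C f))"

text \<open>The suspension is an additive auto-equivalence; it need not be an automorphism.\<close>

locale triangulated_category = additive_category C
  for C :: "('o, 'm, 'z) tri_cat_scheme" (structure) +
  assumes shift_equivalence: "is_equivalence C C (Shift C)"
    and shift_add: "\<lbrakk>f \<in> hom_set C X Y; g \<in> hom_set C X Y\<rbrakk>
      \<Longrightarrow> shift_arr C (Add C f g) = Add C (shift_arr C f) (shift_arr C g)"
    and tri_candidate: "(f, g, h) \<in> Tri C \<Longrightarrow> candidate C f g h"
    and tri_iso: "\<lbrakk>(f, g, h) \<in> Tri C; candidate C f' g' h'; iso_arr C a; iso_arr C b; iso_arr C c;
        a \<in> hom_set C (Dom C f) (Dom C f'); b \<in> hom_set C (Dom C g) (Dom C g');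
        c \<in> hom_set C (Dom C h) (Dom C h');
        b \<cdot> f = f' \<cdot> a; c \<cdot> g = g' \<cdot> b; shift_arr C a \<cdot> h = h' \<cdot> c\<rbrakk>
      \<Longrightarrow> (f', g', h') \<in> Tri C"
    and tri_idn: "\<lbrakk>X \<in> Obj C; zero_object C N\<rbrakk>
      \<Longrightarrow> (Idn C X, Zero C X N, Zero C N (shift_obj C X)) \<in> Tri C"
    and tri_complete: "f \<in> Arr C \<Longrightarrow> \<exists>g h. (f, g, h) \<in> Tri C"
    and tri_rotate: "candidate C f g h
      \<Longrightarrow> (f, g, h) \<in> Tri C \<longleftrightarrow> (g, h, neg C (shift_arr C f)) \<in> Tri C"
    and tri_morphism: "\<lbrakk>(f, g, h) \<in> Tri C; (f', g', h') \<in> Tri C;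
        a \<in> hom_set C (Dom C f) (Dom C f'); b \<in> hom_set C (Dom C g) (Dom C g'); b \<cdot> f = f' \<cdot> a\<rbrakk>
      \<Longrightarrow> \<exists>c \<in> hom_set C (Dom C h) (Dom C h'). c \<cdot> g = g' \<cdot> b \<and> shift_arr C a \<cdot> h = h' \<cdot> c"
    and tri_octahedron: "\<lbrakk>f \<in> hom_set C X Y; g \<in> hom_set C Y Z;
        (f, u, u') \<in> Tri C; (g \<cdot> f, v, v') \<in> Tri C; (g, w, w') \<in> Tri C\<rbrakk>
      \<Longrightarrow> \<exists>s \<in> hom_set C (Cod C u) (Cod C v). \<exists>t \<in> hom_set C (Cod C v) (Cod C w).
        (s, t, shift_arr C u \<cdot> w') \<in> Tri C \<and> s \<cdot> u = v \<cdot> g \<and> t \<cdot> v = w \<and>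
        v' \<cdot> s = u' \<and> w' \<cdot> t = shift_arr C f \<cdot> v'"

definition rigid :: "('o, 'm, 'z) tri_cat_scheme \<Rightarrow> 'o \<Rightarrow> bool" where
  "rigid C T \<longleftrightarrow> hom_set C T (shift_obj C T) = {Zero C T (shift_obj C T)}"

text \<open>The objects of \<open>T * \<Sigma>T\<close>: cones of arrows between objects of \<open>add T\<close>.\<close>

definition cone_objs :: "('o, 'm, 'z) tri_cat_scheme \<Rightarrow> 'o \<Rightarrow> 'o set" where
  "cone_objs C T = {X. \<exists>f g h. (f, g, h) \<in> Tri C \<and>
     Dom C f \<in> add_objs C T \<and> Cod C f \<in> add_objs C T \<and> Cod C g = X}"

definition localising_class :: "('o, 'm, 'z) tri_cat_scheme \<Rightarrow> 'o \<Rightarrow> 'm set" where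
  "localising_class C T = {f \<in> Arr C. \<forall>g h. (g, f, h) \<in> Tri C \<longrightarrow>
     g \<in> factoring C (perp_objs C T) \<and> h \<in> factoring C (perp_objs C T)}"

end

theory Submission
  imports Defs
begin

text \<open>Write \<open>f \<sim> g\<close> for parallel arrows \<open>f, g\<close> with \<open>C(T,f) = C(T,g)\<close>. The proof rests on translating
  all data into the functor \<open>C(T,-)\<close>. An arrow \<open>f\<close> with \<open>C(T,f) = 0\<close> vanishes on an approximation
  \<open>D \<rightarrow> X\<close> of its domain by \<open>add T\<close>, hence factors through the cone of \<open>D \<rightarrow> X\<close>, which lies in
  \<open>T\<^sup>\<bottom>\<close> because \<open>T\<close> is rigid (\<open>in_perp_ideal_iff\<close>). So \<open>(T\<^sup>\<bottom>)\<close> is the kernel of \<open>C(T,-)\<close>, and the long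
  exact sequence shows that \<open>W\<close> is the class of arrows on which \<open>C(T,-)\<close> is bijective (\<open>in_W_iff\<close>).

  The objects of \<open>T * \<Sigma>T\<close> behave like projectives. If \<open>D1 \<rightarrow> D0 \<rightarrow> P\<close> is a presentation by objects of
  \<open>add T\<close>, then an arrow out of \<open>P\<close> is known up to \<open>\<sim>\<close> from its restriction to \<open>D0\<close>, so that it lifts
  along every arrow in \<open>W\<close>, uniquely up to \<open>\<sim>\<close> (\<open>lift_along_W\<close>, \<open>same_cancel\<close>); and if it is killed by
  \<open>C(T,-)\<close>, it factors through \<open>\<Sigma>D1\<close>. Hence \<open>\<sim>\<close> is the congruence of the ideal \<open>(\<Sigma>T)\<close> on \<open>T * \<Sigma>T\<close>
  (\<open>same_iff_shift\<close>). Moreover, every object \<open>X\<close> has a resolution \<open>P \<rightarrow> X\<close> in \<open>W\<close> with \<open>P\<close> in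
  \<open>T * \<Sigma>T\<close>, obtained by two approximations (\<open>resolution_exists\<close>).

  The localisation functor identifies arrows related by \<open>\<sim>\<close> (\<open>localisation_identifies\<close>), so it induces
  a functor \<open>G\<close> on the quotient. In the other direction, lifting along chosen resolutions is a functor
  from \<open>C\<close> to the quotient that inverts \<open>W\<close>, and the universal property extends it to a functor \<open>K\<close> on the
  localisation. If the objects of \<open>T * \<Sigma>T\<close> are resolved by themselves, \<open>K G\<close> is the identity, and the
  images of the resolutions are a natural isomorphism from \<open>G K\<close> to the identity. Since \<open>K\<close> is faithful
  and the quotient of a locally small category is locally small, so is the localisation. The universal
  property itself is proved for the words that define the localisation of any category.\<close>

section \<open>Inverses, functors and their composites\<close>

lemma hom_setD:
  assumes "f \<in> hom_set C X Y"
  shows "f \<in> Arr C" and "Dom C f = X" and "Cod C f = Y"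
  using assms by (auto simp: hom_set_def)

definition inv_arr :: "('o, 'm, 'z) cat_scheme \<Rightarrow> 'm \<Rightarrow> 'm" where
  "inv_arr C f = (SOME g. g \<in> hom_set C (Cod C f) (Dom C f) \<and>
     g \<cdot>\<^bsub>C\<^esub> f = Idn C (Dom C f) \<and> f \<cdot>\<^bsub>C\<^esub> g = Idn C (Cod C f))"

context category
begin

lemma arr_in_hom: "f \<in> Arr C \<Longrightarrow> f \<in> hom_set C (Dom C f) (Cod C f)"
  by (simp add: hom_set_def)

lemma hom_objs:
  assumes "f \<in> hom_set C X Y"
  shows "X \<in> Obj C" and "Y \<in> Obj C"
  using assms dom_obj cod_obj by (auto simp: hom_set_def)

lemma iso_arrI:
  assumes "f \<in> hom_set C X Y" "g \<in> hom_set C Y X" "g \<cdot> f = Idn C X" "f \<cdot> g = Idn C Y"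
  shows "iso_arr C f"
  using assms unfolding iso_arr_def by (auto simp: hom_set_def)

lemma iso_arrE:
  assumes "iso_arr C f" "f \<in> hom_set C X Y"
  obtains g where "g \<in> hom_set C Y X" "g \<cdot> f = Idn C X" "f \<cdot> g = Idn C Y"
  using assms unfolding iso_arr_def by (auto simp: hom_set_def)

lemma inv_arr:
  assumes "iso_arr C f" "f \<in> hom_set C X Y"
  shows "inv_arr C f \<in> hom_set C Y X" and "inv_arr C f \<cdot> f = Idn C X" and "f \<cdot> inv_arr C f = Idn C Y"
proof -
  have "\<exists>g. g \<in> hom_set C (Cod C f) (Dom C f) \<and> g \<cdot> f = Idn C (Dom C f) \<and> f \<cdot> g = Idn C (Cod C f)"
    using assms(1) unfolding iso_arr_def by blast
  from someI_ex[OF this] show "inv_arr C f \<in> hom_set C Y X" "inv_arr C f \<cdot> f = Idn C X"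
    "f \<cdot> inv_arr C f = Idn C Y"
    using hom_setD[OF assms(2)] unfolding inv_arr_def by simp_all
qed

lemma inverse_unique:
  assumes "f \<in> hom_set C X Y" "g \<in> hom_set C Y X" "g' \<in> hom_set C Y X"
    and "g \<cdot> f = Idn C X" "f \<cdot> g' = Idn C Y"
  shows "g = g'"
proof -
  have "g = g \<cdot> (f \<cdot> g')" using assms(2,5) cmp_idn by simp
  also have "\<dots> = (g \<cdot> f) \<cdot> g'" using cmp_assoc[OF assms(3,1,2)] by simp
  also have "\<dots> = g'" using assms(3,4) idn_cmp by simp
  finally show ?thesis .
qed

lemma iso_idn: "X \<in> Obj C \<Longrightarrow> iso_arr C (Idn C X)"
  by (rule iso_arrI[of _ X X "Idn C X"]) (auto intro: idn_hom cmp_idn[OF idn_hom])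

lemma iso_cancel_left:
  assumes "iso_arr C a" "a \<in> hom_set C Y Z" "f \<in> hom_set C X Y" "g \<in> hom_set C X Y" "a \<cdot> f = a \<cdot> g"
  shows "f = g"
proof -
  obtain b where b: "b \<in> hom_set C Z Y" "b \<cdot> a = Idn C Y" using iso_arrE[OF assms(1,2)] .
  have "f = (b \<cdot> a) \<cdot> f" using idn_cmp[OF assms(3)] b(2) by simp
  also have "\<dots> = (b \<cdot> a) \<cdot> g"
    unfolding cmp_assoc[OF assms(3,2) b(1)] cmp_assoc[OF assms(4,2) b(1)] assms(5) ..
  also have "\<dots> = g" using idn_cmp[OF assms(4)] b(2) by simp
  finally show ?thesis .
qed

lemma iso_cancel_right:
  assumes "iso_arr C a" "a \<in> hom_set C X Y" "f \<in> hom_set C Y Z" "g \<in> hom_set C Y Z" "f \<cdot> a = g \<cdot> a"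
  shows "f = g"
proof -
  obtain b where b: "b \<in> hom_set C Y X" "a \<cdot> b = Idn C Y" using iso_arrE[OF assms(1,2)] .
  have "f = f \<cdot> (a \<cdot> b)" using cmp_idn[OF assms(3)] b(2) by simp
  also have "\<dots> = g \<cdot> (a \<cdot> b)"
    unfolding cmp_assoc[OF b(1) assms(2,3), symmetric] cmp_assoc[OF b(1) assms(2,4), symmetric] assms(5) ..
  also have "\<dots> = g" using cmp_idn[OF assms(4)] b(2) by simp
  finally show ?thesis .
qed

end

lemma full_subcat_simps [simp]:
  "Obj (full_subcat C S) = S"
  "Arr (full_subcat C S) = {f \<in> Arr C. Dom C f \<in> S \<and> Cod C f \<in> S}"
  "Dom (full_subcat C S) = Dom C" "Cod (full_subcat C S) = Cod C"
  "Idn (full_subcat C S) = Idn C" "Cmp (full_subcat C S) = Cmp C"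
  by (simp_all add: full_subcat_def)

lemma hom_full_subcat:
  "\<lbrakk>X \<in> S; Y \<in> S\<rbrakk> \<Longrightarrow> hom_set (full_subcat C S) X Y = hom_set C X Y"
  by (auto simp: hom_set_def)

lemma hom_full_subcatD:
  assumes "f \<in> hom_set (full_subcat C S) X Y"
  shows "f \<in> hom_set C X Y" "X \<in> S" "Y \<in> S"
  using assms by (auto simp: hom_set_def)

lemma category_full_subcat:
  assumes "category C" "S \<subseteq> Obj C"
  shows "category (full_subcat C S)"
proof -
  interpret category C by fact
  show ?thesis
  proof
    fix f X Y g Z h V
    assume f: "f \<in> hom_set (full_subcat C S) X Y"
    show "f \<cdot>\<^bsub>full_subcat C S\<^esub> Idn (full_subcat C S) X = f"
      "Idn (full_subcat C S) Y \<cdot>\<^bsub>full_subcat C S\<^esub> f = f"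
      using f[THEN hom_full_subcatD(1)] by (simp_all add: cmp_idn idn_cmp)
    assume g: "g \<in> hom_set (full_subcat C S) Y Z"
    show "g \<cdot>\<^bsub>full_subcat C S\<^esub> f \<in> hom_set (full_subcat C S) X Z"
      using hom_full_subcatD[OF f] hom_full_subcatD[OF g] cmp_hom by (simp add: hom_full_subcat)
    assume h: "h \<in> hom_set (full_subcat C S) Z V"
    show "(h \<cdot>\<^bsub>full_subcat C S\<^esub> g) \<cdot>\<^bsub>full_subcat C S\<^esub> f
        = h \<cdot>\<^bsub>full_subcat C S\<^esub> (g \<cdot>\<^bsub>full_subcat C S\<^esub> f)"
      using f g h by (auto dest!: hom_full_subcatD(1) intro: cmp_assoc)
  qed (use assms(2) in \<open>auto simp: hom_full_subcat idn_hom\<close>)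
qed

lemma fctr_eqI:
  fixes F G :: "('o, 'm, 'p, 'n) fctr"
  shows "\<lbrakk>ObjMap F = ObjMap G; ArrMap F = ArrMap G\<rbrakk> \<Longrightarrow> F = G"
  by (cases F; cases G) simp

lemma functor_eqI:
  assumes "is_functor C D F" "is_functor C D G"
    and "\<And>X. X \<in> Obj C \<Longrightarrow> ObjMap F X = ObjMap G X" "\<And>f. f \<in> Arr C \<Longrightarrow> ArrMap F f = ArrMap G f"
  shows "F = G"
proof (rule fctr_eqI)
  show "ObjMap F = ObjMap G"
    by (rule PiE_ext[OF is_functor.obj_map[OF assms(1)] is_functor.obj_map[OF assms(2)] assms(3)])
  show "ArrMap F = ArrMap G"
    by (rule PiE_ext[OF is_functor.arr_map[OF assms(1)] is_functor.arr_map[OF assms(2)] assms(4)])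
qed

lemma functor_comp_simps:
  "X \<in> Obj C \<Longrightarrow> ObjMap (functor_comp C G F) X = ObjMap G (ObjMap F X)"
  "f \<in> Arr C \<Longrightarrow> ArrMap (functor_comp C G F) f = ArrMap G (ArrMap F f)"
  by (simp_all add: functor_comp_def compose_eq)

context is_functor
begin

lemma map_obj: "X \<in> Obj C \<Longrightarrow> ObjMap F X \<in> Obj D"
  using obj_map by auto

end

lemma is_functor_comp:
  assumes "is_functor C D F" "is_functor D E G"
  shows "is_functor C E (functor_comp C G F)"
proof -
  interpret F: is_functor C D F by fact
  interpret G: is_functor D E G by fact
  show ?thesis
  proof unfold_locales
    show "ObjMap (functor_comp C G F) \<in> Obj C \<rightarrow>\<^sub>E Obj E"
      using F.obj_map G.obj_map by (auto simp: functor_comp_def compose_def)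
    show "ArrMap (functor_comp C G F) \<in> Arr C \<rightarrow>\<^sub>E Arr E"
      using F.arr_map G.arr_map by (auto simp: functor_comp_def compose_def)
    show "ArrMap (functor_comp C G F) f \<in> hom_set E (ObjMap (functor_comp C G F) X) (ObjMap (functor_comp C G F) Y)"
      if "f \<in> hom_set C X Y" for f X Y
      using that G.map_hom[OF F.map_hom[OF that]] F.C.hom_objs[OF that] hom_setD[OF that]
      by (simp add: functor_comp_simps)
    show "ArrMap (functor_comp C G F) (Idn C X) = Idn E (ObjMap (functor_comp C G F) X)" if "X \<in> Obj C" for X
      using that F.C.idn_hom[OF that] by (simp add: functor_comp_simps hom_setD F.map_idn G.map_idn F.map_obj)
    show "ArrMap (functor_comp C G F) (g \<cdot>\<^bsub>C\<^esub> f) = ArrMap (functor_comp C G F) g \<cdot>\<^bsub>E\<^esub> ArrMap (functor_comp C G F) f"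
      if "f \<in> hom_set C X Y" "g \<in> hom_set C Y Z" for f g X Y Z
      using F.C.cmp_hom[OF that] hom_setD[OF that(1)] hom_setD[OF that(2)]
        G.map_cmp[OF F.map_hom[OF that(1)] F.map_hom[OF that(2)]] F.map_cmp[OF that]
      by (simp add: functor_comp_simps hom_setD)
  qed
qed

lemma inclusion_functor:
  assumes "category C" "S \<subseteq> Obj C"
  shows "is_functor (full_subcat C S) C (inclusion (full_subcat C S))"
proof -
  interpret category C by fact
  interpret S: category "full_subcat C S" by (rule category_full_subcat[OF assms])
  show ?thesis
  proof unfold_locales
    show "ArrMap (inclusion (full_subcat C S)) (g \<cdot>\<^bsub>full_subcat C S\<^esub> f) =
      ArrMap (inclusion (full_subcat C S)) g \<cdot>\<^bsub>C\<^esub> ArrMap (inclusion (full_subcat C S)) f"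
      if "f \<in> hom_set (full_subcat C S) X Y" "g \<in> hom_set (full_subcat C S) Y Z" for f g X Y Z
      using hom_setD(1)[OF S.cmp_hom[OF that]] hom_setD(1)[OF that(1)] hom_setD(1)[OF that(2)]
      by (simp add: inclusion_def)
    show "ArrMap (inclusion (full_subcat C S)) (Idn (full_subcat C S) X) = Idn C (ObjMap (inclusion (full_subcat C S)) X)"
      if "X \<in> Obj (full_subcat C S)" for X
      using hom_setD[OF S.idn_hom[OF that]] that by (simp add: inclusion_def)
  qed (use assms(2) in \<open>auto simp: inclusion_def hom_set_def\<close>)
qed

lemma id_functor_is_functor:
  assumes "category C"
  shows "is_functor C C (id_functor C)"
proof -
  interpret category C by fact
  show ?thesis
  proof unfold_locales
    show "ArrMap (inclusion C) (g \<cdot>\<^bsub>C\<^esub> f) = ArrMap (inclusion C) g \<cdot>\<^bsub>C\<^esub> ArrMap (inclusion C) f"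
      if "f \<in> hom_set C X Y" "g \<in> hom_set C Y Z" for f g X Y Z
      using hom_setD(1)[OF cmp_hom[OF that]] hom_setD(1)[OF that(1)] hom_setD(1)[OF that(2)]
      by (simp add: inclusion_def)
    show "ArrMap (inclusion C) (Idn C X) = Idn C (ObjMap (inclusion C) X)" if "X \<in> Obj C" for X
      using hom_setD[OF idn_hom[OF that]] that by (simp add: inclusion_def)
  qed (auto simp: inclusion_def hom_set_def dom_obj cod_obj)
qed

lemma natural_iso_refl:
  assumes "is_functor C D F"
  shows "natural_iso C D F F (\<lambda>X. Idn D (ObjMap F X))"
proof -
  interpret F: is_functor C D F by fact
  have "Idn D (ObjMap F (Cod C f)) \<cdot>\<^bsub>D\<^esub> ArrMap F f = ArrMap F f \<cdot>\<^bsub>D\<^esub> Idn D (ObjMap F (Dom C f))"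
    if "f \<in> Arr C" for f
    using F.map_hom[OF F.C.arr_in_hom[OF that]] F.D.idn_cmp F.D.cmp_idn by metis
  then show ?thesis
    unfolding natural_iso_def using F.D.idn_hom F.D.iso_idn F.map_obj by blast
qed

text \<open>The isomorphisms \<open>G F X \<rightarrow> X\<close> recover an arrow from its image under \<open>F\<close>.\<close>

lemma faithful_if_natural_iso:
  assumes F: "is_functor C D F" and G: "is_functor D C G"
    and nat: "natural_iso C C (functor_comp C G F) (id_functor C) \<epsilon>"
    and f: "f \<in> hom_set C X Y" and g: "g \<in> hom_set C X Y" and eq: "ArrMap F f = ArrMap F g"
  shows "f = g"
proof -
  interpret F: is_functor C D F by fact
  note fX = F.C.hom_objs[OF f]
  have e: "\<epsilon> X \<in> hom_set C (ObjMap (functor_comp C G F) X) X" "iso_arr C (\<epsilon> X)"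
    using nat fX(1) by (auto simp: natural_iso_def inclusion_def)
  have "f \<cdot>\<^bsub>C\<^esub> \<epsilon> X = \<epsilon> Y \<cdot>\<^bsub>C\<^esub> ArrMap G (ArrMap F f)" "g \<cdot>\<^bsub>C\<^esub> \<epsilon> X = \<epsilon> Y \<cdot>\<^bsub>C\<^esub> ArrMap G (ArrMap F g)"
    using nat hom_setD[OF f] hom_setD[OF g]
    by (auto simp: natural_iso_def inclusion_def functor_comp_simps)
  then show ?thesis using F.C.iso_cancel_right[OF e(2,1) f g] eq by simp
qed

text \<open>Only fullness needs an idea: the preimage of \<open>u\<close> is the conjugate \<open>f\<close> of \<open>G u\<close> by the isomorphisms
  \<open>X \<rightarrow> G F X\<close>. By naturality \<open>G F f = G u\<close>, and \<open>G\<close> is faithful.\<close>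

lemma equivalence_props:
  assumes "is_equivalence C D F"
  shows "\<lbrakk>f \<in> hom_set C X Y; g \<in> hom_set C X Y; ArrMap F f = ArrMap F g\<rbrakk> \<Longrightarrow> f = g"
    and "\<lbrakk>X \<in> Obj C; Y \<in> Obj C; u \<in> hom_set D (ObjMap F X) (ObjMap F Y)\<rbrakk>
      \<Longrightarrow> \<exists>f \<in> hom_set C X Y. ArrMap F f = u"
    and "Z \<in> Obj D \<Longrightarrow> \<exists>X \<in> Obj C. \<exists>e \<in> hom_set D (ObjMap F X) Z. iso_arr D e"
proof -
  obtain G \<eta> \<epsilon> where F: "is_functor C D F" and G: "is_functor D C G"
    and eta: "natural_iso C C (id_functor C) (functor_comp C G F) \<eta>"
    and eps: "natural_iso D D (functor_comp D F G) (id_functor D) \<epsilon>"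
    using assms unfolding is_equivalence_def by blast
  interpret F: is_functor C D F by fact
  interpret G: is_functor D C G by fact
  have etaX: "\<eta> X \<in> hom_set C X (ObjMap G (ObjMap F X))" "iso_arr C (\<eta> X)" if "X \<in> Obj C" for X
    using eta that by (auto simp: natural_iso_def inclusion_def functor_comp_simps)
  have sq: "\<eta> Y \<cdot>\<^bsub>C\<^esub> f = ArrMap G (ArrMap F f) \<cdot>\<^bsub>C\<^esub> \<eta> X" if "f \<in> hom_set C X Y" for f X Y
    using eta hom_setD[OF that] by (auto simp: natural_iso_def inclusion_def functor_comp_simps)
  show "f = g" if f: "f \<in> hom_set C X Y" and g: "g \<in> hom_set C X Y" and eq: "ArrMap F f = ArrMap F g"
    for f g
  proof -
    have Y: "Y \<in> Obj C" using F.C.hom_objs[OF f] by simp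
    show ?thesis using F.C.iso_cancel_left[OF etaX(2,1)[OF Y] f g] sq[OF f] sq[OF g] eq by simp
  qed
  show "\<exists>f \<in> hom_set C X Y. ArrMap F f = u"
    if X: "X \<in> Obj C" and Y: "Y \<in> Obj C" and u: "u \<in> hom_set D (ObjMap F X) (ObjMap F Y)"
  proof -
    obtain b where b: "b \<in> hom_set C (ObjMap G (ObjMap F Y)) Y" "\<eta> Y \<cdot>\<^bsub>C\<^esub> b = Idn C (ObjMap G (ObjMap F Y))"
      using F.C.iso_arrE[OF etaX(2,1)[OF Y]] .
    have Gu: "ArrMap G u \<in> hom_set C (ObjMap G (ObjMap F X)) (ObjMap G (ObjMap F Y))"
      using G.map_hom[OF u] .
    define k where "k = ArrMap G u \<cdot>\<^bsub>C\<^esub> \<eta> X"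
    have k: "k \<in> hom_set C X (ObjMap G (ObjMap F Y))"
      unfolding k_def by (rule F.C.cmp_hom[OF etaX(1)[OF X] Gu])
    define f where "f = b \<cdot>\<^bsub>C\<^esub> k"
    have f: "f \<in> hom_set C X Y" unfolding f_def by (rule F.C.cmp_hom[OF k b(1)])
    have "\<eta> Y \<cdot>\<^bsub>C\<^esub> f = k" unfolding f_def
      using F.C.cmp_assoc[OF k b(1) etaX(1)[OF Y]] b(2) F.C.idn_cmp[OF k] by simp
    then have "ArrMap G (ArrMap F f) \<cdot>\<^bsub>C\<^esub> \<eta> X = ArrMap G u \<cdot>\<^bsub>C\<^esub> \<eta> X"
      using sq[OF f] k_def by simp
    then have "ArrMap G (ArrMap F f) = ArrMap G u"
      using F.C.iso_cancel_right[OF etaX(2,1)[OF X] G.map_hom[OF F.map_hom[OF f]] Gu] by simp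
    then have "ArrMap F f = u"
      using faithful_if_natural_iso[OF G F eps F.map_hom[OF f] u] by simp
    then show ?thesis using f by blast
  qed
  show "\<exists>X \<in> Obj C. \<exists>e \<in> hom_set D (ObjMap F X) Z. iso_arr D e" if "Z \<in> Obj D"
    using eps that G.map_obj[OF that] by (auto simp: natural_iso_def inclusion_def functor_comp_simps)
qed

section \<open>Quotient by a congruence\<close>

locale category_congruence = category C
  for C :: "('o, 'm, 'z) cat_scheme" (structure) +
  fixes R :: "('m \<times> 'm) set"
  assumes equiv: "equiv (Arr C) R"
    and parallel: "(f, g) \<in> R \<Longrightarrow> Dom C f = Dom C g \<and> Cod C f = Cod C g"
    and cong_cmp: "\<lbrakk>(f, f') \<in> R; (g, g') \<in> R; Cod C f = Dom C g\<rbrakk> \<Longrightarrow> (g \<cdot> f, g' \<cdot> f') \<in> R"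
begin

abbreviation "Q \<equiv> quotient_cat C R"

lemma cong_refl: "f \<in> Arr C \<Longrightarrow> (f, f) \<in> R"
  using equiv by (auto simp: equiv_def refl_on_def)

lemma cong_arr: "(f, g) \<in> R \<Longrightarrow> f \<in> Arr C \<and> g \<in> Arr C"
  using equiv by (auto simp: equiv_def)

lemma quotient_simps:
  "Obj Q = Obj C" "Arr Q = Arr C // R" "Idn Q X = R `` {Idn C X}"
  by (simp_all add: quotient_cat_def)

lemma quotient_arrE:
  assumes "c \<in> Arr Q"
  obtains f where "f \<in> Arr C" "c = R `` {f}"
  using assms unfolding quotient_simps by (metis quotientE)

lemma class_ends:
  assumes "f \<in> Arr C"
  shows "Dom Q (R `` {f}) = Dom C f" and "Cod Q (R `` {f}) = Cod C f"
proof -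
  have f: "f \<in> R `` {f}" using cong_refl[OF assms] by simp
  have "Dom C ` R `` {f} = (\<lambda>_. Dom C f) ` R `` {f}" "Cod C ` R `` {f} = (\<lambda>_. Cod C f) ` R `` {f}"
    by (rule image_cong[OF HOL.refl]; drule Image_singleton_iff[THEN iffD1]; drule parallel; simp)+
  then have "Dom C ` R `` {f} = {Dom C f}" "Cod C ` R `` {f} = {Cod C f}"
    using image_constant[OF f] by metis+
  then show "Dom Q (R `` {f}) = Dom C f" "Cod Q (R `` {f}) = Cod C f"
    by (simp_all add: quotient_cat_def)
qed

lemma class_hom: "f \<in> hom_set C X Y \<Longrightarrow> R `` {f} \<in> hom_set Q X Y"
  using class_ends[of f] by (auto simp: hom_set_def quotient_simps intro: quotientI)

lemma hom_class:
  assumes "c \<in> hom_set Q X Y"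
  obtains f where "f \<in> hom_set C X Y" "c = R `` {f}"
proof -
  obtain f where f: "f \<in> Arr C" "c = R `` {f}"
    using quotient_arrE[OF hom_setD(1)[OF assms]] by blast
  then show ?thesis using that[of f] class_ends[of f] assms by (auto simp: hom_set_def)
qed

lemma class_cmp:
  assumes "f \<in> hom_set C X Y" "g \<in> hom_set C Y Z"
  shows "R `` {g} \<cdot>\<^bsub>Q\<^esub> R `` {f} = R `` {g \<cdot> f}"
proof -
  have fg: "f \<in> Arr C" "g \<in> Arr C" "Cod C f = Dom C g" using assms by (auto simp: hom_set_def)
  have eq: "R `` {g' \<cdot> f'} = R `` {g \<cdot> f}" if "g' \<in> R `` {g}" "f' \<in> R `` {f}" for f' g'
    using that by (intro equiv_class_eq[OF equiv cong_cmp[OF _ _ fg(3)], symmetric]) simp_all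
  have "R `` {g} \<cdot>\<^bsub>Q\<^esub> R `` {f} = (\<Union>g' \<in> R `` {g}. \<Union>f' \<in> R `` {f}. R `` {g' \<cdot> f'})"
    by (simp only: quotient_cat_def cat.simps)
  also have "\<dots> = (\<Union>g' \<in> R `` {g}. \<Union>f' \<in> R `` {f}. R `` {g \<cdot> f})"
    by (intro SUP_cong HOL.refl eq)
  also have "\<dots> = R `` {g \<cdot> f}"
    using equiv_class_self[OF equiv fg(1)] equiv_class_self[OF equiv fg(2)] by blast
  finally show ?thesis .
qed

lemma category_quotient: "category Q"
proof
  fix X assume "X \<in> Obj Q"
  then show "Idn Q X \<in> hom_set Q X X" by (simp add: quotient_simps class_hom idn_hom)
next
  fix f X Y g Z assume f: "f \<in> hom_set Q X Y" and g: "g \<in> hom_set Q Y Z"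
  obtain f' where f': "f' \<in> hom_set C X Y" "f = R `` {f'}" using f by (rule hom_class)
  obtain g' where g': "g' \<in> hom_set C Y Z" "g = R `` {g'}" using g by (rule hom_class)
  show "g \<cdot>\<^bsub>Q\<^esub> f \<in> hom_set Q X Z"
    unfolding f'(2) g'(2) class_cmp[OF f'(1) g'(1)] by (rule class_hom[OF cmp_hom[OF f'(1) g'(1)]])
  fix h V assume "h \<in> hom_set Q Z V"
  then obtain h' where h': "h' \<in> hom_set C Z V" "h = R `` {h'}" by (rule hom_class)
  show "(h \<cdot>\<^bsub>Q\<^esub> g) \<cdot>\<^bsub>Q\<^esub> f = h \<cdot>\<^bsub>Q\<^esub> (g \<cdot>\<^bsub>Q\<^esub> f)"
    unfolding f'(2) g'(2) h'(2) class_cmp[OF f'(1) g'(1)] class_cmp[OF g'(1) h'(1)]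
      class_cmp[OF f'(1) cmp_hom[OF g'(1) h'(1)]] class_cmp[OF cmp_hom[OF f'(1) g'(1)] h'(1)]
      cmp_assoc[OF f'(1) g'(1) h'(1)] ..
next
  fix f X Y assume f: "f \<in> hom_set Q X Y"
  then obtain f' where f': "f' \<in> hom_set C X Y" "f = R `` {f'}" by (rule hom_class)
  note o = hom_objs[OF f'(1)]
  show "f \<cdot>\<^bsub>Q\<^esub> Idn Q X = f"
    using class_cmp[OF idn_hom[OF o(1)] f'(1)] f' by (simp add: quotient_simps cmp_idn)
  show "Idn Q Y \<cdot>\<^bsub>Q\<^esub> f = f"
    using class_cmp[OF f'(1) idn_hom[OF o(2)]] f' by (simp add: quotient_simps idn_cmp)
next
  fix f assume "f \<in> Arr Q"
  then obtain f' where f': "f' \<in> Arr C" "f = R `` {f'}" by (rule quotient_arrE)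
  show "Dom Q f \<in> Obj Q" "Cod Q f \<in> Obj Q"
    unfolding f'(2) class_ends[OF f'(1)] quotient_simps by (simp_all add: dom_obj cod_obj f'(1))
qed

sublocale quotient: category Q
  by (rule category_quotient)

lemma quotient_functor_simps:
  "X \<in> Obj C \<Longrightarrow> ObjMap (quotient_functor C R) X = X"
  "f \<in> Arr C \<Longrightarrow> ArrMap (quotient_functor C R) f = R `` {f}"
  by (simp_all add: quotient_functor_def)

lemma quotient_functor: "is_functor C Q (quotient_functor C R)"
proof
  show "ObjMap (quotient_functor C R) \<in> Obj C \<rightarrow>\<^sub>E Obj Q"
    "ArrMap (quotient_functor C R) \<in> Arr C \<rightarrow>\<^sub>E Arr Q"
    by (auto simp: quotient_functor_def quotient_simps quotientI)
  show "ArrMap (quotient_functor C R) f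
      \<in> hom_set Q (ObjMap (quotient_functor C R) X) (ObjMap (quotient_functor C R) Y)"
    if "f \<in> hom_set C X Y" for f X Y
    using class_hom[OF that] hom_objs[OF that] hom_setD(1)[OF that] by (simp add: quotient_functor_simps)
  show "ArrMap (quotient_functor C R) (Idn C X) = Idn Q (ObjMap (quotient_functor C R) X)"
    if "X \<in> Obj C" for X
    using that hom_setD[OF idn_hom[OF that]] by (simp add: quotient_functor_simps quotient_simps)
  show "ArrMap (quotient_functor C R) (g \<cdot> f)
      = ArrMap (quotient_functor C R) g \<cdot>\<^bsub>Q\<^esub> ArrMap (quotient_functor C R) f"
    if "f \<in> hom_set C X Y" "g \<in> hom_set C Y Z" for f g X Y Z
    using hom_setD(1)[OF that(1)] hom_setD(1)[OF that(2)] hom_setD(1)[OF cmp_hom[OF that]] class_cmp[OF that]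
    by (simp add: quotient_functor_simps)
qed

lemma quotient_functor_unique:
  assumes "is_functor Q E G" "is_functor Q E G'"
    and "functor_comp C G (quotient_functor C R) = functor_comp C G' (quotient_functor C R)"
  shows "G = G'"
proof (rule functor_eqI[OF assms(1,2)])
  fix X assume "X \<in> Obj Q"
  then show "ObjMap G X = ObjMap G' X"
    using arg_cong[OF assms(3), of "\<lambda>F. ObjMap F X"]
    by (simp add: functor_comp_simps quotient_functor_simps quotient_simps)
next
  fix c assume "c \<in> Arr Q"
  then obtain f where f: "f \<in> Arr C" "c = R `` {f}" by (rule quotient_arrE)
  then show "ArrMap G c = ArrMap G' c"
    using arg_cong[OF assms(3), of "\<lambda>F. ArrMap F f"]
    by (simp add: functor_comp_simps quotient_functor_simps)
qed

text \<open>The functor on the quotient evaluates an arbitrary representative of a class.\<close>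

lemma quotient_universal:
  assumes "is_functor C E F" and resp: "\<And>f g. (f, g) \<in> R \<Longrightarrow> ArrMap F f = ArrMap F g"
  shows "\<exists>!G. is_functor Q E G \<and> functor_comp C G (quotient_functor C R) = F"
proof -
  interpret F: is_functor C E F by fact
  define G where "G = \<lparr>ObjMap = ObjMap F, ArrMap = (\<lambda>c \<in> Arr Q. ArrMap F (SOME f. f \<in> c))\<rparr>"
  have val: "ArrMap G (R `` {f}) = ArrMap F f" if "f \<in> Arr C" for f
  proof -
    have "(SOME g. g \<in> R `` {f}) \<in> R `` {f}" by (rule someI[of _ f]) (simp add: cong_refl that)
    then show ?thesis using resp that by (auto simp: G_def quotient_simps quotientI)
  qed
  have G: "is_functor Q E G"
  proof
    show "ObjMap G \<in> Obj Q \<rightarrow>\<^sub>E Obj E" using F.obj_map by (simp add: G_def quotient_simps)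
    have "ArrMap G c \<in> Arr E" if c: "c \<in> Arr Q" for c
    proof -
      obtain f where f: "f \<in> Arr C" "c = R `` {f}" using c by (rule quotient_arrE)
      then show ?thesis using val F.arr_map by auto
    qed
    then show "ArrMap G \<in> Arr Q \<rightarrow>\<^sub>E Arr E" by (auto simp: G_def)
  next
    fix c X Y assume "c \<in> hom_set Q X Y"
    then obtain f where f: "f \<in> hom_set C X Y" "c = R `` {f}" by (rule hom_class)
    then show "ArrMap G c \<in> hom_set E (ObjMap G X) (ObjMap G Y)"
      using val[OF hom_setD(1)[OF f(1)]] F.map_hom[OF f(1)] by simp (simp add: G_def)
  next
    fix X assume "X \<in> Obj Q"
    then have X: "X \<in> Obj C" by (simp add: quotient_simps)
    show "ArrMap G (Idn Q X) = Idn E (ObjMap G X)"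
      using val[OF hom_setD(1)[OF idn_hom[OF X]]] F.map_idn[OF X] by (simp add: quotient_simps) (simp add: G_def)
  next
    fix c X Y d Z assume c: "c \<in> hom_set Q X Y" and d: "d \<in> hom_set Q Y Z"
    obtain f where f: "f \<in> hom_set C X Y" "c = R `` {f}" using c by (rule hom_class)
    obtain g where g: "g \<in> hom_set C Y Z" "d = R `` {g}" using d by (rule hom_class)
    show "ArrMap G (d \<cdot>\<^bsub>Q\<^esub> c) = ArrMap G d \<cdot>\<^bsub>E\<^esub> ArrMap G c"
      using class_cmp[OF f(1) g(1)] val[OF hom_setD(1)[OF f(1)]] val[OF hom_setD(1)[OF g(1)]]
        val[OF hom_setD(1)[OF cmp_hom[OF f(1) g(1)]]] F.map_cmp[OF f(1) g(1)] f(2) g(2) by simp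
  qed
  have eq: "functor_comp C G (quotient_functor C R) = F"
  proof (rule functor_eqI[OF is_functor_comp[OF quotient_functor G] assms(1)])
    show "ObjMap (functor_comp C G (quotient_functor C R)) X = ObjMap F X" if "X \<in> Obj C" for X
      using that by (simp add: functor_comp_simps quotient_functor_simps) (simp add: G_def)
    show "ArrMap (functor_comp C G (quotient_functor C R)) f = ArrMap F f" if "f \<in> Arr C" for f
      using that by (simp add: functor_comp_simps quotient_functor_simps val)
  qed
  show ?thesis
  proof (rule ex1I[of _ G])
    fix G' assume "is_functor Q E G' \<and> functor_comp C G' (quotient_functor C R) = F"
    then show "G' = G" using quotient_functor_unique[of E G' G] G eq by simp
  qed (use G eq in simp)
qed

end

lemma congruence_closure_props:
  assumes "category C" and R: "\<And>f g. (f, g) \<in> R \<Longrightarrow> f \<in> Arr C \<and> g \<in> hom_set C (Dom C f) (Cod C f)"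
    and "(f, g) \<in> congruence_closure C R"
  shows "f \<in> Arr C" and "g \<in> hom_set C (Dom C f) (Cod C f)"
proof -
  interpret category C by fact
  have "f \<in> Arr C \<and> g \<in> hom_set C (Dom C f) (Cod C f)"
    using assms(3)
  proof induction
    case (cmp f f' g g')
    then have "f \<in> hom_set C (Dom C f) (Dom C g)" "g \<in> hom_set C (Dom C g) (Cod C g)"
      "f' \<in> hom_set C (Dom C f) (Dom C g)" "g' \<in> hom_set C (Dom C g) (Cod C g)"
      by (auto simp: hom_set_def)
    then have "g \<cdot>\<^bsub>C\<^esub> f \<in> hom_set C (Dom C f) (Cod C g)" "g' \<cdot>\<^bsub>C\<^esub> f' \<in> hom_set C (Dom C f) (Cod C g)"
      using cmp_hom by blast+
    then show ?case by (simp add: hom_set_def)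
  qed (auto simp: hom_set_def dest: R)
  then show "f \<in> Arr C" "g \<in> hom_set C (Dom C f) (Cod C f)" by blast+
qed

lemma category_congruence_closure:
  assumes "category C" and R: "\<And>f g. (f, g) \<in> R \<Longrightarrow> f \<in> Arr C \<and> g \<in> hom_set C (Dom C f) (Cod C f)"
  shows "category_congruence C (congruence_closure C R)"
proof -
  interpret category C by fact
  have props: "f \<in> Arr C" "g \<in> hom_set C (Dom C f) (Cod C f)" if "(f, g) \<in> congruence_closure C R" for f g
    using congruence_closure_props[OF assms(1) _ that] R by blast+
  show ?thesis
  proof
    show "equiv (Arr C) (congruence_closure C R)"
    proof (rule equivI)
      show "congruence_closure C R \<subseteq> Arr C \<times> Arr C" using props by (auto simp: hom_set_def)
      show "refl_on (Arr C) (congruence_closure C R)" by (auto simp: refl_on_def intro: congruence_closure.refl)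
      show "sym (congruence_closure C R)" by (auto simp: sym_def intro: congruence_closure.sym)
      show "Relation.trans (congruence_closure C R)" by (rule transI) (rule congruence_closure.trans)
    qed
  next
    fix f g assume "(f, g) \<in> congruence_closure C R"
    then show "Dom C f = Dom C g \<and> Cod C f = Cod C g" using props(2) by (auto simp: hom_set_def)
  next
    fix f f' g g' assume "(f, f') \<in> congruence_closure C R" "(g, g') \<in> congruence_closure C R"
      "Cod C f = Dom C g"
    then show "(g \<cdot>\<^bsub>C\<^esub> f, g' \<cdot>\<^bsub>C\<^esub> f') \<in> congruence_closure C R" by (rule congruence_closure.cmp)
  qed
qed

lemma functor_respects_closure:
  assumes "is_functor C E F" and R: "\<And>f g. (f, g) \<in> R \<Longrightarrow> f \<in> Arr C \<and> g \<in> hom_set C (Dom C f) (Cod C f)"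
    and resp: "\<And>f g. (f, g) \<in> R \<Longrightarrow> ArrMap F f = ArrMap F g"
    and "(f, g) \<in> congruence_closure C R"
  shows "ArrMap F f = ArrMap F g"
proof -
  interpret F: is_functor C E F by fact
  have props: "f \<in> Arr C" "g \<in> hom_set C (Dom C f) (Cod C f)" if "(f, g) \<in> congruence_closure C R" for f g
    using congruence_closure_props[OF F.C.category_axioms _ that] R by blast+
  show ?thesis using assms(4)
  proof induction
    case (cmp f f' g g')
    have "f \<in> hom_set C (Dom C f) (Dom C g)" "g \<in> hom_set C (Dom C g) (Cod C g)"
      "f' \<in> hom_set C (Dom C f) (Dom C g)" "g' \<in> hom_set C (Dom C g) (Cod C g)"
      using props[OF cmp(1)] props[OF cmp(2)] cmp(3) by (auto simp: hom_set_def)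
    then show ?case using F.map_cmp cmp.IH by metis
  qed (auto dest: resp)
qed

section \<open>The localisation at a class of arrows\<close>

lemma localisation_relation_cases [consumes 1, case_names idn cmp fwd_bwd bwd_fwd]:
  assumes "(a, b) \<in> localisation_relations C W"
    and "\<And>X. X \<in> Obj C \<Longrightarrow> \<Phi> (X, [Fwd (Idn C X)], X) (X, [], X)"
    and "\<And>f X Y g Z. \<lbrakk>f \<in> hom_set C X Y; g \<in> hom_set C Y Z\<rbrakk>
      \<Longrightarrow> \<Phi> (X, [Fwd f, Fwd g], Z) (X, [Fwd (g \<cdot>\<^bsub>C\<^esub> f)], Z)"
    and "\<And>w X Y. \<lbrakk>w \<in> W; w \<in> hom_set C X Y\<rbrakk> \<Longrightarrow> \<Phi> (X, [Fwd w, Bwd w], X) (X, [], X)"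
    and "\<And>w X Y. \<lbrakk>w \<in> W; w \<in> hom_set C X Y\<rbrakk> \<Longrightarrow> \<Phi> (Y, [Bwd w, Fwd w], Y) (Y, [], Y)"
  shows "\<Phi> a b"
proof -
  obtain X w Y X' w' Y' where [simp]: "a = (X, w, Y)" "b = (X', w', Y')" by (cases a; cases b) auto
  show ?thesis
    using assms(1)[simplified] by (rule localisation_relations.cases) (auto intro: assms(2-5))
qed

locale localised_category = category C
  for C :: "('o, 'm, 'z) cat_scheme" (structure) +
  fixes W :: "'m set"
  assumes W_arr: "W \<subseteq> Arr C"
begin

lemma is_word_objs: "is_word C W X w Y \<Longrightarrow> X \<in> Obj C \<and> Y \<in> Obj C"
proof (induction w arbitrary: X)
  case (Cons l w)
  then show ?case using W_arr dom_obj cod_obj by (cases l) auto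
qed auto

lemma is_word_append: "\<lbrakk>is_word C W X w Y; is_word C W Y v Z\<rbrakk> \<Longrightarrow> is_word C W X (w @ v) Z"
  by (induction C W X w Y rule: is_word.induct) auto

abbreviation "P \<equiv> word_cat C W"

lemma word_hom_iff: "a \<in> hom_set P X Y \<longleftrightarrow> (\<exists>w. a = (X, w, Y) \<and> is_word C W X w Y)"
  by (auto simp: hom_set_def word_cat_def)

lemma word_simps:
  "Obj P = Obj C" "Arr P = {(X, w, Y). is_word C W X w Y}" "Dom P (X, w, Y) = X" "Cod P (X, w, Y) = Y"
  "Idn P X = (X, [], X)" "(Y', v, Z) \<cdot>\<^bsub>P\<^esub> (X, w, Y) = (X, w @ v, Z)"
  by (simp_all add: word_cat_def)

lemma category_words: "category P"
  by unfold_locales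
    (auto simp: word_hom_iff word_simps is_word_append dest: is_word_objs intro: is_word_append)

lemma relations_parallel:
  assumes "(a, b) \<in> localisation_relations C W"
  shows "a \<in> Arr P \<and> b \<in> hom_set P (Dom P a) (Cod P a)"
  using assms
proof (induction rule: localisation_relation_cases)
  case (cmp f X Y g Z)
  then show ?case using cmp_hom[OF cmp] hom_objs[OF cmp(1)] hom_objs[OF cmp(2)]
    by (auto simp: word_hom_iff word_simps hom_set_def)
qed (auto simp: word_hom_iff word_simps hom_setD[OF idn_hom] hom_setD dest: hom_objs)

sublocale words: category_congruence P "localisation_congruence C W"
  unfolding localisation_congruence_def
  by (rule category_congruence_closure[OF category_words relations_parallel])

abbreviation "D \<equiv> localisation C W"
abbreviation "L \<equiv> localisation_functor C W"

sublocale loc: category D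
  unfolding localisation_def by (rule words.category_quotient)

lemma localisation_obj: "Obj D = Obj C"
  by (simp add: localisation_def words.quotient_simps word_simps)

abbreviation "word_class X w Y \<equiv> localisation_congruence C W `` {(X, w, Y)}"

lemma class_hom: "is_word C W X w Y \<Longrightarrow> word_class X w Y \<in> hom_set D X Y"
  unfolding localisation_def by (rule words.class_hom) (simp add: word_hom_iff)

lemma class_cmp:
  "\<lbrakk>is_word C W X w Y; is_word C W Y v Z\<rbrakk>
    \<Longrightarrow> word_class Y v Z \<cdot>\<^bsub>D\<^esub> word_class X w Y = word_class X (w @ v) Z"
  unfolding localisation_def using words.class_cmp[of "(X, w, Y)" X Y "(Y, v, Z)" Z]
  by (simp add: word_hom_iff word_simps)

lemma class_idn: "Idn D X = word_class X [] X"
  by (simp add: localisation_def words.quotient_simps word_simps)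

lemma relation_class_eq:
  "(a, b) \<in> localisation_relations C W
    \<Longrightarrow> localisation_congruence C W `` {a} = localisation_congruence C W `` {b}"
  by (rule equiv_class_eq[OF words.equiv])
    (auto simp: localisation_congruence_def intro: congruence_closure.base)

lemma L_simps:
  "X \<in> Obj C \<Longrightarrow> ObjMap L X = X"
  "f \<in> hom_set C X Y \<Longrightarrow> ArrMap L f = word_class X [Fwd f] Y"
  by (auto simp: localisation_functor_def hom_set_def)

lemma Fwd_word: "f \<in> hom_set C X Y \<Longrightarrow> is_word C W X [Fwd f] Y"
  using hom_objs by (auto simp: hom_set_def)

lemma Bwd_word: "\<lbrakk>w \<in> W; w \<in> hom_set C X Y\<rbrakk> \<Longrightarrow> is_word C W Y [Bwd w] X"
  using hom_objs by (auto simp: hom_set_def)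

lemma L_hom: "f \<in> hom_set C X Y \<Longrightarrow> ArrMap L f \<in> hom_set D X Y"
  using class_hom[OF Fwd_word] by (simp add: L_simps)

lemma L_functor: "is_functor C D L"
proof
  show "ObjMap L \<in> Obj C \<rightarrow>\<^sub>E Obj D" by (auto simp: localisation_functor_def localisation_obj)
  have "ArrMap L f \<in> Arr D" if "f \<in> Arr C" for f
    using hom_setD(1)[OF L_hom[OF arr_in_hom[OF that]]] .
  then show "ArrMap L \<in> Arr C \<rightarrow>\<^sub>E Arr D"
    by (auto simp: localisation_functor_def)
next
  fix f X Y assume "f \<in> hom_set C X Y"
  then show "ArrMap L f \<in> hom_set D (ObjMap L X) (ObjMap L Y)"
    using hom_objs[of f X Y] by (simp add: L_simps(1) L_hom)
next
  fix X assume X: "X \<in> Obj C"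
  then show "ArrMap L (Idn C X) = Idn D (ObjMap L X)"
    using relation_class_eq[OF localisation_relations.intros(1)[OF X]]
    by (simp add: L_simps(1) L_simps(2)[OF idn_hom] class_idn)
next
  fix f X Y g Z assume fg: "f \<in> hom_set C X Y" "g \<in> hom_set C Y Z"
  then show "ArrMap L (g \<cdot> f) = ArrMap L g \<cdot>\<^bsub>D\<^esub> ArrMap L f"
    using relation_class_eq[OF localisation_relations.intros(2)[OF fg]]
      class_cmp[OF Fwd_word[OF fg(1)] Fwd_word[OF fg(2)]] cmp_hom[OF fg]
    by (simp add: L_simps)
qed

sublocale L: is_functor C D L by (rule L_functor)

lemma Bwd_inverse:
  assumes "w \<in> W" "w \<in> hom_set C X Y"
  shows "word_class Y [Bwd w] X \<in> hom_set D Y X"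
    and "word_class Y [Bwd w] X \<cdot>\<^bsub>D\<^esub> ArrMap L w = Idn D X"
    and "ArrMap L w \<cdot>\<^bsub>D\<^esub> word_class Y [Bwd w] X = Idn D Y"
  using class_hom[OF Bwd_word[OF assms]] class_cmp[OF Bwd_word[OF assms] Fwd_word[OF assms(2)]]
    class_cmp[OF Fwd_word[OF assms(2)] Bwd_word[OF assms]]
    relation_class_eq[OF localisation_relations.intros(3)[OF assms]]
    relation_class_eq[OF localisation_relations.intros(4)[OF assms]]
  by (simp_all add: L_simps(2)[OF assms(2)] class_idn)

lemma L_inverts: "w \<in> W \<Longrightarrow> iso_arr D (ArrMap L w)"
  using Bwd_inverse[OF _ arr_in_hom] L_hom[OF arr_in_hom] W_arr loc.iso_arrI by blast

text \<open>Induction on the letters of a word. Uniqueness of functors and naturality of transformations on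
  the localisation are derived from this rule, without a further look at words.\<close>

lemma localisation_induct [consumes 1, case_names idn fwd bwd cmp]:
  assumes "a \<in> Arr D"
    and idn: "\<And>X. X \<in> Obj C \<Longrightarrow> \<Phi> (Idn D X)"
    and fwd: "\<And>f X Y. f \<in> hom_set C X Y \<Longrightarrow> \<Phi> (ArrMap L f)"
    and bwd: "\<And>w b X Y. \<lbrakk>w \<in> W; w \<in> hom_set C X Y; b \<in> hom_set D Y X;
      b \<cdot>\<^bsub>D\<^esub> ArrMap L w = Idn D X; ArrMap L w \<cdot>\<^bsub>D\<^esub> b = Idn D Y\<rbrakk> \<Longrightarrow> \<Phi> b"
    and cmp: "\<And>a b X Y Z. \<lbrakk>a \<in> hom_set D X Y; b \<in> hom_set D Y Z; \<Phi> a; \<Phi> b\<rbrakk> \<Longrightarrow> \<Phi> (b \<cdot>\<^bsub>D\<^esub> a)"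
  shows "\<Phi> a"
proof -
  have words: "\<Phi> (word_class X w Y)" if "is_word C W X w Y" for X w Y
    using that
  proof (induction w arbitrary: X)
    case Nil
    then have "X \<in> Obj C" "X = Y" by auto
    then show ?case using idn[of X] by (simp add: class_idn)
  next
    case (Cons l w)
    show ?case
    proof (cases l)
      case (Fwd f)
      then have f: "f \<in> hom_set C X (Cod C f)" and w: "is_word C W (Cod C f) w Y"
        using Cons.prems by (auto simp: hom_set_def)
      show ?thesis
        using cmp[OF class_hom[OF Fwd_word[OF f]] class_hom[OF w]] fwd[OF f] Cons.IH[OF w]
          class_cmp[OF Fwd_word[OF f] w] Fwd by (simp add: L_simps(2)[OF f])
    next
      case (Bwd f)
      then have f: "f \<in> W" "f \<in> hom_set C (Dom C f) X" and w: "is_word C W (Dom C f) w Y"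
        using Cons.prems W_arr by (auto simp: hom_set_def)
      show ?thesis
        using cmp[OF class_hom[OF Bwd_word[OF f]] class_hom[OF w]] bwd[OF f Bwd_inverse[OF f]]
          Cons.IH[OF w] class_cmp[OF Bwd_word[OF f] w] Bwd by simp
    qed
  qed
  obtain X w Y where "is_word C W X w Y" "a = word_class X w Y"
    using assms(1) unfolding localisation_def
    by (elim words.quotient_arrE) (auto simp: word_simps)
  then show ?thesis using words by simp
qed

lemma functor_from_localisation_unique:
  assumes G: "is_functor D E G" "is_functor D E G'" and eq: "functor_comp C G L = functor_comp C G' L"
  shows "G = G'"
proof -
  interpret G: is_functor D E G by fact
  interpret G': is_functor D E G' by fact
  have obj: "ObjMap G X = ObjMap G' X" if "X \<in> Obj C" for X
    using arg_cong[OF eq, of "\<lambda>F. ObjMap F X"] that by (simp add: functor_comp_simps L_simps)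
  have arr: "ArrMap G (ArrMap L f) = ArrMap G' (ArrMap L f)" if "f \<in> Arr C" for f
    using arg_cong[OF eq, of "\<lambda>F. ArrMap F f"] that by (simp add: functor_comp_simps)
  show ?thesis
  proof (rule functor_eqI[OF G])
    fix a assume "a \<in> Arr D"
    then show "ArrMap G a = ArrMap G' a"
    proof (induction rule: localisation_induct)
      case (idn X)
      then show ?case by (simp add: G.map_idn G'.map_idn localisation_obj obj)
    next
      case (fwd f X Y)
      then show ?case by (simp add: arr hom_setD)
    next
      case (bwd w b X Y)
      note o = hom_objs[OF bwd(2)]
      show ?case
      proof (rule G.D.inverse_unique)
        show "ArrMap G (ArrMap L w) \<in> hom_set E (ObjMap G X) (ObjMap G Y)"
          by (rule G.map_hom[OF L_hom[OF bwd(2)]])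
        show "ArrMap G b \<in> hom_set E (ObjMap G Y) (ObjMap G X)"
          by (rule G.map_hom[OF bwd(3)])
        show "ArrMap G' b \<in> hom_set E (ObjMap G Y) (ObjMap G X)"
          using G'.map_hom[OF bwd(3)] o obj by simp
        show "ArrMap G b \<cdot>\<^bsub>E\<^esub> ArrMap G (ArrMap L w) = Idn E (ObjMap G X)"
          using G.map_cmp[OF L_hom[OF bwd(2)] bwd(3)] bwd(4) G.map_idn[of X] o localisation_obj by simp
        show "ArrMap G (ArrMap L w) \<cdot>\<^bsub>E\<^esub> ArrMap G' b = Idn E (ObjMap G Y)"
          using G'.map_cmp[OF bwd(3) L_hom[OF bwd(2)]] bwd(5) G'.map_idn[of Y] o obj localisation_obj
            arr[OF hom_setD(1)[OF bwd(2)]] by simp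
      qed
    next
      case (cmp a b X Y Z)
      then show ?case using G.map_cmp[OF cmp(1,2)] G'.map_cmp[OF cmp(1,2)] by simp
    qed
  qed (simp add: localisation_obj obj)
qed

text \<open>The square of an inverse \<open>b\<close> of \<open>L w\<close> follows from that of \<open>L w\<close> by composing with \<open>F b\<close> on one side
  and with \<open>F' b\<close> on the other.\<close>

lemma natural_on_localisation:
  assumes F: "is_functor D E F" and F': "is_functor D E F'"
    and eta: "\<And>X. X \<in> Obj C \<Longrightarrow> \<eta> X \<in> hom_set E (ObjMap F X) (ObjMap F' X)"
    and sq: "\<And>f X Y. f \<in> hom_set C X Y
      \<Longrightarrow> \<eta> Y \<cdot>\<^bsub>E\<^esub> ArrMap F (ArrMap L f) = ArrMap F' (ArrMap L f) \<cdot>\<^bsub>E\<^esub> \<eta> X"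
    and "a \<in> Arr D"
  shows "\<eta> (Cod D a) \<cdot>\<^bsub>E\<^esub> ArrMap F a = ArrMap F' a \<cdot>\<^bsub>E\<^esub> \<eta> (Dom D a)"
  using assms(5)
proof (induction rule: localisation_induct)
  interpret F: is_functor D E F by fact
  interpret F': is_functor D E F' by fact
  {
    case (idn X)
    then have X: "X \<in> Obj D" by (simp add: localisation_obj)
    show ?case
      using F.D.cmp_idn[OF eta[OF idn]] F.D.idn_cmp[OF eta[OF idn]] F.map_idn[OF X] F'.map_idn[OF X]
        hom_setD[OF loc.idn_hom[OF X]] by simp
  next
    case (fwd f X Y)
    then show ?case using sq[OF fwd] hom_setD[OF L_hom[OF fwd]] by simp
  next
    case (bwd w b X Y)
    note o = hom_objs[OF bwd(2)]
    have oD: "X \<in> Obj D" "Y \<in> Obj D" using o by (simp_all add: localisation_obj)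
    note w = L_hom[OF bwd(2)] and e = eta[OF o(1)] eta[OF o(2)]
    note Fw = F.map_hom[OF w] and Fb = F.map_hom[OF bwd(3)]
      and F'w = F'.map_hom[OF w] and F'b = F'.map_hom[OF bwd(3)]
    have FwFb: "ArrMap F (ArrMap L w) \<cdot>\<^bsub>E\<^esub> ArrMap F b = Idn E (ObjMap F Y)"
      using F.map_cmp[OF bwd(3) w] bwd(5) F.map_idn[OF oD(2)] by simp
    have F'bF'w: "ArrMap F' b \<cdot>\<^bsub>E\<^esub> ArrMap F' (ArrMap L w) = Idn E (ObjMap F' X)"
      using F'.map_cmp[OF w bwd(3)] bwd(4) F'.map_idn[OF oD(1)] by simp
    have eb: "\<eta> X \<cdot>\<^bsub>E\<^esub> ArrMap F b \<in> hom_set E (ObjMap F Y) (ObjMap F' X)"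
      by (rule F.D.cmp_hom[OF Fb e(1)])
    have "\<eta> X \<cdot>\<^bsub>E\<^esub> ArrMap F b
        = (ArrMap F' b \<cdot>\<^bsub>E\<^esub> ArrMap F' (ArrMap L w)) \<cdot>\<^bsub>E\<^esub> (\<eta> X \<cdot>\<^bsub>E\<^esub> ArrMap F b)"
      using F.D.idn_cmp[OF eb] F'bF'w by simp
    also have "\<dots> = ArrMap F' b \<cdot>\<^bsub>E\<^esub> ((ArrMap F' (ArrMap L w) \<cdot>\<^bsub>E\<^esub> \<eta> X) \<cdot>\<^bsub>E\<^esub> ArrMap F b)"
      using F.D.cmp_assoc[OF eb F'w F'b] F.D.cmp_assoc[OF Fb e(1) F'w] by simp
    also have "\<dots> = ArrMap F' b \<cdot>\<^bsub>E\<^esub> ((\<eta> Y \<cdot>\<^bsub>E\<^esub> ArrMap F (ArrMap L w)) \<cdot>\<^bsub>E\<^esub> ArrMap F b)"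
      using sq[OF bwd(2)] by simp
    also have "\<dots> = ArrMap F' b \<cdot>\<^bsub>E\<^esub> \<eta> Y"
      using F.D.cmp_assoc[OF Fb Fw e(2)] FwFb F.D.cmp_idn[OF e(2)] by simp
    finally show ?case using hom_setD[OF bwd(3)] by simp
  next
    case (cmp a b X Y Z)
    note o = loc.hom_objs[OF cmp(1)] loc.hom_objs(2)[OF cmp(2)]
    have e: "\<eta> X \<in> hom_set E (ObjMap F X) (ObjMap F' X)" "\<eta> Y \<in> hom_set E (ObjMap F Y) (ObjMap F' Y)"
      "\<eta> Z \<in> hom_set E (ObjMap F Z) (ObjMap F' Z)" using o eta by (simp_all add: localisation_obj)
    note Fa = F.map_hom[OF cmp(1)] and Fb = F.map_hom[OF cmp(2)]
      and F'a = F'.map_hom[OF cmp(1)] and F'b = F'.map_hom[OF cmp(2)]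
    have "\<eta> Z \<cdot>\<^bsub>E\<^esub> ArrMap F (b \<cdot>\<^bsub>D\<^esub> a) = (\<eta> Z \<cdot>\<^bsub>E\<^esub> ArrMap F b) \<cdot>\<^bsub>E\<^esub> ArrMap F a"
      using F.map_cmp[OF cmp(1,2)] F.D.cmp_assoc[OF Fa Fb e(3)] by simp
    also have "\<dots> = ArrMap F' b \<cdot>\<^bsub>E\<^esub> (\<eta> Y \<cdot>\<^bsub>E\<^esub> ArrMap F a)"
      using cmp(4) F.D.cmp_assoc[OF Fa e(2) F'b] hom_setD[OF cmp(2)] by simp
    also have "\<dots> = (ArrMap F' b \<cdot>\<^bsub>E\<^esub> ArrMap F' a) \<cdot>\<^bsub>E\<^esub> \<eta> X"
      using cmp(3) F.D.cmp_assoc[OF e(1) F'a F'b] hom_setD[OF cmp(1)] by simp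
    finally show ?case using F'.map_cmp[OF cmp(1,2)] hom_setD[OF loc.cmp_hom[OF cmp(1,2)]] by simp
  }
qed

end

fun letter_value :: "('p, 'n, 'y) cat_scheme \<Rightarrow> ('o, 'm, 'p, 'n) fctr \<Rightarrow> 'm letter \<Rightarrow> 'n" where
  "letter_value E F (Fwd f) = ArrMap F f"
| "letter_value E F (Bwd w) = inv_arr E (ArrMap F w)"

text \<open>The empty word has no letter that would tell its object; hence the end point \<open>Y\<close>.\<close>

fun word_value :: "('p, 'n, 'y) cat_scheme \<Rightarrow> ('o, 'm, 'p, 'n) fctr \<Rightarrow> 'm letter list \<Rightarrow> 'o \<Rightarrow> 'n" where
  "word_value E F [] Y = Idn E (ObjMap F Y)"
| "word_value E F (l # w) Y = word_value E F w Y \<cdot>\<^bsub>E\<^esub> letter_value E F l"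

locale inverting_functor = localised_category C W + F: is_functor C E F
  for C :: "('o, 'm, 'z) cat_scheme" (structure) and W :: "'m set"
    and E :: "('p, 'n, 'y) cat_scheme" and F :: "('o, 'm, 'p, 'n) fctr" +
  assumes inverts: "w \<in> W \<Longrightarrow> iso_arr E (ArrMap F w)"
begin

lemma word_step:
  assumes "is_word C W X (l # w) Z"
  obtains Y where "letter_value E F l \<in> hom_set E (ObjMap F X) (ObjMap F Y)" "is_word C W Y w Z"
proof (cases l)
  case (Fwd f)
  then have f: "f \<in> hom_set C X (Cod C f)" "is_word C W (Cod C f) w Z"
    using assms by (auto simp: hom_set_def)
  show ?thesis using that[OF _ f(2)] F.map_hom[OF f(1)] Fwd by simp
next
  case (Bwd f)
  then have f: "f \<in> W" "f \<in> hom_set C (Dom C f) X" "is_word C W (Dom C f) w Z"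
    using assms W_arr by (auto simp: hom_set_def)
  show ?thesis using that[OF _ f(3)] F.D.inv_arr(1)[OF inverts[OF f(1)] F.map_hom[OF f(2)]] Bwd by simp
qed

lemma word_value_hom: "is_word C W X w Y \<Longrightarrow> word_value E F w Y \<in> hom_set E (ObjMap F X) (ObjMap F Y)"
proof (induction w arbitrary: X)
  case Nil
  then show ?case by (auto intro!: F.D.idn_hom F.map_obj)
next
  case (Cons l w)
  obtain Z where "letter_value E F l \<in> hom_set E (ObjMap F X) (ObjMap F Z)" "is_word C W Z w Y"
    using word_step[OF Cons.prems] .
  then show ?case using Cons.IH F.D.cmp_hom by simp
qed

lemma word_value_append:
  "\<lbrakk>is_word C W X w Y; is_word C W Y v Z\<rbrakk>
    \<Longrightarrow> word_value E F (w @ v) Z = word_value E F v Z \<cdot>\<^bsub>E\<^esub> word_value E F w Y"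
proof (induction w arbitrary: X)
  case Nil
  then show ?case using F.D.cmp_idn[OF word_value_hom] by auto
next
  case (Cons l w)
  obtain V where V: "letter_value E F l \<in> hom_set E (ObjMap F X) (ObjMap F V)" "is_word C W V w Y"
    using word_step[OF Cons.prems(1)] .
  show ?case
    using Cons.IH[OF V(2) Cons.prems(2)]
      F.D.cmp_assoc[OF V(1) word_value_hom[OF V(2)] word_value_hom[OF Cons.prems(2)]] by simp
qed

definition word_functor :: "('o, 'o \<times> 'm letter list \<times> 'o, 'p, 'n) fctr" where
  "word_functor = \<lparr>ObjMap = ObjMap F, ArrMap = (\<lambda>a \<in> Arr P. word_value E F (fst (snd a)) (snd (snd a)))\<rparr>"

lemma word_functor_simp: "is_word C W X w Y \<Longrightarrow> ArrMap word_functor (X, w, Y) = word_value E F w Y"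
  by (simp add: word_functor_def word_simps)

lemma word_functor: "is_functor P E word_functor"
proof
  show "ObjMap word_functor \<in> Obj P \<rightarrow>\<^sub>E Obj E" using F.obj_map by (simp add: word_functor_def word_simps)
  show "ArrMap word_functor \<in> Arr P \<rightarrow>\<^sub>E Arr E"
    using hom_setD(1)[OF word_value_hom] by (auto simp: word_functor_def word_simps)
next
  fix f X Y assume "f \<in> hom_set P X Y"
  then show "ArrMap word_functor f \<in> hom_set E (ObjMap word_functor X) (ObjMap word_functor Y)"
    using word_value_hom by (auto simp: word_hom_iff word_functor_simp) (simp add: word_functor_def)
next
  fix X assume "X \<in> Obj P"
  then show "ArrMap word_functor (Idn P X) = Idn E (ObjMap word_functor X)"
    by (simp add: word_simps word_functor_simp) (simp add: word_functor_def)
next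
  fix f X Y g Z assume "f \<in> hom_set P X Y" "g \<in> hom_set P Y Z"
  then show "ArrMap word_functor (g \<cdot>\<^bsub>P\<^esub> f) = ArrMap word_functor g \<cdot>\<^bsub>E\<^esub> ArrMap word_functor f"
    by (auto simp: word_hom_iff word_simps word_functor_simp is_word_append word_value_append)
qed

lemma word_functor_relations:
  assumes "(a, b) \<in> localisation_relations C W"
  shows "ArrMap word_functor a = ArrMap word_functor b"
  using assms
proof (induction rule: localisation_relation_cases)
  case (idn X)
  then show ?case
    using Fwd_word[OF idn_hom[OF idn]] F.D.cmp_idn[OF F.D.idn_hom[OF F.map_obj[OF idn]]]
    by (simp add: word_functor_simp F.map_idn)
next
  case (cmp f X Y g Z)
  note f = F.map_hom[OF cmp(1)] and g = F.map_hom[OF cmp(2)]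
  have w: "is_word C W X [Fwd f, Fwd g] Z"
    using is_word_append[OF Fwd_word[OF cmp(1)] Fwd_word[OF cmp(2)]] by auto
  show ?case
    using F.D.idn_cmp[OF F.D.cmp_hom[OF f g]] F.D.idn_cmp[OF g] F.map_cmp[OF cmp]
    by (simp add: word_functor_simp[OF w] word_functor_simp[OF Fwd_word[OF cmp_hom[OF cmp]]])
next
  case (fwd_bwd w X Y)
  note i = inverts[OF fwd_bwd(1)] and h = F.map_hom[OF fwd_bwd(2)]
  have w: "is_word C W X [Fwd w, Bwd w] X"
    using is_word_append[OF Fwd_word[OF fwd_bwd(2)] Bwd_word[OF fwd_bwd]] by auto
  show ?case
    using F.D.idn_cmp[OF F.D.inv_arr(1)[OF i h]] F.D.inv_arr(2)[OF i h] hom_objs[OF fwd_bwd(2)]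
    by (simp add: word_functor_simp[OF w] word_functor_simp)
next
  case (bwd_fwd w X Y)
  note i = inverts[OF bwd_fwd(1)] and h = F.map_hom[OF bwd_fwd(2)]
  have w: "is_word C W Y [Bwd w, Fwd w] Y"
    using is_word_append[OF Bwd_word[OF bwd_fwd] Fwd_word[OF bwd_fwd(2)]] by auto
  show ?case
    using F.D.idn_cmp[OF h] F.D.inv_arr(3)[OF i h] hom_objs[OF bwd_fwd(2)]
    by (simp add: word_functor_simp[OF w] word_functor_simp)
qed

text \<open>Evaluation of words, with chosen inverses for the reversed letters, is a functor that respects the
  defining relations, and so it descends to the quotient.\<close>

lemma extends_to_localisation: "\<exists>G. is_functor D E G \<and> functor_comp C G L = F"
proof -
  have "ArrMap word_functor a = ArrMap word_functor b" if "(a, b) \<in> localisation_congruence C W" for a b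
    using functor_respects_closure[OF word_functor relations_parallel word_functor_relations]
      that unfolding localisation_congruence_def by blast
  from words.quotient_universal[OF word_functor this]
  obtain G where G: "is_functor D E G"
    and eq: "functor_comp P G (quotient_functor P (localisation_congruence C W)) = word_functor"
    unfolding localisation_def by blast
  have "functor_comp C G L = F"
  proof (rule functor_eqI[OF is_functor_comp[OF L_functor G] F.is_functor_axioms])
    fix X assume X: "X \<in> Obj C"
    then show "ObjMap (functor_comp C G L) X = ObjMap F X"
      using arg_cong[OF eq, of "\<lambda>K. ObjMap K X"]
      by (simp add: functor_comp_simps L_simps words.quotient_functor_simps word_simps word_functor_def)
  next
    fix f assume "f \<in> Arr C"
    then have f: "f \<in> hom_set C (Dom C f) (Cod C f)" by (rule arr_in_hom)
    have w: "(Dom C f, [Fwd f], Cod C f) \<in> Arr P" using Fwd_word[OF f] by (simp add: word_simps)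
    have "ArrMap G (ArrMap L f) = word_value E F [Fwd f] (Cod C f)"
      using arg_cong[OF eq, of "\<lambda>K. ArrMap K (Dom C f, [Fwd f], Cod C f)"] w Fwd_word[OF f]
      by (simp add: functor_comp_simps L_simps(2)[OF f] words.quotient_functor_simps word_functor_simp)
    then show "ArrMap (functor_comp C G L) f = ArrMap F f"
      using \<open>f \<in> Arr C\<close> F.D.idn_cmp[OF F.map_hom[OF f]] by (simp add: functor_comp_simps)
  qed
  then show ?thesis using G by blast
qed

end

lemma (in localised_category) localisation_is_localisation:
  "is_localisation TYPE('p) TYPE('n) C W D L"
  unfolding is_localisation_def
proof (intro conjI ballI allI impI)
  show "is_functor C D L" by (rule L_functor)
  show "iso_arr D (ArrMap L w)" if "w \<in> W" for w using that by (rule L_inverts)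
  fix E :: "('p, 'n) cat" and F
  assume EF: "is_functor C E F \<and> (\<forall>w \<in> W. iso_arr E (ArrMap F w))"
  then interpret F: is_functor C E F by simp
  interpret inverting_functor C W E F using EF by unfold_locales simp
  obtain G where G: "is_functor D E G" "functor_comp C G L = F" using extends_to_localisation by blast
  show "\<exists>!G. is_functor D E G \<and> F = functor_comp C G L"
  proof (rule ex1I[of _ G])
    fix G' assume G': "is_functor D E G' \<and> F = functor_comp C G' L"
    show "G' = G" by (rule functor_from_localisation_unique) (use G G' in simp_all)
  qed (use G in simp)
qed

section \<open>Additive categories\<close>

context additive_category
begin

abbreviation add_arr (infixl "\<oplus>" 65) where "f \<oplus> g \<equiv> Add C f g"

definition sub_arr (infixl "\<ominus>" 65) where "f \<ominus> g = Add C f (neg C g)"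

lemma hom_group_simps:
  "carrier (hom_group C X Y) = hom_set C X Y" "mult (hom_group C X Y) = Add C"
  "one (hom_group C X Y) = Zero C X Y"
  by (simp_all add: hom_group_def)

lemma zero_hom:
  assumes "X \<in> Obj C" "Y \<in> Obj C"
  shows "Zero C X Y \<in> hom_set C X Y"
proof -
  interpret G: comm_group "hom_group C X Y" using hom_comm_group assms by simp
  show ?thesis using G.one_closed by (simp add: hom_group_simps)
qed

lemma
  assumes "f \<in> hom_set C X Y"
  shows add_zero: "f \<oplus> Zero C X Y = f" and zero_add: "Zero C X Y \<oplus> f = f"
    and neg_hom: "neg C f \<in> hom_set C X Y" and neg_add: "neg C f \<oplus> f = Zero C X Y"
    and add_neg: "f \<oplus> neg C f = Zero C X Y"
proof -
  interpret G: comm_group "hom_group C X Y" using hom_comm_group hom_objs[OF assms] by simp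
  have neg: "neg C f = m_inv (hom_group C X Y) f" using hom_setD[OF assms] by (simp add: neg_def)
  show "f \<oplus> Zero C X Y = f" "Zero C X Y \<oplus> f = f" "neg C f \<in> hom_set C X Y"
    "neg C f \<oplus> f = Zero C X Y" "f \<oplus> neg C f = Zero C X Y"
    using G.r_one[of f] G.l_one[of f] G.inv_closed[of f] G.l_inv[of f] G.r_inv[of f] assms
    by (simp_all add: neg hom_group_simps)
qed

lemma
  assumes "f \<in> hom_set C X Y" "g \<in> hom_set C X Y"
  shows add_hom: "f \<oplus> g \<in> hom_set C X Y" and sub_hom: "f \<ominus> g \<in> hom_set C X Y"
    and sub_eq_zero: "f \<ominus> g = Zero C X Y \<longleftrightarrow> f = g"
    and add_self: "f \<oplus> g = g \<Longrightarrow> f = Zero C X Y"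
    and neg_unique: "f \<oplus> g = Zero C X Y \<Longrightarrow> f = neg C g"
    and add_sub: "g \<oplus> (f \<ominus> g) = f"
proof -
  interpret G: comm_group "hom_group C X Y" using hom_comm_group hom_objs[OF assms(1)] by simp
  have neg: "neg C g = m_inv (hom_group C X Y) g" using hom_setD[OF assms(2)] by (simp add: neg_def)
  note n = neg_hom[OF assms(2)] neg_add[OF assms(2)]
  show "f \<oplus> g \<in> hom_set C X Y" using G.m_closed[of f g] assms by (simp add: hom_group_simps)
  show "f \<ominus> g \<in> hom_set C X Y" using G.m_closed[of f "neg C g"] assms n by (simp add: hom_group_simps sub_arr_def)
  show unique: "f = neg C g" if "f \<oplus> g = Zero C X Y"
    using G.inv_equality[of f g] that assms by (simp add: hom_group_simps neg)
  have assoc: "(f \<oplus> neg C g) \<oplus> g = f"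
    using G.m_assoc[of f "neg C g" g] assms n add_zero[OF assms(1)] by (simp add: hom_group_simps)
  show "f \<ominus> g = Zero C X Y \<longleftrightarrow> f = g"
    using assoc zero_add[OF assms(2)] add_neg[OF assms(2)] by (auto simp: sub_arr_def)
  show "f = Zero C X Y" if "f \<oplus> g = g"
    using G.l_cancel_one[of g f] G.r_cancel_one[of g f] that assms by (simp add: hom_group_simps)
  show "g \<oplus> (f \<ominus> g) = f"
    using G.m_comm[of g "f \<oplus> neg C g"] assoc assms(2) \<open>f \<ominus> g \<in> _\<close> by (simp add: hom_group_simps sub_arr_def)
qed

lemma cmp_zero:
  assumes "f \<in> hom_set C X Y" "Z \<in> Obj C"
  shows "f \<cdot> Zero C Z X = Zero C Z Y"
proof (rule add_self)
  note o = hom_objs[OF assms(1)]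
  show h: "f \<cdot> Zero C Z X \<in> hom_set C Z Y" by (rule cmp_hom[OF zero_hom[OF assms(2) o(1)] assms(1)])
  then show "f \<cdot> Zero C Z X \<in> hom_set C Z Y" .
  show "f \<cdot> Zero C Z X \<oplus> f \<cdot> Zero C Z X = f \<cdot> Zero C Z X"
    using cmp_add_right[OF zero_hom[OF assms(2) o(1)] zero_hom[OF assms(2) o(1)] assms(1)]
      add_zero[OF zero_hom[OF assms(2) o(1)]] by simp
qed

lemma zero_cmp:
  assumes "f \<in> hom_set C X Y" "Z \<in> Obj C"
  shows "Zero C Y Z \<cdot> f = Zero C X Z"
proof (rule add_self)
  note o = hom_objs[OF assms(1)]
  show h: "Zero C Y Z \<cdot> f \<in> hom_set C X Z" by (rule cmp_hom[OF assms(1) zero_hom[OF o(2) assms(2)]])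
  then show "Zero C Y Z \<cdot> f \<in> hom_set C X Z" .
  show "Zero C Y Z \<cdot> f \<oplus> Zero C Y Z \<cdot> f = Zero C Y Z \<cdot> f"
    using cmp_add_left[OF assms(1) zero_hom[OF o(2) assms(2)] zero_hom[OF o(2) assms(2)]]
      add_zero[OF zero_hom[OF o(2) assms(2)]] by simp
qed

lemma cmp_neg:
  assumes "f \<in> hom_set C X Y" "g \<in> hom_set C Y Z"
  shows "g \<cdot> neg C f = neg C (g \<cdot> f)" and "neg C g \<cdot> f = neg C (g \<cdot> f)"
proof -
  note n = neg_hom[OF assms(1)] neg_hom[OF assms(2)]
  show "g \<cdot> neg C f = neg C (g \<cdot> f)"
    using neg_unique[OF cmp_hom[OF n(1) assms(2)] cmp_hom[OF assms]]
      cmp_add_right[OF n(1) assms] neg_add[OF assms(1)] cmp_zero[OF assms(2)] hom_objs[OF assms(1)] by simp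
  show "neg C g \<cdot> f = neg C (g \<cdot> f)"
    using neg_unique[OF cmp_hom[OF assms(1) n(2)] cmp_hom[OF assms]]
      cmp_add_left[OF assms(1) n(2) assms(2)] neg_add[OF assms(2)] zero_cmp[OF assms(1)] hom_objs[OF assms(2)] by simp
qed

lemma neg_neg: "f \<in> hom_set C X Y \<Longrightarrow> neg C (neg C f) = f"
  using neg_unique[of f X Y "neg C f"] neg_hom add_neg by metis

lemma neg_zero: "\<lbrakk>X \<in> Obj C; Y \<in> Obj C\<rbrakk> \<Longrightarrow> neg C (Zero C X Y) = Zero C X Y"
  using neg_unique[OF zero_hom zero_hom] add_zero[OF zero_hom] by metis

lemma cmp_sub_right:
  assumes "f \<in> hom_set C X Y" "f' \<in> hom_set C X Y" "g \<in> hom_set C Y Z"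
  shows "g \<cdot> (f \<ominus> f') = (g \<cdot> f) \<ominus> (g \<cdot> f')"
  using cmp_add_right[OF assms(1) neg_hom[OF assms(2)] assms(3)] cmp_neg(1)[OF assms(2,3)]
  by (simp add: sub_arr_def)

lemma cmp_sub_left:
  assumes "f \<in> hom_set C X Y" "g \<in> hom_set C Y Z" "g' \<in> hom_set C Y Z"
  shows "(g \<ominus> g') \<cdot> f = (g \<cdot> f) \<ominus> (g' \<cdot> f)"
  using cmp_add_left[OF assms(1,2) neg_hom[OF assms(3)]] cmp_neg(2)[OF assms(1,3)]
  by (simp add: sub_arr_def)

lemma additive_map_zero:
  assumes "X \<in> Obj C" "Y \<in> Obj C"
    and "\<And>f. f \<in> hom_set C X Y \<Longrightarrow> \<phi> f \<in> hom_set C X' Y'"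
    and "\<And>f g. \<lbrakk>f \<in> hom_set C X Y; g \<in> hom_set C X Y\<rbrakk> \<Longrightarrow> \<phi> (f \<oplus> g) = \<phi> f \<oplus> \<phi> g"
  shows "\<phi> (Zero C X Y) = Zero C X' Y'"
proof (rule add_self)
  note z = zero_hom[OF assms(1,2)]
  show "\<phi> (Zero C X Y) \<in> hom_set C X' Y'" using assms(3)[OF z] .
  then show "\<phi> (Zero C X Y) \<in> hom_set C X' Y'" .
  show "\<phi> (Zero C X Y) \<oplus> \<phi> (Zero C X Y) = \<phi> (Zero C X Y)"
    using assms(4)[OF z z] add_zero[OF z] by simp
qed

lemma additive_map_finprod:
  assumes "X \<in> Obj C" "Y \<in> Obj C" "X' \<in> Obj C" "Y' \<in> Obj C"
    and hom: "\<And>f. f \<in> hom_set C X Y \<Longrightarrow> \<phi> f \<in> hom_set C X' Y'"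
    and add: "\<And>f g. \<lbrakk>f \<in> hom_set C X Y; g \<in> hom_set C X Y\<rbrakk> \<Longrightarrow> \<phi> (f \<oplus> g) = \<phi> f \<oplus> \<phi> g"
    and "finite K" "\<And>k. k \<in> K \<Longrightarrow> c k \<in> hom_set C X Y"
  shows "\<phi> (finprod (hom_group C X Y) c K) = finprod (hom_group C X' Y') (\<lambda>k. \<phi> (c k)) K"
  using assms(7,8)
proof (induction K)
  case empty
  then show ?case
    using additive_map_zero[of X Y \<phi> X' Y', OF assms(1,2) hom add]
    by (simp add: comm_monoid.finprod_empty hom_comm_group assms(1-4) comm_group.axioms hom_group_simps)
next
  case (insert k K)
  interpret G: comm_group "hom_group C X Y" using hom_comm_group assms(1,2) by simp
  interpret G': comm_group "hom_group C X' Y'" using hom_comm_group assms(3,4) by simp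
  have c: "c \<in> K \<rightarrow> carrier (hom_group C X Y)" "c k \<in> hom_set C X Y"
    using insert.prems by (auto simp: hom_group_simps)
  then have c': "(\<lambda>k. \<phi> (c k)) \<in> K \<rightarrow> carrier (hom_group C X' Y')" "\<phi> (c k) \<in> carrier (hom_group C X' Y')"
    using hom by (auto simp: hom_group_simps)
  have "finprod (hom_group C X Y) c K \<in> hom_set C X Y"
    using G.finprod_closed[OF c(1)] by (simp add: hom_group_simps)
  then show ?case
    using insert.IH insert.prems insert.hyps add[OF c(2)] G.finprod_insert[OF insert.hyps c(1)]
      G'.finprod_insert[OF insert.hyps c'] c by (simp add: hom_group_simps)
qed

lemma direct_sumD:
  assumes "is_direct_sum C Xs S i p"
  shows "S \<in> Obj C" and "set Xs \<subseteq> Obj C"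
    and "k < length Xs \<Longrightarrow> i k \<in> hom_set C (Xs ! k) S" and "k < length Xs \<Longrightarrow> p k \<in> hom_set C S (Xs ! k)"
    and "\<lbrakk>k < length Xs; l < length Xs\<rbrakk> \<Longrightarrow>
      p k \<cdot> i l = (if k = l then Idn C (Xs ! k) else Zero C (Xs ! l) (Xs ! k))"
    and "finprod (hom_group C S S) (\<lambda>k. i k \<cdot> p k) {..<length Xs} = Idn C S"
  using assms unfolding is_direct_sum_def by auto

text \<open>Compose \<open>f\<close> with the identity of the direct sum, written as the sum of the \<open>i k \<cdot> p k\<close>.\<close>

lemma direct_sum_expand:
  assumes S: "is_direct_sum C Xs S i p" and f: "f \<in> hom_set C S Y"
  shows "f = finprod (hom_group C S Y) (\<lambda>k. (f \<cdot> i k) \<cdot> p k) {..<length Xs}"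
proof -
  note D = direct_sumD[OF S]
  have ip: "i k \<cdot> p k \<in> hom_set C S S" if "k \<in> {..<length Xs}" for k
    using D(3,4) that cmp_hom by blast
  note o = hom_objs[OF f]
  interpret G: comm_group "hom_group C S Y" using hom_comm_group o by simp
  have "f = f \<cdot> finprod (hom_group C S S) (\<lambda>k. i k \<cdot> p k) {..<length Xs}"
    using D(6) cmp_idn[OF f] by simp
  also have "\<dots> = finprod (hom_group C S Y) (\<lambda>k. f \<cdot> (i k \<cdot> p k)) {..<length Xs}"
    by (rule additive_map_finprod[OF o(1) o(1) o cmp_hom[OF _ f] cmp_add_right[OF _ _ f] _ ip]) auto
  also have "\<dots> = finprod (hom_group C S Y) (\<lambda>k. (f \<cdot> i k) \<cdot> p k) {..<length Xs}"
  proof (rule G.finprod_cong')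
    show "(\<lambda>k. (f \<cdot> i k) \<cdot> p k) \<in> {..<length Xs} \<rightarrow> carrier (hom_group C S Y)"
      using cmp_hom[OF D(4) cmp_hom[OF D(3) f]] by (auto simp: hom_group_simps)
    show "f \<cdot> (i k \<cdot> p k) = (f \<cdot> i k) \<cdot> p k" if "k \<in> {..<length Xs}" for k
      using cmp_assoc[OF D(4) D(3) f] that by simp
  qed simp
  finally show ?thesis .
qed

lemma direct_sum_ext:
  assumes S: "is_direct_sum C Xs S i p" and f: "f \<in> hom_set C S Y" and g: "g \<in> hom_set C S Y"
    and eq: "\<And>k. k < length Xs \<Longrightarrow> f \<cdot> i k = g \<cdot> i k"
  shows "f = g"
proof -
  note D = direct_sumD[OF S]
  interpret G: comm_group "hom_group C S Y" using hom_comm_group hom_objs[OF f] by simp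
  have "finprod (hom_group C S Y) (\<lambda>k. (f \<cdot> i k) \<cdot> p k) {..<length Xs}
      = finprod (hom_group C S Y) (\<lambda>k. (g \<cdot> i k) \<cdot> p k) {..<length Xs}"
    using cmp_hom[OF D(4) cmp_hom[OF D(3) g]] eq
    by (intro G.finprod_cong') (auto simp: hom_group_simps)
  then show ?thesis using direct_sum_expand[OF S f] direct_sum_expand[OF S g] by simp
qed

lemma direct_sum_coext:
  assumes S: "is_direct_sum C Xs S i p" and f: "f \<in> hom_set C Y S" and g: "g \<in> hom_set C Y S"
    and eq: "\<And>k. k < length Xs \<Longrightarrow> p k \<cdot> f = p k \<cdot> g"
  shows "f = g"
proof -
  note D = direct_sumD[OF S]
  note Y = hom_objs(1)[OF f]
  interpret G: comm_group "hom_group C Y S" using hom_comm_group hom_objs[OF f] by simp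
  have ip: "i k \<cdot> p k \<in> hom_set C S S" if "k \<in> {..<length Xs}" for k
    using D(3,4) that cmp_hom by blast
  have expand: "h = finprod (hom_group C Y S) (\<lambda>k. (i k \<cdot> p k) \<cdot> h) {..<length Xs}"
    if h: "h \<in> hom_set C Y S" for h
  proof -
    have "h = finprod (hom_group C S S) (\<lambda>k. i k \<cdot> p k) {..<length Xs} \<cdot> h"
      using D(6) idn_cmp[OF h] by simp
    also have "\<dots> = finprod (hom_group C Y S) (\<lambda>k. (i k \<cdot> p k) \<cdot> h) {..<length Xs}"
      by (rule additive_map_finprod[OF D(1) D(1) Y D(1) cmp_hom[OF h] cmp_add_left[OF h] _ ip]) auto
    finally show ?thesis .
  qed
  have "finprod (hom_group C Y S) (\<lambda>k. (i k \<cdot> p k) \<cdot> f) {..<length Xs}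
      = finprod (hom_group C Y S) (\<lambda>k. (i k \<cdot> p k) \<cdot> g) {..<length Xs}"
  proof (rule G.finprod_cong')
    show "(\<lambda>k. (i k \<cdot> p k) \<cdot> g) \<in> {..<length Xs} \<rightarrow> carrier (hom_group C Y S)"
      using cmp_hom[OF g ip] by (auto simp: hom_group_simps)
    show "(i k \<cdot> p k) \<cdot> f = (i k \<cdot> p k) \<cdot> g" if "k \<in> {..<length Xs}" for k
      using cmp_assoc[OF f D(4) D(3)] cmp_assoc[OF g D(4) D(3)] eq that by simp
  qed simp
  then show ?thesis using expand[OF f] expand[OF g] by simp
qed

lemma direct_sum_lift:
  assumes S: "is_direct_sum C Xs S i p" and f: "f \<in> hom_set C S Y" and w: "w \<in> hom_set C V Y"
    and lift: "\<And>k. k < length Xs \<Longrightarrow> \<exists>u \<in> hom_set C (Xs ! k) V. w \<cdot> u = f \<cdot> i k"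
  shows "\<exists>u \<in> hom_set C S V. w \<cdot> u = f"
proof -
  note D = direct_sumD[OF S]
  note o = hom_objs[OF f] and V = hom_objs(1)[OF w]
  obtain u where u: "\<And>k. k < length Xs \<Longrightarrow> u k \<in> hom_set C (Xs ! k) V \<and> w \<cdot> u k = f \<cdot> i k"
    using lift by metis
  interpret G: comm_group "hom_group C S Y" using hom_comm_group o by simp
  interpret H: comm_group "hom_group C S V" using hom_comm_group o V by simp
  have up: "u k \<cdot> p k \<in> hom_set C S V" if "k \<in> {..<length Xs}" for k
    using D(4) u that cmp_hom by blast
  define h where "h = finprod (hom_group C S V) (\<lambda>k. u k \<cdot> p k) {..<length Xs}"
  have h: "h \<in> hom_set C S V"
    using H.finprod_closed[of "\<lambda>k. u k \<cdot> p k" "{..<length Xs}"] up by (auto simp: h_def hom_group_simps)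
  have "w \<cdot> h = finprod (hom_group C S Y) (\<lambda>k. w \<cdot> (u k \<cdot> p k)) {..<length Xs}"
    unfolding h_def
    by (rule additive_map_finprod[OF o(1) V o cmp_hom[OF _ w] cmp_add_right[OF _ _ w] _ up]) auto
  also have "\<dots> = finprod (hom_group C S Y) (\<lambda>k. (f \<cdot> i k) \<cdot> p k) {..<length Xs}"
  proof (rule G.finprod_cong')
    show "(\<lambda>k. (f \<cdot> i k) \<cdot> p k) \<in> {..<length Xs} \<rightarrow> carrier (hom_group C S Y)"
      using cmp_hom[OF D(4) cmp_hom[OF D(3) f]] by (auto simp: hom_group_simps)
    show "w \<cdot> (u k \<cdot> p k) = (f \<cdot> i k) \<cdot> p k" if "k \<in> {..<length Xs}" for k
      using cmp_assoc[OF D(4) _ w, of k "u k"] u that by simp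
  qed simp
  also have "\<dots> = f" using direct_sum_expand[OF S f] by simp
  finally show ?thesis using h by blast
qed

lemma zero_object_exists: "\<exists>N. zero_object C N"
proof -
  obtain N i p where N: "is_direct_sum C [] N i p" using direct_sums[of "[]"] by auto
  have o: "N \<in> Obj C" using direct_sumD(1)[OF N] .
  interpret G: comm_group "hom_group C N N" using hom_comm_group o by simp
  have id: "Idn C N = Zero C N N" using direct_sumD(6)[OF N] by (simp add: hom_group_simps)
  have "f = Zero C X N" if f: "f \<in> hom_set C X N" for f X
    using idn_cmp[OF f] zero_cmp[OF f o] id by simp
  moreover have "f = Zero C N X" if f: "f \<in> hom_set C N X" for f X
    using cmp_idn[OF f] cmp_zero[OF f o] id by simp
  ultimately show ?thesis using o zero_hom unfolding zero_object_def by (intro exI[of _ N]) blast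
qed

lemma zero_objectD:
  assumes "zero_object C N"
  shows "N \<in> Obj C" and "f \<in> hom_set C X N \<Longrightarrow> f = Zero C X N" and "f \<in> hom_set C N X \<Longrightarrow> f = Zero C N X"
  using assms hom_objs[of f] unfolding zero_object_def by blast+

subsection \<open>Direct summands of finite sums of an object\<close>

text \<open>A summand comes with a complement; in \<open>T \<oplus> T\<close> the second copy of \<open>T\<close> serves as one.\<close>

lemma self_in_add_objs:
  assumes "T \<in> Obj C"
  shows "T \<in> add_objs C T"
proof -
  obtain S i p where "is_direct_sum C [T, T] S i p" using direct_sums[of "[T, T]"] assms by auto
  then have "is_direct_sum C (replicate 2 T) S i p" "is_direct_sum C [T, T] S i p"
    by (simp_all add: numeral_2_eq_2)
  then show ?thesis unfolding add_objs_def by blast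
qed

lemma add_objsE:
  assumes "D \<in> add_objs C T"
  obtains n S i p a b where "is_direct_sum C (replicate n T) S i p"
    "a \<in> hom_set C D S" "b \<in> hom_set C S D" "b \<cdot> a = Idn C D" "D \<in> Obj C"
proof -
  obtain n S i p D' i' p' where S: "is_direct_sum C (replicate n T) S i p"
    and D: "is_direct_sum C [D, D'] S i' p'"
    using assms unfolding add_objs_def by blast
  show ?thesis
    using that[OF S, of "i' 0" "p' 0"] direct_sumD(2)[OF D] direct_sumD(3-5)[OF D, of 0] by simp
qed

lemma add_objs_obj: "D \<in> add_objs C T \<Longrightarrow> D \<in> Obj C"
  by (elim add_objsE)

text \<open>The inclusions of \<open>T\<close> into a finite sum of copies are jointly epic, and \<open>D\<close> is a retract of such a
  sum.\<close>

lemma add_objs_ext: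
  assumes "D \<in> add_objs C T" and f: "f \<in> hom_set C D Y" and g: "g \<in> hom_set C D Y"
    and eq: "\<And>t. t \<in> hom_set C T D \<Longrightarrow> f \<cdot> t = g \<cdot> t"
  shows "f = g"
proof -
  obtain n S i p a b where S: "is_direct_sum C (replicate n T) S i p"
    and a: "a \<in> hom_set C D S" and b: "b \<in> hom_set C S D" and ba: "b \<cdot> a = Idn C D"
    using add_objsE[OF assms(1)] .
  have "f \<cdot> b = g \<cdot> b"
  proof (rule direct_sum_ext[OF S cmp_hom[OF b f] cmp_hom[OF b g]])
    fix k assume "k < length (replicate n T)"
    then have k: "i k \<in> hom_set C T S" using direct_sumD(3)[OF S] by simp
    show "(f \<cdot> b) \<cdot> i k = (g \<cdot> b) \<cdot> i k"
      using cmp_assoc[OF k b f] cmp_assoc[OF k b g] eq[OF cmp_hom[OF k b]] by simp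
  qed
  then show ?thesis
    using cmp_assoc[OF a b f] cmp_assoc[OF a b g] ba cmp_idn[OF f] cmp_idn[OF g] by metis
qed

text \<open>Projectivity relative to a fixed arrow \<open>w\<close> passes from \<open>T\<close> to finite sums, component by
  component, and then to retracts.\<close>

lemma add_objs_lift:
  assumes "D \<in> add_objs C T" and f: "f \<in> hom_set C D Y" and w: "w \<in> hom_set C V Y"
    and lift: "\<And>t. t \<in> hom_set C T Y \<Longrightarrow> \<exists>u \<in> hom_set C T V. w \<cdot> u = t"
  shows "\<exists>u \<in> hom_set C D V. w \<cdot> u = f"
proof -
  obtain n S i p a b where S: "is_direct_sum C (replicate n T) S i p"
    and a: "a \<in> hom_set C D S" and b: "b \<in> hom_set C S D" and ba: "b \<cdot> a = Idn C D"
    using add_objsE[OF assms(1)] .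
  have "\<exists>u \<in> hom_set C S V. w \<cdot> u = f \<cdot> b"
  proof (rule direct_sum_lift[OF S cmp_hom[OF b f] w])
    fix k assume k: "k < length (replicate n T)"
    then have "i k \<in> hom_set C T S" using direct_sumD(3)[OF S] by simp
    then show "\<exists>u \<in> hom_set C (replicate n T ! k) V. w \<cdot> u = (f \<cdot> b) \<cdot> i k"
      using lift[OF cmp_hom[OF _ cmp_hom[OF b f]]] k by simp
  qed
  then obtain u where u: "u \<in> hom_set C S V" "w \<cdot> u = f \<cdot> b" by blast
  show ?thesis
    using cmp_hom[OF a u(1)] cmp_assoc[OF a u(1) w] cmp_assoc[OF a b f] u(2) ba cmp_idn[OF f]
    by (intro bexI[of _ "u \<cdot> a"]) simp_all
qed

lemma add_objs_hom_zero:
  assumes "N \<in> add_objs C V" and V: "hom_set C T V = {Zero C T V}" and t: "t \<in> hom_set C T N"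
  shows "t = Zero C T N"
proof -
  obtain n S i p a b where S: "is_direct_sum C (replicate n V) S i p"
    and a: "a \<in> hom_set C N S" and b: "b \<in> hom_set C S N" and ba: "b \<cdot> a = Idn C N"
    using add_objsE[OF assms(1)] .
  note T = hom_objs(1)[OF t]
  note zero = zero_hom[OF T direct_sumD(1)[OF S]]
  have at: "a \<cdot> t \<in> hom_set C T S" by (rule cmp_hom[OF t a])
  have "a \<cdot> t = Zero C T S"
  proof (rule direct_sum_coext[OF S at zero])
    fix k assume "k < length (replicate n V)"
    then have p: "p k \<in> hom_set C S V" using direct_sumD(4)[OF S] by simp
    show "p k \<cdot> (a \<cdot> t) = p k \<cdot> Zero C T S" using cmp_hom[OF at p] cmp_hom[OF zero p] V by simp
  qed
  then show ?thesis using cmp_assoc[OF t a b] ba idn_cmp[OF t] cmp_zero[OF b T] by simp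
qed

end

section \<open>Exactness properties of triangles\<close>

context triangulated_category
begin

lemma shift_functor: "is_functor C C (Shift C)"
  using shift_equivalence by (simp add: is_equivalence_def)

lemma shift_hom: "f \<in> hom_set C X Y \<Longrightarrow> shift_arr C f \<in> hom_set C (shift_obj C X) (shift_obj C Y)"
  by (rule is_functor.map_hom[OF shift_functor])

lemma shift_obj_closed: "X \<in> Obj C \<Longrightarrow> shift_obj C X \<in> Obj C"
  by (rule is_functor.map_obj[OF shift_functor])

lemmas shift_idn = is_functor.map_idn[OF shift_functor]
lemmas shift_cmp = is_functor.map_cmp[OF shift_functor]
lemmas shift_faithful = equivalence_props(1)[OF shift_equivalence]
lemmas shift_full = equivalence_props(2)[OF shift_equivalence]
lemmas shift_dense = equivalence_props(3)[OF shift_equivalence]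

lemma shift_zero:
  assumes "X \<in> Obj C" "Y \<in> Obj C"
  shows "shift_arr C (Zero C X Y) = Zero C (shift_obj C X) (shift_obj C Y)"
  by (rule additive_map_zero[OF assms shift_hom shift_add])

lemma shift_direct_sum:
  assumes S: "is_direct_sum C Xs S i p"
  shows "is_direct_sum C (map (shift_obj C) Xs) (shift_obj C S) (\<lambda>k. shift_arr C (i k)) (\<lambda>k. shift_arr C (p k))"
proof -
  note D = direct_sumD[OF S]
  have ob: "Xs ! k \<in> Obj C" if "k < length Xs" for k using D(2) that by auto
  have pi: "shift_arr C (p k) \<cdot> shift_arr C (i l) = shift_arr C (if k = l then Idn C (Xs ! k) else Zero C (Xs ! l) (Xs ! k))"
    if "k < length Xs" "l < length Xs" for k l
    using shift_cmp[OF D(3)[OF that(2)] D(4)[OF that(1)]] D(5)[OF that] by simp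
  interpret G: comm_group "hom_group C (shift_obj C S) (shift_obj C S)"
    using hom_comm_group shift_obj_closed D(1) by simp
  have ip: "i k \<cdot> p k \<in> hom_set C S S" if "k \<in> {..<length Xs}" for k
    using D(3,4) that cmp_hom by blast
  have "shift_arr C (finprod (hom_group C S S) (\<lambda>k. i k \<cdot> p k) {..<length Xs})
      = finprod (hom_group C (shift_obj C S) (shift_obj C S)) (\<lambda>k. shift_arr C (i k \<cdot> p k)) {..<length Xs}"
    by (rule additive_map_finprod[OF D(1) D(1) shift_obj_closed[OF D(1)] shift_obj_closed[OF D(1)]
      shift_hom shift_add _ ip]) auto
  then have "finprod (hom_group C (shift_obj C S) (shift_obj C S)) (\<lambda>k. shift_arr C (i k \<cdot> p k)) {..<length Xs}
      = Idn C (shift_obj C S)"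
    using D(6) shift_idn[OF D(1)] by simp
  moreover have "finprod (hom_group C (shift_obj C S) (shift_obj C S)) (\<lambda>k. shift_arr C (i k) \<cdot> shift_arr C (p k)) {..<length Xs}
      = finprod (hom_group C (shift_obj C S) (shift_obj C S)) (\<lambda>k. shift_arr C (i k \<cdot> p k)) {..<length Xs}"
    using shift_cmp[OF D(4) D(3)] shift_hom[OF ip]
    by (intro G.finprod_cong') (auto simp: hom_group_simps)
  ultimately show ?thesis
    unfolding is_direct_sum_def using D ob pi
    by (auto simp: shift_hom shift_zero shift_idn shift_obj_closed)
qed

lemma shift_add_objs:
  assumes "D \<in> add_objs C T"
  shows "shift_obj C D \<in> add_objs C (shift_obj C T)"
proof -
  obtain n S i p D' i' p' where "is_direct_sum C (replicate n T) S i p" "is_direct_sum C [D, D'] S i' p'"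
    using assms unfolding add_objs_def by blast
  from this[THEN shift_direct_sum]
  have "is_direct_sum C (replicate n (shift_obj C T)) (shift_obj C S) (\<lambda>k. shift_arr C (i k)) (\<lambda>k. shift_arr C (p k))"
    "is_direct_sum C [shift_obj C D, shift_obj C D'] (shift_obj C S) (\<lambda>k. shift_arr C (i' k)) (\<lambda>k. shift_arr C (p' k))"
    by simp_all
  then show ?thesis unfolding add_objs_def by blast
qed

lemma tri_homs:
  assumes "(f, g, h) \<in> Tri C"
  shows "f \<in> hom_set C X Y \<Longrightarrow> \<exists>Z. g \<in> hom_set C Y Z \<and> h \<in> hom_set C Z (shift_obj C X)"
    and "g \<in> hom_set C Y Z \<Longrightarrow> \<exists>X. f \<in> hom_set C X Y \<and> h \<in> hom_set C Z (shift_obj C X)"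
    and "\<lbrakk>f \<in> hom_set C X Y; g \<in> hom_set C Y Z\<rbrakk> \<Longrightarrow> h \<in> hom_set C Z (shift_obj C X)"
proof -
  have f: "f \<in> Arr C" and g: "g \<in> hom_set C (Cod C f) (Dom C h)"
    and h: "h \<in> hom_set C (Cod C g) (shift_obj C (Dom C f))"
    using tri_candidate[OF assms] by (simp_all add: candidate_def)
  have g': "g \<in> hom_set C (Cod C f) (Cod C g)" using hom_setD(1,2)[OF g] by (simp add: hom_set_def)
  show "\<exists>Z. g \<in> hom_set C Y Z \<and> h \<in> hom_set C Z (shift_obj C X)" if "f \<in> hom_set C X Y"
    using g' h hom_setD[OF that] by auto
  show "\<exists>X. f \<in> hom_set C X Y \<and> h \<in> hom_set C Z (shift_obj C X)" if "g \<in> hom_set C Y Z"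
    using arr_in_hom[OF f] h hom_setD[OF that] hom_setD[OF g] by auto
  show "h \<in> hom_set C Z (shift_obj C X)" if "f \<in> hom_set C X Y" "g \<in> hom_set C Y Z"
    using h hom_setD[OF that(1)] hom_setD[OF that(2)] by simp
qed

lemma candidateI:
  assumes "f \<in> hom_set C X Y" "g \<in> hom_set C Y Z" "h \<in> hom_set C Z (shift_obj C X)"
  shows "candidate C f g h"
  using assms hom_setD[OF assms(1)] hom_setD[OF assms(2)] hom_setD[OF assms(3)]
  by (simp add: candidate_def)

lemma rotate: "(f, g, h) \<in> Tri C \<Longrightarrow> (g, h, neg C (shift_arr C f)) \<in> Tri C"
  using tri_rotate tri_candidate by blast

lemma tri_map:
  assumes "(f, g, h) \<in> Tri C" "(f', g', h') \<in> Tri C"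
    and "f \<in> hom_set C X Y" "g \<in> hom_set C Y Z" "h \<in> hom_set C Z V"
    and "f' \<in> hom_set C X' Y'" "g' \<in> hom_set C Y' Z'" "h' \<in> hom_set C Z' V'"
    and "a \<in> hom_set C X X'" "b \<in> hom_set C Y Y'" "b \<cdot> f = f' \<cdot> a"
  obtains c where "c \<in> hom_set C Z Z'" "c \<cdot> g = g' \<cdot> b" "shift_arr C a \<cdot> h = h' \<cdot> c"
  using tri_morphism[OF assms(1,2), of a b] that assms(9-11) assms(3-8)[THEN hom_setD(2)] by auto

text \<open>Map the triangle \<open>X = X \<rightarrow> 0\<close> to the given one.\<close>

lemma tri_cmp_zero:
  assumes tri: "(f, g, h) \<in> Tri C" and f: "f \<in> hom_set C X Y" and g: "g \<in> hom_set C Y Z"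
  shows "g \<cdot> f = Zero C X Z"
proof -
  obtain N where N: "zero_object C N" using zero_object_exists by blast
  note o = hom_objs[OF f] hom_objs(2)[OF g] and NO = zero_objectD(1)[OF N]
  have h: "h \<in> hom_set C Z (shift_obj C X)" using tri_homs(3)[OF tri f g] .
  obtain c where c: "c \<in> hom_set C N Z" "c \<cdot> Zero C X N = g \<cdot> f"
    using tri_map[OF tri_idn[OF o(1) N] tri idn_hom[OF o(1)] zero_hom[OF o(1) NO]
      zero_hom[OF NO shift_obj_closed[OF o(1)]] f g h idn_hom[OF o(1)] f] by blast
  then show ?thesis using cmp_zero[OF c(1) o(1)] by simp
qed

text \<open>Map the triangle to \<open>0 \<rightarrow> V = V \<rightarrow> \<Sigma>0\<close>, which is a triangle because it rotates to
  \<open>V = V \<rightarrow> \<Sigma>0\<close>, where \<open>\<Sigma>0\<close> is again a zero object.\<close>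

lemma cohom_exact:
  assumes tri: "(f, g, h) \<in> Tri C" and f: "f \<in> hom_set C X Y" and g: "g \<in> hom_set C Y Z"
    and u: "u \<in> hom_set C Y V" and zero: "u \<cdot> f = Zero C X V"
  shows "\<exists>v \<in> hom_set C Z V. v \<cdot> g = u"
proof -
  obtain N where N: "zero_object C N" using zero_object_exists by blast
  note o = hom_objs[OF f] hom_objs[OF u] and NO = zero_objectD(1)[OF N]
  note SNO = shift_obj_closed[OF NO]
  have h: "h \<in> hom_set C Z (shift_obj C X)" using tri_homs(3)[OF tri f g] .
  have ids: "Idn C (shift_obj C N) = Zero C (shift_obj C N) (shift_obj C N)"
    using zero_objectD(2)[OF N idn_hom[OF NO]] shift_idn[OF NO] shift_zero[OF NO NO] by simp
  have SN: "zero_object C (shift_obj C N)"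
    unfolding zero_object_def
  proof (intro conjI ballI)
    fix W assume W: "W \<in> Obj C"
    have "a = Zero C W (shift_obj C N)" if "a \<in> hom_set C W (shift_obj C N)" for a
      using idn_cmp[OF that] ids zero_cmp[OF that SNO] by simp
    then show "hom_set C W (shift_obj C N) = {Zero C W (shift_obj C N)}" using zero_hom[OF W SNO] by blast
    have "a = Zero C (shift_obj C N) W" if "a \<in> hom_set C (shift_obj C N) W" for a
      using cmp_idn[OF that] ids cmp_zero[OF that SNO] by simp
    then show "hom_set C (shift_obj C N) W = {Zero C (shift_obj C N) W}" using zero_hom[OF SNO W] by blast
  qed (rule SNO)
  note V = o(4)
  have cand: "candidate C (Zero C N V) (Idn C V) (Zero C V (shift_obj C N))"
    by (rule candidateI[OF zero_hom[OF NO V] idn_hom[OF V] zero_hom[OF V SNO]])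
  have "neg C (shift_arr C (Zero C N V)) = Zero C (shift_obj C N) (shift_obj C V)"
    using shift_zero[OF NO V] neg_zero[OF SNO shift_obj_closed[OF V]] by simp
  then have tri': "(Zero C N V, Idn C V, Zero C V (shift_obj C N)) \<in> Tri C"
    using tri_rotate[OF cand] tri_idn[OF V SN] by simp
  have "u \<cdot> f = Zero C N V \<cdot> Zero C X N"
    using zero cmp_zero[OF zero_hom[OF NO V] o(1)] by simp
  then obtain c where "c \<in> hom_set C Z V" "c \<cdot> g = Idn C V \<cdot> u"
    using tri_map[OF tri tri' f g h zero_hom[OF NO V] idn_hom[OF V] zero_hom[OF V SNO]
      zero_hom[OF o(1) NO] u] by blast
  then show ?thesis using idn_cmp[OF u] by auto
qed

text \<open>Map \<open>V \<rightarrow> 0 \<rightarrow> \<Sigma>V \<rightarrow> \<Sigma>V\<close> to the rotated triangle; the third component of the map is the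
  suspension of the one that is wanted.\<close>

lemma hom_exact:
  assumes tri: "(f, g, h) \<in> Tri C" and f: "f \<in> hom_set C X Y" and g: "g \<in> hom_set C Y Z"
    and u: "u \<in> hom_set C V Y" and zero: "g \<cdot> u = Zero C V Z"
  shows "\<exists>v \<in> hom_set C V X. f \<cdot> v = u"
proof -
  obtain N where N: "zero_object C N" using zero_object_exists by blast
  note o = hom_objs[OF f] hom_objs[OF u] hom_objs[OF g] and NO = zero_objectD(1)[OF N]
  note V = o(3)
  note SV = shift_obj_closed[OF V]
  have h: "h \<in> hom_set C Z (shift_obj C X)" using tri_homs(3)[OF tri f g] .
  note Sf = shift_hom[OF f] and Su = shift_hom[OF u]
  have id: "shift_arr C (Idn C V) = Idn C (shift_obj C V)" by (rule shift_idn[OF V])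
  have sq: "Zero C N Z \<cdot> Zero C V N = g \<cdot> u"
    using zero cmp_zero[OF zero_hom[OF NO o(6)] V] by simp
  obtain c where c: "c \<in> hom_set C (shift_obj C V) (shift_obj C X)"
    and eq: "shift_arr C u \<cdot> neg C (Idn C (shift_obj C V)) = neg C (shift_arr C f) \<cdot> c"
    using tri_map[OF rotate[OF tri_idn[OF V N]] rotate[OF tri] zero_hom[OF V NO] zero_hom[OF NO SV]
      _ g h neg_hom[OF Sf] u zero_hom[OF NO o(6)] sq] neg_hom[OF idn_hom[OF SV]] id by auto
  have "neg C (shift_arr C u) = neg C (shift_arr C f \<cdot> c)"
    using eq unfolding cmp_neg(1)[OF idn_hom[OF SV] Su] cmp_neg(2)[OF c Sf] cmp_idn[OF Su] .
  then have eq: "shift_arr C u = shift_arr C f \<cdot> c"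
    using neg_neg[OF Su] neg_neg[OF cmp_hom[OF c Sf]] by metis
  obtain v where v: "v \<in> hom_set C V X" "shift_arr C v = c"
    using shift_full[OF V o(1) c] by blast
  have "f \<cdot> v = u"
    using shift_faithful[OF cmp_hom[OF v(1) f] u] shift_cmp[OF v(1) f] v(2) eq by metis
  then show ?thesis using v(1) by blast
qed

text \<open>Complete \<open>f\<close> to a triangle and transport its third object along an isomorphism with a
  suspension; the rotation axiom reads backwards then.\<close>

lemma tri_complete_second:
  assumes f: "f \<in> hom_set C X Y"
  shows "\<exists>Z. \<exists>g \<in> hom_set C Z X. \<exists>h \<in> hom_set C Y (shift_obj C Z). (g, f, h) \<in> Tri C"
proof -
  obtain p q where tri: "(f, p, q) \<in> Tri C" using tri_complete[OF hom_setD(1)[OF f]] by blast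
  obtain K where p: "p \<in> hom_set C Y K" and q: "q \<in> hom_set C K (shift_obj C X)"
    using tri_homs(1)[OF tri f] by blast
  note o = hom_objs[OF f] hom_objs(2)[OF p]
  obtain Z e where Z: "Z \<in> Obj C" and e: "e \<in> hom_set C (shift_obj C Z) K" "iso_arr C e"
    using shift_dense[OF o(3)] by blast
  obtain e' where e': "e' \<in> hom_set C K (shift_obj C Z)" "e' \<cdot> e = Idn C (shift_obj C Z)" "e \<cdot> e' = Idn C K"
    using iso_arrE[OF e(2,1)] .
  have qe: "q \<cdot> e \<in> hom_set C (shift_obj C Z) (shift_obj C X)" by (rule cmp_hom[OF e(1) q])
  obtain g where g: "g \<in> hom_set C Z X" "shift_arr C g = neg C (q \<cdot> e)"
    using shift_full[OF Z o(1) neg_hom[OF qe]] by blast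
  have ng: "neg C (shift_arr C g) = q \<cdot> e" using neg_neg[OF qe] g(2) by simp
  have h: "e' \<cdot> p \<in> hom_set C Y (shift_obj C Z)" by (rule cmp_hom[OF p e'(1)])
  have "(f, e' \<cdot> p, q \<cdot> e) \<in> Tri C"
  proof (rule tri_iso[OF tri candidateI[OF f h qe] iso_idn[OF o(1)] iso_idn[OF o(2)] iso_arrI[OF e'(1) e(1) e'(3,2)]])
    show "Idn C X \<in> hom_set C (Dom C f) (Dom C f)" "Idn C Y \<in> hom_set C (Dom C p) (Dom C (e' \<cdot> p))"
      "e' \<in> hom_set C (Dom C q) (Dom C (q \<cdot> e))"
      using idn_hom[OF o(1)] idn_hom[OF o(2)] e'(1) hom_setD[OF f] hom_setD[OF p] hom_setD[OF h]
        hom_setD[OF q] hom_setD[OF qe] by simp_all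
    show "Idn C Y \<cdot> f = f \<cdot> Idn C X" using f by (simp add: idn_cmp cmp_idn)
    show "e' \<cdot> p = (e' \<cdot> p) \<cdot> Idn C Y" using cmp_idn[OF h] by simp
    show "shift_arr C (Idn C X) \<cdot> q = (q \<cdot> e) \<cdot> e'"
      using shift_idn[OF o(1)] idn_cmp[OF q] cmp_assoc[OF e'(1) e(1) q] e'(3) cmp_idn[OF q] by simp
  qed
  then have "(g, f, e' \<cdot> p) \<in> Tri C" using tri_rotate[OF candidateI[OF g(1) f h]] ng by simp
  then show ?thesis using g(1) h by blast
qed

end

section \<open>A rigid object with approximations\<close>

lemma factoringI:
  assumes "a \<in> hom_set C X N" "b \<in> hom_set C N Y" "N \<in> S" "b \<cdot>\<^bsub>C\<^esub> a \<in> hom_set C X Y"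
  shows "b \<cdot>\<^bsub>C\<^esub> a \<in> factoring C S"
  using assms(1-3) hom_setD[OF assms(4)] unfolding factoring_def by auto

locale rigid_object = triangulated_category C
  for C :: "('o, 'm, 'z) tri_cat_scheme" (structure) +
  fixes T :: 'o
  assumes T_obj: "T \<in> Obj C" and T_rigid: "rigid C T" and T_approx: "contravariantly_finite C T"
begin

abbreviation "W \<equiv> localising_class C T"

lemma T_in_add: "T \<in> add_objs C T"
  by (rule self_in_add_objs[OF T_obj])

lemma T_shift_zero: "\<lbrakk>N \<in> add_objs C (shift_obj C T); t \<in> hom_set C T N\<rbrakk> \<Longrightarrow> t = Zero C T N"
  using add_objs_hom_zero[of N "shift_obj C T" T t] T_rigid by (simp add: rigid_def)

lemma approximation:
  assumes "X \<in> Obj C"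
  obtains D d where "D \<in> add_objs C T" "d \<in> hom_set C D X"
    "\<forall>t \<in> hom_set C T X. \<exists>s \<in> hom_set C T D. t = d \<cdot> s"
  using T_approx assms T_in_add unfolding contravariantly_finite_def by meson

text \<open>If \<open>d : D \<rightarrow> X\<close> is an approximation by \<open>add T\<close>, an arrow that \<open>T\<close> does not see vanishes on \<open>D\<close>
  and factors through the cone of \<open>d\<close>. That cone lies in \<open>T\<^sup>\<bottom>\<close>, because every \<open>T \<rightarrow> X\<close> factors
  through \<open>d\<close> and \<open>T\<close> is rigid.\<close>

lemma in_perp_ideal_iff:
  assumes f: "f \<in> hom_set C X Y"
  shows "f \<in> factoring C (perp_objs C T) \<longleftrightarrow> (\<forall>t \<in> hom_set C T X. f \<cdot> t = Zero C T Y)"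
proof
  assume "f \<in> factoring C (perp_objs C T)"
  then obtain N a b where N: "N \<in> perp_objs C T" and a: "a \<in> hom_set C X N" and b: "b \<in> hom_set C N Y"
    and fab: "f = b \<cdot> a" using hom_setD[OF f] unfolding factoring_def by auto
  show "\<forall>t \<in> hom_set C T X. f \<cdot> t = Zero C T Y"
  proof
    fix t assume t: "t \<in> hom_set C T X"
    have "a \<cdot> t = Zero C T N" using cmp_hom[OF t a] N by (simp add: perp_objs_def)
    then show "f \<cdot> t = Zero C T Y" using cmp_assoc[OF t a b] cmp_zero[OF b T_obj] fab by simp
  qed
next
  assume null: "\<forall>t \<in> hom_set C T X. f \<cdot> t = Zero C T Y"
  note o = hom_objs[OF f]
  obtain D d where D: "D \<in> add_objs C T" and d: "d \<in> hom_set C D X"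
    and approx: "\<forall>t \<in> hom_set C T X. \<exists>s \<in> hom_set C T D. t = d \<cdot> s" using approximation[OF o(1)] .
  note DO = add_objs_obj[OF D]
  obtain g h where tri: "(d, g, h) \<in> Tri C" using tri_complete[OF hom_setD(1)[OF d]] by blast
  obtain N where g: "g \<in> hom_set C X N" and h: "h \<in> hom_set C N (shift_obj C D)"
    using tri_homs(1)[OF tri d] by blast
  have "f \<cdot> d = Zero C D Y"
  proof (rule add_objs_ext[OF D cmp_hom[OF d f] zero_hom[OF DO o(2)]])
    show "(f \<cdot> d) \<cdot> t = Zero C D Y \<cdot> t" if "t \<in> hom_set C T D" for t
      using cmp_assoc[OF that d f] null cmp_hom[OF that d] zero_cmp[OF that o(2)] by simp
  qed
  then obtain v where v: "v \<in> hom_set C N Y" "v \<cdot> g = f" using cohom_exact[OF tri d g f] by blast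
  have "t = Zero C T N" if t: "t \<in> hom_set C T N" for t
  proof -
    have "h \<cdot> t = Zero C T (shift_obj C D)"
      by (rule T_shift_zero[OF shift_add_objs[OF D] cmp_hom[OF t h]])
    then obtain s where s: "s \<in> hom_set C T X" "g \<cdot> s = t"
      using hom_exact[OF rotate[OF tri] g h t] by blast
    obtain r where r: "r \<in> hom_set C T D" "s = d \<cdot> r" using approx s(1) by blast
    show ?thesis
      using cmp_assoc[OF r(1) d g] tri_cmp_zero[OF tri d g] zero_cmp[OF r(1) hom_objs(2)[OF g]] r(2) s(2) by simp
  qed
  then have "N \<in> perp_objs C T"
    using zero_hom[OF T_obj hom_objs(2)[OF g]] hom_objs(2)[OF g] unfolding perp_objs_def by blast
  then show "f \<in> factoring C (perp_objs C T)"
    using factoringI[OF g v(1) _ cmp_hom[OF g v(1)]] v(2) by simp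
qed

lemma W_arr: "W \<subseteq> Arr C"
  by (auto simp: localising_class_def)

text \<open>In the long exact sequence of a triangle \<open>Z \<rightarrow> X \<rightarrow> Y \<rightarrow> \<Sigma>Z\<close> on \<open>g, f, h\<close>, injectivity of \<open>C(T,f)\<close>
  amounts to \<open>C(T,g) = 0\<close> and surjectivity to \<open>C(T,h) = 0\<close>.\<close>

lemma in_W_iff:
  assumes f: "f \<in> hom_set C X Y"
  shows "f \<in> W \<longleftrightarrow> (\<forall>t \<in> hom_set C T X. f \<cdot> t = Zero C T Y \<longrightarrow> t = Zero C T X) \<and>
    (\<forall>t \<in> hom_set C T Y. \<exists>s \<in> hom_set C T X. f \<cdot> s = t)"
    (is "_ \<longleftrightarrow> ?inj \<and> ?surj")
proof
  assume W: "f \<in> W"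
  obtain Z g h where g: "g \<in> hom_set C Z X" and h: "h \<in> hom_set C Y (shift_obj C Z)" and tri: "(g, f, h) \<in> Tri C"
    using tri_complete_second[OF f] by blast
  have null: "\<forall>t \<in> hom_set C T Z. g \<cdot> t = Zero C T X" "\<forall>t \<in> hom_set C T Y. h \<cdot> t = Zero C T (shift_obj C Z)"
    using W tri in_perp_ideal_iff[OF g] in_perp_ideal_iff[OF h] unfolding localising_class_def by auto
  have ?inj
  proof (intro ballI impI)
    fix t assume t: "t \<in> hom_set C T X" "f \<cdot> t = Zero C T Y"
    then show "t = Zero C T X" using hom_exact[OF tri g f t] null(1) by auto
  qed
  moreover have ?surj
    using hom_exact[OF rotate[OF tri] f h] null(2) by blast
  ultimately show "?inj \<and> ?surj" ..
next
  assume bij: "?inj \<and> ?surj"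
  have "g \<in> factoring C (perp_objs C T) \<and> h \<in> factoring C (perp_objs C T)" if tri: "(g, f, h) \<in> Tri C" for g h
  proof -
    obtain Z where g: "g \<in> hom_set C Z X" and h: "h \<in> hom_set C Y (shift_obj C Z)"
      using tri_homs(2)[OF tri f] by blast
    have "g \<cdot> t = Zero C T X" if t: "t \<in> hom_set C T Z" for t
    proof -
      have "f \<cdot> (g \<cdot> t) = Zero C T Y"
        using cmp_assoc[OF t g f] tri_cmp_zero[OF tri g f] zero_cmp[OF t hom_objs(2)[OF f]] by simp
      then show ?thesis using bij cmp_hom[OF t g] by blast
    qed
    moreover have "h \<cdot> t = Zero C T (shift_obj C Z)" if t: "t \<in> hom_set C T Y" for t
    proof -
      obtain s where s: "s \<in> hom_set C T X" "f \<cdot> s = t" using bij t by blast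
      show ?thesis
        using cmp_assoc[OF s(1) f h] tri_cmp_zero[OF rotate[OF tri] f h] zero_cmp[OF s(1) hom_objs(2)[OF h]] s(2) by simp
    qed
    ultimately show ?thesis using in_perp_ideal_iff[OF g] in_perp_ideal_iff[OF h] by simp
  qed
  then show "f \<in> W" using hom_setD(1)[OF f] unfolding localising_class_def by blast
qed

lemma W_lift: "\<lbrakk>w \<in> W; w \<in> hom_set C X Y; t \<in> hom_set C T Y\<rbrakk> \<Longrightarrow> \<exists>s \<in> hom_set C T X. w \<cdot> s = t"
  using in_W_iff by blast

lemma W_cancel:
  assumes "w \<in> W" "w \<in> hom_set C X Y" "s \<in> hom_set C T X" "t \<in> hom_set C T X" "w \<cdot> s = w \<cdot> t"
  shows "s = t"
proof -
  have "w \<cdot> (s \<ominus> t) = Zero C T Y"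
    using cmp_sub_right[OF assms(3,4,2)] assms(5) sub_eq_zero[OF cmp_hom[OF assms(3,2)] cmp_hom[OF assms(4,2)]] by simp
  then have "s \<ominus> t = Zero C T X" using assms(1) sub_hom[OF assms(3,4)] in_W_iff[OF assms(2)] by blast
  then show ?thesis using sub_eq_zero[OF assms(3,4)] by simp
qed

lemma W_I:
  assumes f: "f \<in> hom_set C X Y"
    and inj: "\<And>t. \<lbrakk>t \<in> hom_set C T X; f \<cdot> t = Zero C T Y\<rbrakk> \<Longrightarrow> t = Zero C T X"
    and surj: "\<And>t. t \<in> hom_set C T Y \<Longrightarrow> \<exists>s \<in> hom_set C T X. f \<cdot> s = t"
  shows "f \<in> W"
  using in_W_iff[OF f] assms(2,3) by blast

lemma idn_in_W: "X \<in> Obj C \<Longrightarrow> Idn C X \<in> W"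
  by (rule W_I[OF idn_hom]) (auto simp: idn_cmp)

subsection \<open>Objects with a presentation by \<open>add T\<close>\<close>

lemma cone_objsE:
  assumes "P \<in> cone_objs C T"
  obtains D1 D0 f q r where "D1 \<in> add_objs C T" "D0 \<in> add_objs C T" "(f, q, r) \<in> Tri C"
    "f \<in> hom_set C D1 D0" "q \<in> hom_set C D0 P" "r \<in> hom_set C P (shift_obj C D1)"
    "\<forall>t \<in> hom_set C T P. \<exists>s \<in> hom_set C T D0. q \<cdot> s = t"
proof -
  obtain f q r where tri: "(f, q, r) \<in> Tri C" and D: "Dom C f \<in> add_objs C T" "Cod C f \<in> add_objs C T"
    and P: "Cod C q = P"
    using assms unfolding cone_objs_def by blast
  obtain D1 D0 where f: "f \<in> hom_set C D1 D0" using D tri_candidate[OF tri] arr_in_hom by (auto simp: candidate_def)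
  have q: "q \<in> hom_set C D0 P" and r: "r \<in> hom_set C P (shift_obj C D1)"
    using tri_homs(1)[OF tri f] P hom_setD(3) by metis+
  have D1: "D1 \<in> add_objs C T" and D0: "D0 \<in> add_objs C T" using D hom_setD[OF f] by simp_all
  have "\<exists>s \<in> hom_set C T D0. q \<cdot> s = t" if t: "t \<in> hom_set C T P" for t
    using hom_exact[OF rotate[OF tri] q r t] T_shift_zero[OF shift_add_objs[OF D1] cmp_hom[OF t r]] by blast
  then show ?thesis using that[OF D1 D0 tri f q r] by blast
qed

lemma cone_objs_obj: "P \<in> cone_objs C T \<Longrightarrow> P \<in> Obj C"
  using hom_objs(2) by (elim cone_objsE)

text \<open>A two-step resolution of \<open>X\<close>: if \<open>Z \<rightarrow> D0 \<rightarrow> X\<close> are the first two arrows of a triangle on an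
  approximation of \<open>X\<close>, and \<open>D1 \<rightarrow> Z\<close> is an approximation, then \<open>C(T,P)\<close> for the cone \<open>P\<close> of
  \<open>D1 \<rightarrow> D0\<close> is the cokernel of \<open>C(T,D1) \<rightarrow> C(T,D0)\<close>, which is \<open>C(T,X)\<close>.\<close>

lemma resolution_exists:
  assumes X: "X \<in> Obj C"
  shows "\<exists>P \<in> cone_objs C T. \<exists>w \<in> hom_set C P X. w \<in> W"
proof -
  obtain D0 d0 where D0: "D0 \<in> add_objs C T" and d0: "d0 \<in> hom_set C D0 X"
    and a0: "\<forall>t \<in> hom_set C T X. \<exists>s \<in> hom_set C T D0. t = d0 \<cdot> s" using approximation[OF X] .
  obtain Z z h where z: "z \<in> hom_set C Z D0" and h: "h \<in> hom_set C X (shift_obj C Z)"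
    and tri0: "(z, d0, h) \<in> Tri C" using tri_complete_second[OF d0] by blast
  obtain D1 d1 where D1: "D1 \<in> add_objs C T" and d1: "d1 \<in> hom_set C D1 Z"
    and a1: "\<forall>t \<in> hom_set C T Z. \<exists>s \<in> hom_set C T D1. t = d1 \<cdot> s"
    using approximation[OF hom_objs(1)[OF z]] .
  define f where "f = z \<cdot> d1"
  have f: "f \<in> hom_set C D1 D0" unfolding f_def by (rule cmp_hom[OF d1 z])
  obtain q r where tri: "(f, q, r) \<in> Tri C" using tri_complete[OF hom_setD(1)[OF f]] by blast
  obtain P where q: "q \<in> hom_set C D0 P" and r: "r \<in> hom_set C P (shift_obj C D1)"
    using tri_homs(1)[OF tri f] by blast
  have P: "P \<in> cone_objs C T" unfolding cone_objs_def using tri D0 D1 hom_setD[OF f] hom_setD[OF q] by blast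
  have "d0 \<cdot> f = Zero C D1 X"
    using cmp_assoc[OF d1 z d0] tri_cmp_zero[OF tri0 z d0] zero_cmp[OF d1 X] by (simp add: f_def)
  then obtain w where w: "w \<in> hom_set C P X" "w \<cdot> q = d0" using cohom_exact[OF tri f q d0] by blast
  have "w \<in> W"
  proof (rule W_I[OF w(1)])
    fix t assume t: "t \<in> hom_set C T P" and wt: "w \<cdot> t = Zero C T X"
    have "r \<cdot> t = Zero C T (shift_obj C D1)" by (rule T_shift_zero[OF shift_add_objs[OF D1] cmp_hom[OF t r]])
    then obtain s where s: "s \<in> hom_set C T D0" "q \<cdot> s = t" using hom_exact[OF rotate[OF tri] q r t] by blast
    have "d0 \<cdot> s = Zero C T X" using cmp_assoc[OF s(1) q w(1)] w(2) s(2) wt by simp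
    then obtain s' where s': "s' \<in> hom_set C T Z" "z \<cdot> s' = s" using hom_exact[OF tri0 z d0 s(1)] by blast
    obtain v where v: "v \<in> hom_set C T D1" "s' = d1 \<cdot> v" using a1 s'(1) by blast
    have "s = f \<cdot> v" using cmp_assoc[OF v(1) d1 z] v(2) s'(2) by (simp add: f_def)
    then show "t = Zero C T P"
      using cmp_assoc[OF v(1) f q] tri_cmp_zero[OF tri f q] zero_cmp[OF v(1) hom_objs(2)[OF q]] s(2) by simp
  next
    fix t assume t: "t \<in> hom_set C T X"
    obtain s where s: "s \<in> hom_set C T D0" "t = d0 \<cdot> s" using a0 t by blast
    show "\<exists>u \<in> hom_set C T P. w \<cdot> u = t"
      using cmp_hom[OF s(1) q] cmp_assoc[OF s(1) q w(1)] w(2) s(2) by (intro bexI[of _ "q \<cdot> s"]) simp_all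
  qed
  then show ?thesis using P w(1) by blast
qed

text \<open>This is the congruence of the ideal \<open>(T\<^sup>\<bottom>)\<close>, in a form in which its compatibility with composition
  and its relation to \<open>W\<close> are immediate.\<close>

definition same_on_T (infix "\<sim>" 50) where
  "f \<sim> g \<longleftrightarrow> f \<in> Arr C \<and> g \<in> hom_set C (Dom C f) (Cod C f) \<and> (\<forall>t \<in> hom_set C T (Dom C f). f \<cdot> t = g \<cdot> t)"

lemma same_iff:
  "f \<in> hom_set C X Y \<Longrightarrow> f \<sim> g \<longleftrightarrow> g \<in> hom_set C X Y \<and> (\<forall>t \<in> hom_set C T X. f \<cdot> t = g \<cdot> t)"
  unfolding same_on_T_def by (auto simp: hom_set_def)

lemma same_refl: "f \<in> Arr C \<Longrightarrow> f \<sim> f"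
  by (simp add: same_on_T_def hom_set_def)

lemma same_sym: "f \<sim> g \<Longrightarrow> g \<sim> f"
  by (auto simp: same_on_T_def hom_set_def)

lemma same_trans: "f \<sim> g \<Longrightarrow> g \<sim> h \<Longrightarrow> f \<sim> h"
  by (auto simp: same_on_T_def hom_set_def)

lemma same_cmp:
  assumes "f \<sim> f'" "g \<sim> g'" and f: "f \<in> hom_set C X Y" and g: "g \<in> hom_set C Y Z"
  shows "g \<cdot> f \<sim> g' \<cdot> f'"
proof -
  have f': "f' \<in> hom_set C X Y" and ft: "\<And>t. t \<in> hom_set C T X \<Longrightarrow> f \<cdot> t = f' \<cdot> t"
    using assms(1) same_iff[OF f] by auto
  have g': "g' \<in> hom_set C Y Z" and gt: "\<And>t. t \<in> hom_set C T Y \<Longrightarrow> g \<cdot> t = g' \<cdot> t"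
    using assms(2) same_iff[OF g] by auto
  have "(g \<cdot> f) \<cdot> t = (g' \<cdot> f') \<cdot> t" if t: "t \<in> hom_set C T X" for t
    using cmp_assoc[OF t f g] cmp_assoc[OF t f' g'] ft[OF t] gt[OF cmp_hom[OF t f']] by simp
  then show ?thesis using same_iff[OF cmp_hom[OF f g]] cmp_hom[OF f' g'] by blast
qed

lemma same_cancel:
  assumes "w \<in> W" "w \<in> hom_set C Y Z" and f: "f \<in> hom_set C X Y" and g: "g \<in> hom_set C X Y"
    and "w \<cdot> f \<sim> w \<cdot> g"
  shows "f \<sim> g"
proof -
  have "f \<cdot> t = g \<cdot> t" if t: "t \<in> hom_set C T X" for t
    using W_cancel[OF assms(1,2) cmp_hom[OF t f] cmp_hom[OF t g]] assms(5) t
      same_iff[OF cmp_hom[OF f assms(2)]] cmp_assoc[OF t f assms(2)] cmp_assoc[OF t g assms(2)] by simp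
  then show ?thesis using same_iff[OF f] g by blast
qed

lemma same_iff_perp:
  assumes "f \<in> hom_set C X Y" "g \<in> hom_set C X Y"
  shows "f \<sim> g \<longleftrightarrow> f \<ominus> g \<in> factoring C (perp_objs C T)"
proof -
  have "(f \<ominus> g) \<cdot> t = Zero C T Y \<longleftrightarrow> f \<cdot> t = g \<cdot> t" if "t \<in> hom_set C T X" for t
    using cmp_sub_left[OF that assms] sub_eq_zero[OF cmp_hom[OF that assms(1)] cmp_hom[OF that assms(2)]] by simp
  then show ?thesis using in_perp_ideal_iff[OF sub_hom[OF assms]] same_iff[OF assms(1)] assms(2) by simp
qed

text \<open>Let \<open>D1 \<rightarrow> D0 \<rightarrow> P\<close> be a presentation. The restriction of \<open>f\<close> to \<open>D0\<close> lifts along \<open>w\<close>, because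
  \<open>D0\<close> is projective relative to \<open>w\<close>. The lift kills \<open>D1\<close>, because \<open>w\<close> is monic for arrows out of
  \<open>D1\<close>, and therefore descends to \<open>P\<close>.\<close>

lemma lift_along_W:
  assumes P: "P \<in> cone_objs C T" and w: "w \<in> W" "w \<in> hom_set C X Y" and f: "f \<in> hom_set C P Y"
  shows "\<exists>g \<in> hom_set C P X. w \<cdot> g \<sim> f"
proof -
  obtain D1 D0 k q r where D: "D1 \<in> add_objs C T" "D0 \<in> add_objs C T" and tri: "(k, q, r) \<in> Tri C"
    and k: "k \<in> hom_set C D1 D0" and q: "q \<in> hom_set C D0 P" and r: "r \<in> hom_set C P (shift_obj C D1)"
    and onto: "\<forall>t \<in> hom_set C T P. \<exists>s \<in> hom_set C T D0. q \<cdot> s = t" using cone_objsE[OF P] .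
  have X: "X \<in> Obj C" using hom_objs[OF w(2)] by simp
  obtain u where u: "u \<in> hom_set C D0 X" "w \<cdot> u = f \<cdot> q"
    using add_objs_lift[OF D(2) cmp_hom[OF q f] w(2)] W_lift[OF w] by blast
  have "u \<cdot> k = Zero C D1 X"
  proof (rule add_objs_ext[OF D(1) cmp_hom[OF k u(1)] zero_hom[OF add_objs_obj[OF D(1)] X]])
    fix t assume t: "t \<in> hom_set C T D1"
    have "w \<cdot> ((u \<cdot> k) \<cdot> t) = ((f \<cdot> q) \<cdot> k) \<cdot> t"
      using cmp_assoc[OF t cmp_hom[OF k u(1)] w(2)] cmp_assoc[OF k u(1) w(2)] u(2) by simp
    also have "\<dots> = (f \<cdot> Zero C D1 P) \<cdot> t" using cmp_assoc[OF k q f] tri_cmp_zero[OF tri k q] by simp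
    also have "\<dots> = Zero C T Y"
      using cmp_zero[OF f hom_objs(1)[OF k]] zero_cmp[OF t hom_objs(2)[OF f]] by simp
    also have "\<dots> = w \<cdot> Zero C T X" using cmp_zero[OF w(2) T_obj] by simp
    finally have "(u \<cdot> k) \<cdot> t = Zero C T X"
      using W_cancel[OF w cmp_hom[OF t cmp_hom[OF k u(1)]] zero_hom[OF T_obj X]] by blast
    then show "(u \<cdot> k) \<cdot> t = Zero C D1 X \<cdot> t" using zero_cmp[OF t X] by simp
  qed
  then obtain v where v: "v \<in> hom_set C P X" "v \<cdot> q = u" using cohom_exact[OF tri k q u(1)] by blast
  have "(w \<cdot> v) \<cdot> t = f \<cdot> t" if t: "t \<in> hom_set C T P" for t
  proof -
    obtain s where s: "s \<in> hom_set C T D0" "q \<cdot> s = t" using onto t by blast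
    have "(w \<cdot> v) \<cdot> t = (w \<cdot> (v \<cdot> q)) \<cdot> s"
      using cmp_assoc[OF s(1) q cmp_hom[OF v(1) w(2)]] cmp_assoc[OF q v(1) w(2)] s(2) by simp
    also have "\<dots> = f \<cdot> t" using v(2) u(2) cmp_assoc[OF s(1) q f] s(2) by simp
    finally show ?thesis .
  qed
  then show ?thesis using same_iff[OF cmp_hom[OF v(1) w(2)]] f v(1) by blast
qed

text \<open>An arrow out of \<open>P\<close> that \<open>T\<close> does not see vanishes on \<open>D0\<close>, hence factors through \<open>\<Sigma>D1\<close>, where
  \<open>D1 \<rightarrow> D0 \<rightarrow> P\<close> is a presentation; so the ideals \<open>(T\<^sup>\<bottom>)\<close> and \<open>(\<Sigma>T)\<close> agree on arrows out of \<open>P\<close>.\<close>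

lemma same_iff_shift:
  assumes P: "P \<in> cone_objs C T" and f: "f \<in> hom_set C P Y" and g: "g \<in> hom_set C P Y"
  shows "f \<sim> g \<longleftrightarrow> f \<ominus> g \<in> factoring C (add_objs C (shift_obj C T))"
proof
  note fg = sub_hom[OF f g]
  have "add_objs C (shift_obj C T) \<subseteq> perp_objs C T"
  proof
    fix N assume N: "N \<in> add_objs C (shift_obj C T)"
    then show "N \<in> perp_objs C T"
      using T_shift_zero[OF N] add_objs_obj[OF N] zero_hom[OF T_obj add_objs_obj[OF N]]
      unfolding perp_objs_def by blast
  qed
  then have "factoring C (add_objs C (shift_obj C T)) \<subseteq> factoring C (perp_objs C T)"
    unfolding factoring_def by blast
  then show "f \<sim> g" if "f \<ominus> g \<in> factoring C (add_objs C (shift_obj C T))"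
    using that same_iff_perp[OF f g] by blast
  assume "f \<sim> g"
  then have null: "(f \<ominus> g) \<cdot> t = Zero C T Y" if "t \<in> hom_set C T P" for t
    using that same_iff_perp[OF f g] in_perp_ideal_iff[OF fg] by blast
  obtain D1 D0 k q r where D: "D1 \<in> add_objs C T" "D0 \<in> add_objs C T" and tri: "(k, q, r) \<in> Tri C"
    and k: "k \<in> hom_set C D1 D0" and q: "q \<in> hom_set C D0 P" and r: "r \<in> hom_set C P (shift_obj C D1)"
    using cone_objsE[OF P] .
  have Y: "Y \<in> Obj C" using hom_objs[OF f] by simp
  have "(f \<ominus> g) \<cdot> q = Zero C D0 Y"
  proof (rule add_objs_ext[OF D(2) cmp_hom[OF q fg] zero_hom[OF add_objs_obj[OF D(2)] Y]])
    show "((f \<ominus> g) \<cdot> q) \<cdot> t = Zero C D0 Y \<cdot> t" if t: "t \<in> hom_set C T D0" for t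
      using cmp_assoc[OF t q fg] null[OF cmp_hom[OF t q]] zero_cmp[OF t Y] by simp
  qed
  then obtain v where v: "v \<in> hom_set C (shift_obj C D1) Y" "v \<cdot> r = f \<ominus> g"
    using cohom_exact[OF rotate[OF tri] q r fg] by blast
  show "f \<ominus> g \<in> factoring C (add_objs C (shift_obj C T))"
    using factoringI[OF r v(1) shift_add_objs[OF D(1)] cmp_hom[OF r v(1)]] v(2) by simp
qed

end

section \<open>Localising at a rigid object\<close>

lemma hom_group_full_subcat:
  "\<lbrakk>X \<in> S; Y \<in> S\<rbrakk> \<Longrightarrow> hom_group (full_subcat C S) X Y = hom_group C X Y"
  by (simp add: hom_group_def hom_full_subcat) (simp add: full_subcat_def)

context rigid_object
begin

abbreviation "A \<equiv> full_subcat C (cone_objs C T)"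
abbreviation "R \<equiv> ideal_congruence A (factoring C (add_objs C (shift_obj C T)))"

lemma category_A: "category A"
  by (rule category_full_subcat[OF category_axioms]) (auto intro: cone_objs_obj)

lemma A_hom: "\<lbrakk>P \<in> cone_objs C T; Q \<in> cone_objs C T\<rbrakk> \<Longrightarrow> hom_set A P Q = hom_set C P Q"
  by (rule hom_full_subcat)

lemma R_iff: "(f, g) \<in> R \<longleftrightarrow> f \<in> Arr A \<and> f \<sim> g"
proof (cases "f \<in> Arr A \<and> g \<in> hom_set C (Dom C f) (Cod C f)")
  case True
  then have f: "f \<in> hom_set C (Dom C f) (Cod C f)" and g: "g \<in> hom_set C (Dom C f) (Cod C f)"
    and o: "Dom C f \<in> cone_objs C T" "Cod C f \<in> cone_objs C T"
    by (auto simp: hom_set_def)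
  have "neg A g = neg C g" using hom_setD[OF g] o by (simp add: neg_def hom_group_full_subcat)
  moreover have "Add A = Add C" by (simp add: full_subcat_def)
  ultimately have "Add A f (neg A g) = f \<ominus> g" by (simp add: sub_arr_def)
  then show ?thesis
    using same_iff_shift[OF o(1) f g] True o by (auto simp: ideal_congruence_def A_hom)
next
  case False
  then show ?thesis by (auto simp: ideal_congruence_def same_on_T_def hom_set_def)
qed

sublocale AR: category_congruence A R
proof -
  interpret A: category A by (rule category_A)
  show "category_congruence A R"
  proof
    show "equiv (Arr A) R"
    proof (rule equivI)
      show "R \<subseteq> Arr A \<times> Arr A" using R_iff by (auto simp: same_on_T_def hom_set_def)
      show "refl_on (Arr A) R" using R_iff same_refl by (auto simp: refl_on_def)
      show "sym R" unfolding sym_def using R_iff same_sym by (auto simp: same_on_T_def hom_set_def)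
      show "Relation.trans R" using R_iff same_trans by (auto intro!: transI)
    qed
  next
    fix f g assume "(f, g) \<in> R"
    then show "Dom A f = Dom A g \<and> Cod A f = Cod A g" using R_iff by (auto simp: same_on_T_def hom_set_def)
  next
    fix f f' g g' assume fg: "(f, f') \<in> R" "(g, g') \<in> R" "Cod A f = Dom A g"
    then have f: "f \<in> hom_set C (Dom C f) (Dom C g)" and g: "g \<in> hom_set C (Dom C g) (Cod C g)"
      and o: "Dom C f \<in> cone_objs C T" "Cod C g \<in> cone_objs C T"
      using R_iff by (auto simp: hom_set_def)
    have "g \<cdot> f \<sim> g' \<cdot> f'" using same_cmp[OF _ _ f g] fg R_iff by blast
    then show "(g \<cdot>\<^bsub>A\<^esub> f, g' \<cdot>\<^bsub>A\<^esub> f') \<in> R"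
      using R_iff hom_setD[OF cmp_hom[OF f g]] o by simp
  qed
qed

abbreviation "AQ \<equiv> quotient_cat A R"

sublocale localised: localised_category C W
  by unfold_locales (rule W_arr)

abbreviation "CW \<equiv> localisation C W"
abbreviation "LW \<equiv> localisation_functor C W"

text \<open>If \<open>f - g = b a\<close> with \<open>a : X \<rightarrow> N\<close> and \<open>N \<in> T\<^sup>\<bottom>\<close>, let \<open>S = X \<oplus> N\<close>. The projection \<open>S \<rightarrow> X\<close> is in
  \<open>W\<close>, so its two sections \<open>(1, 0)\<close> and \<open>(1, a)\<close> become equal in the localisation; composing them with
  \<open>(g, b) : S \<rightarrow> Y\<close> gives \<open>g\<close> and \<open>f\<close>.\<close>

lemma localisation_identifies:
  assumes "f \<sim> g"
  shows "ArrMap LW f = ArrMap LW g"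
proof -
  obtain X Y where f: "f \<in> hom_set C X Y" using assms arr_in_hom by (auto simp: same_on_T_def)
  then have g: "g \<in> hom_set C X Y" using assms same_iff by blast
  note o = hom_objs[OF f]
  obtain N a b where N: "N \<in> perp_objs C T" and a: "a \<in> hom_set C X N" and b: "b \<in> hom_set C N Y"
    and fab: "f \<ominus> g = b \<cdot> a"
    using assms same_iff_perp[OF f g] hom_setD[OF sub_hom[OF f g]] unfolding factoring_def by auto
  have NO: "N \<in> Obj C" using hom_objs[OF b] by simp
  obtain S i p where S: "is_direct_sum C [X, N] S i p" using direct_sums[of "[X, N]"] o NO by auto
  note D = direct_sumD[OF S]
  have i0: "i 0 \<in> hom_set C X S" and i1: "i 1 \<in> hom_set C N S"
    and p0: "p 0 \<in> hom_set C S X" and p1: "p 1 \<in> hom_set C S N"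
    using D(3)[of 0] D(3)[of 1] D(4)[of 0] D(4)[of 1] by simp_all
  have pi: "p 0 \<cdot> i 0 = Idn C X" "p 0 \<cdot> i 1 = Zero C N X" "p 1 \<cdot> i 0 = Zero C X N" "p 1 \<cdot> i 1 = Idn C N"
    using D(5)[of 0 0] D(5)[of 0 1] D(5)[of 1 0] D(5)[of 1 1] by simp_all
  have pW: "p 0 \<in> W"
  proof (rule W_I[OF p0])
    fix t assume t: "t \<in> hom_set C T S" and zero: "p 0 \<cdot> t = Zero C T X"
    note z = zero_hom[OF T_obj D(1)]
    show "t = Zero C T S"
    proof (rule direct_sum_coext[OF S t z])
      fix k assume "k < length [X, N]"
      then have "k = 0 \<or> k = 1" by auto
      moreover have "p 1 \<cdot> t = Zero C T N" using cmp_hom[OF t p1] N by (simp add: perp_objs_def)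
      ultimately show "p k \<cdot> t = p k \<cdot> Zero C T S"
        using zero cmp_zero[OF p0 T_obj] cmp_zero[OF p1 T_obj] by auto
    qed
  next
    fix t assume t: "t \<in> hom_set C T X"
    show "\<exists>s \<in> hom_set C T S. p 0 \<cdot> s = t"
      using cmp_hom[OF t i0] cmp_assoc[OF t i0 p0] pi(1) idn_cmp[OF t] by (intro bexI[of _ "i 0 \<cdot> t"]) simp_all
  qed
  define j where "j = i 0 \<oplus> i 1 \<cdot> a"
  define m where "m = g \<cdot> p 0 \<oplus> b \<cdot> p 1"
  have i1a: "i 1 \<cdot> a \<in> hom_set C X S" by (rule cmp_hom[OF a i1])
  have j: "j \<in> hom_set C X S" unfolding j_def by (rule add_hom[OF i0 i1a])
  have gp: "g \<cdot> p 0 \<in> hom_set C S Y" and bp: "b \<cdot> p 1 \<in> hom_set C S Y"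
    using cmp_hom[OF p0 g] cmp_hom[OF p1 b] by simp_all
  have m: "m \<in> hom_set C S Y" unfolding m_def by (rule add_hom[OF gp bp])
  have pj: "p 0 \<cdot> j = Idn C X"
    unfolding j_def cmp_add_right[OF i0 i1a p0] pi(1) cmp_assoc[OF a i1 p0, symmetric] pi(2)
      zero_cmp[OF a o(1)] by (rule add_zero[OF idn_hom[OF o(1)]])
  have mi0: "m \<cdot> i 0 = g"
    unfolding m_def cmp_add_left[OF i0 gp bp] cmp_assoc[OF i0 p0 g] cmp_assoc[OF i0 p1 b] pi
      cmp_idn[OF g] cmp_zero[OF b o(1)] by (rule add_zero[OF g])
  have mi1: "m \<cdot> i 1 = b"
    unfolding m_def cmp_add_left[OF i1 gp bp] cmp_assoc[OF i1 p0 g] cmp_assoc[OF i1 p1 b] pi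
      cmp_idn[OF b] cmp_zero[OF g NO] by (rule zero_add[OF b])
  have mj: "m \<cdot> j = f"
    unfolding j_def cmp_add_right[OF i0 i1a m] mi0 cmp_assoc[OF a i1 m, symmetric] mi1
      fab[symmetric] by (rule add_sub[OF f g])
  note Lp = localised.L_hom[OF p0]
  have "ArrMap LW (i 0) = ArrMap LW j"
    using localised.loc.iso_cancel_left[OF localised.L_inverts[OF pW] Lp localised.L_hom[OF i0] localised.L_hom[OF j]]
      localised.L.map_cmp[OF i0 p0] localised.L.map_cmp[OF j p0] pi(1) pj by simp
  then show ?thesis using localised.L.map_cmp[OF i0 m] localised.L.map_cmp[OF j m] mi0 mj by simp
qed

subsection \<open>The functor that resolves\<close>

text \<open>Objects that have a presentation are resolved by themselves, so that \<open>resolve\<close> below restricts to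
  the quotient functor on the nose and not only up to isomorphism.\<close>

definition resolution :: "'o \<Rightarrow> 'o \<times> 'm" where
  "resolution X = (if X \<in> cone_objs C T then (X, Idn C X)
     else (SOME (P, w). P \<in> cone_objs C T \<and> w \<in> hom_set C P X \<and> w \<in> W))"

definition res_obj :: "'o \<Rightarrow> 'o" where "res_obj X = fst (resolution X)"
definition res_arr :: "'o \<Rightarrow> 'm" where "res_arr X = snd (resolution X)"

lemma res:
  assumes "X \<in> Obj C"
  shows "res_obj X \<in> cone_objs C T" and "res_arr X \<in> hom_set C (res_obj X) X" and "res_arr X \<in> W"
proof -
  have "res_obj X \<in> cone_objs C T \<and> res_arr X \<in> hom_set C (res_obj X) X \<and> res_arr X \<in> W"
  proof (cases "X \<in> cone_objs C T")
    case True
    then show ?thesis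
      using idn_hom[OF assms] idn_in_W[OF assms] by (simp add: res_obj_def res_arr_def resolution_def)
  next
    case False
    have "\<exists>p. case p of (P, w) \<Rightarrow> P \<in> cone_objs C T \<and> w \<in> hom_set C P X \<and> w \<in> W"
      using resolution_exists[OF assms] by auto
    from someI_ex[OF this] False show ?thesis
      by (simp add: res_obj_def res_arr_def resolution_def case_prod_unfold)
  qed
  then show "res_obj X \<in> cone_objs C T" "res_arr X \<in> hom_set C (res_obj X) X" "res_arr X \<in> W" by auto
qed

lemma res_self:
  assumes "X \<in> cone_objs C T"
  shows "res_obj X = X" and "res_arr X = Idn C X"
  using assms by (simp_all add: res_obj_def res_arr_def resolution_def)

definition lifts :: "'m \<Rightarrow> 'm set" where
  "lifts f = {f' \<in> hom_set C (res_obj (Dom C f)) (res_obj (Cod C f)).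
     res_arr (Cod C f) \<cdot> f' \<sim> f \<cdot> res_arr (Dom C f)}"

lemma lifts_iff:
  "f \<in> hom_set C X Y \<Longrightarrow> f' \<in> lifts f \<longleftrightarrow>
    f' \<in> hom_set C (res_obj X) (res_obj Y) \<and> res_arr Y \<cdot> f' \<sim> f \<cdot> res_arr X"
  by (simp add: lifts_def hom_setD)

lemma lift_exists:
  assumes f: "f \<in> hom_set C X Y"
  shows "\<exists>f'. f' \<in> lifts f"
proof -
  note o = hom_objs[OF f]
  show ?thesis
    using lift_along_W[OF res(1)[OF o(1)] res(3,2)[OF o(2)] cmp_hom[OF res(2)[OF o(1)] f]] lifts_iff[OF f]
    by blast
qed

text \<open>The extension of this functor to the localisation will be the quasi-inverse.\<close>

definition resolve :: "('o, 'm, 'o, 'm set) fctr" where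
  "resolve = \<lparr>ObjMap = (\<lambda>X \<in> Obj C. res_obj X), ArrMap = (\<lambda>f \<in> Arr C. R `` {SOME f'. f' \<in> lifts f})\<rparr>"

lemma resolve_obj: "X \<in> Obj C \<Longrightarrow> ObjMap resolve X = res_obj X"
  by (simp add: resolve_def)

text \<open>Any lift may be used, because two of them become related by \<open>\<sim>\<close> after composition with the
  resolution of \<open>Y\<close>, which is in \<open>W\<close> and can be cancelled.\<close>

lemma resolve_arr:
  assumes f: "f \<in> hom_set C X Y" and f': "f' \<in> lifts f"
  shows "ArrMap resolve f = R `` {f'}"
proof -
  note o = hom_objs[OF f]
  define f'' where "f'' = (SOME f'. f' \<in> lifts f)"
  have "f'' \<in> lifts f" unfolding f''_def by (rule someI) (rule f')
  then have h: "f'' \<in> hom_set C (res_obj X) (res_obj Y)" "f' \<in> hom_set C (res_obj X) (res_obj Y)"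
    and "res_arr Y \<cdot> f'' \<sim> res_arr Y \<cdot> f'"
    using f' lifts_iff[OF f] same_trans same_sym by blast+
  then have "f'' \<sim> f'" using same_cancel[OF res(3,2)[OF o(2)]] by blast
  then have "(f'', f') \<in> R" using R_iff hom_setD[OF h(1)] res(1) o by simp
  then have "R `` {f''} = R `` {f'}" by (rule equiv_class_eq[OF AR.equiv])
  then show ?thesis using hom_setD[OF f] by (simp add: resolve_def f''_def)
qed

lemma lifts_idn:
  assumes X: "X \<in> Obj C"
  shows "Idn C (res_obj X) \<in> lifts (Idn C X)"
proof -
  note r = res(2)[OF X]
  note P = hom_objs(1)[OF r]
  show ?thesis
    using lifts_iff[OF idn_hom[OF X]] idn_hom[OF P] cmp_idn[OF r] idn_cmp[OF r] same_refl[OF hom_setD(1)[OF r]]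
    by simp
qed

lemma lifts_cmp:
  assumes f: "f \<in> hom_set C X Y" and g: "g \<in> hom_set C Y Z" and "f' \<in> lifts f" "g' \<in> lifts g"
  shows "g' \<cdot> f' \<in> lifts (g \<cdot> f)"
proof -
  note o = hom_objs[OF f] hom_objs(2)[OF g]
  note r = res(2)[OF o(1)] res(2)[OF o(2)] res(2)[OF o(3)]
  have f': "f' \<in> hom_set C (res_obj X) (res_obj Y)" and fs: "res_arr Y \<cdot> f' \<sim> f \<cdot> res_arr X"
    using assms(3) lifts_iff[OF f] by auto
  have g': "g' \<in> hom_set C (res_obj Y) (res_obj Z)" and gs: "res_arr Z \<cdot> g' \<sim> g \<cdot> res_arr Y"
    using assms(4) lifts_iff[OF g] by auto
  have "res_arr Z \<cdot> (g' \<cdot> f') \<sim> (g \<cdot> res_arr Y) \<cdot> f'"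
    using same_cmp[OF same_refl[OF hom_setD(1)[OF f']] gs f' cmp_hom[OF g' r(3)]] cmp_assoc[OF f' g' r(3)] by simp
  moreover have "(g \<cdot> res_arr Y) \<cdot> f' \<sim> (g \<cdot> f) \<cdot> res_arr X"
    using same_cmp[OF fs same_refl[OF hom_setD(1)[OF g]] cmp_hom[OF f' r(2)] g]
      cmp_assoc[OF f' r(2) g] cmp_assoc[OF r(1) f g] by simp
  ultimately show ?thesis using lifts_iff[OF cmp_hom[OF f g]] cmp_hom[OF f' g'] same_trans by blast
qed

lemma class_hom_AQ:
  "\<lbrakk>f \<in> hom_set C P Q; P \<in> cone_objs C T; Q \<in> cone_objs C T\<rbrakk> \<Longrightarrow> R `` {f} \<in> hom_set AQ P Q"
  using AR.class_hom by (simp add: A_hom)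

lemma class_cmp_AQ:
  "\<lbrakk>f \<in> hom_set C P Q; g \<in> hom_set C Q V; P \<in> cone_objs C T; Q \<in> cone_objs C T; V \<in> cone_objs C T\<rbrakk>
    \<Longrightarrow> R `` {g} \<cdot>\<^bsub>AQ\<^esub> R `` {f} = R `` {g \<cdot> f}"
  using AR.class_cmp[of f P Q g V] by (simp add: A_hom)

lemma class_eq_AQ:
  assumes "f \<in> hom_set C P Q" "P \<in> cone_objs C T" "Q \<in> cone_objs C T" "f \<sim> g"
  shows "R `` {f} = R `` {g}"
  by (rule equiv_class_eq[OF AR.equiv]) (use assms R_iff hom_setD[OF assms(1)] in simp)

lemma resolve_functor: "is_functor C AQ resolve"
proof
  show "ObjMap resolve \<in> Obj C \<rightarrow>\<^sub>E Obj AQ"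
    using res(1) by (auto simp: resolve_def AR.quotient_simps)
  have hom: "ArrMap resolve f \<in> hom_set AQ (ObjMap resolve X) (ObjMap resolve Y)" if f: "f \<in> hom_set C X Y" for f X Y
  proof -
    obtain f' where f': "f' \<in> lifts f" using lift_exists[OF f] by blast
    then show ?thesis
      using class_hom_AQ lifts_iff[OF f] res(1) hom_objs[OF f] resolve_arr[OF f f'] by (simp add: resolve_obj)
  qed
  then show "ArrMap resolve f \<in> hom_set AQ (ObjMap resolve X) (ObjMap resolve Y)" if "f \<in> hom_set C X Y" for f X Y
    using that .
  show "ArrMap resolve \<in> Arr C \<rightarrow>\<^sub>E Arr AQ"
    using hom_setD(1)[OF hom[OF arr_in_hom]] by (auto simp: resolve_def)
  show "ArrMap resolve (Idn C X) = Idn AQ (ObjMap resolve X)" if "X \<in> Obj C" for X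
    using resolve_arr[OF idn_hom[OF that] lifts_idn[OF that]] that by (simp add: resolve_obj AR.quotient_simps)
  show "ArrMap resolve (g \<cdot> f) = ArrMap resolve g \<cdot>\<^bsub>AQ\<^esub> ArrMap resolve f"
    if f: "f \<in> hom_set C X Y" and g: "g \<in> hom_set C Y Z" for f g X Y Z
  proof -
    obtain f' where f': "f' \<in> lifts f" using lift_exists[OF f] by blast
    obtain g' where g': "g' \<in> lifts g" using lift_exists[OF g] by blast
    have h: "f' \<in> hom_set C (res_obj X) (res_obj Y)" "g' \<in> hom_set C (res_obj Y) (res_obj Z)"
      using f' g' lifts_iff[OF f] lifts_iff[OF g] by auto
    note o = hom_objs[OF f] hom_objs(2)[OF g]
    show ?thesis
      unfolding resolve_arr[OF f f'] resolve_arr[OF g g']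
        resolve_arr[OF cmp_hom[OF f g] lifts_cmp[OF f g f' g']]
      using class_cmp_AQ[OF h res(1)[OF o(1)] res(1)[OF o(2)] res(1)[OF o(3)]] by simp
  qed
qed

text \<open>Lift the identity of \<open>Q\<close> along \<open>f\<close> to get a right inverse \<open>g\<close> up to \<open>\<sim>\<close>; then cancel \<open>f\<close> in
  \<open>f (g f) \<sim> f\<close>.\<close>

lemma W_iso_in_quotient:
  assumes f: "f \<in> W" "f \<in> hom_set C P Q" and P: "P \<in> cone_objs C T" and Q: "Q \<in> cone_objs C T"
  shows "iso_arr AQ (R `` {f})"
proof -
  note o = hom_objs[OF f(2)]
  obtain g where g: "g \<in> hom_set C Q P" and fg: "f \<cdot> g \<sim> Idn C Q"
    using lift_along_W[OF Q f idn_hom[OF o(2)]] by blast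
  have "f \<cdot> (g \<cdot> f) \<sim> f \<cdot> Idn C P"
    using same_cmp[OF same_refl[OF hom_setD(1)[OF f(2)]] fg f(2) cmp_hom[OF g f(2)]]
      cmp_assoc[OF f(2) g f(2)] idn_cmp[OF f(2)] cmp_idn[OF f(2)] by simp
  then have gf: "g \<cdot> f \<sim> Idn C P" by (rule same_cancel[OF f cmp_hom[OF f(2) g] idn_hom[OF o(1)]])
  show ?thesis
  proof (rule AR.quotient.iso_arrI[OF class_hom_AQ[OF f(2) P Q] class_hom_AQ[OF g Q P]])
    show "R `` {g} \<cdot>\<^bsub>AQ\<^esub> R `` {f} = Idn AQ P"
      using class_cmp_AQ[OF f(2) g P Q P] class_eq_AQ[OF cmp_hom[OF f(2) g] P P gf] by (simp add: AR.quotient_simps)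
    show "R `` {f} \<cdot>\<^bsub>AQ\<^esub> R `` {g} = Idn AQ Q"
      using class_cmp_AQ[OF g f(2) Q P Q] class_eq_AQ[OF cmp_hom[OF g f(2)] Q Q fg] by (simp add: AR.quotient_simps)
  qed
qed

text \<open>After \<open>C(T,-)\<close>, the square of a lift commutes and three of its sides are bijective.\<close>

lemma lift_in_W:
  assumes f: "f \<in> W" "f \<in> hom_set C X Y" and f': "f' \<in> lifts f"
  shows "f' \<in> W"
proof -
  note o = hom_objs[OF f(2)]
  note rX = res(2)[OF o(1)] and rY = res(2)[OF o(2)]
  have h: "f' \<in> hom_set C (res_obj X) (res_obj Y)" and "res_arr Y \<cdot> f' \<sim> f \<cdot> res_arr X"
    using f' lifts_iff[OF f(2)] by auto
  then have sq: "res_arr Y \<cdot> (f' \<cdot> t) = f \<cdot> (res_arr X \<cdot> t)" if "t \<in> hom_set C T (res_obj X)" for t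
    using that same_iff[OF cmp_hom[OF h rY]] cmp_assoc[OF that h rY] cmp_assoc[OF that rX f(2)] by simp
  note zX = zero_hom[OF T_obj hom_objs(1)[OF rX]]
  show ?thesis
  proof (rule W_I[OF h])
    fix t assume t: "t \<in> hom_set C T (res_obj X)" and "f' \<cdot> t = Zero C T (res_obj Y)"
    then have "f \<cdot> (res_arr X \<cdot> t) = f \<cdot> (res_arr X \<cdot> Zero C T (res_obj X))"
      using sq[OF t] sq[OF zX] cmp_zero[OF h T_obj] by simp
    then have "res_arr X \<cdot> t = res_arr X \<cdot> Zero C T (res_obj X)"
      by (rule W_cancel[OF f cmp_hom[OF t rX] cmp_hom[OF zX rX]])
    then show "t = Zero C T (res_obj X)" by (rule W_cancel[OF res(3)[OF o(1)] rX t zX])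
  next
    fix t assume t: "t \<in> hom_set C T (res_obj Y)"
    obtain s where s: "s \<in> hom_set C T X" "f \<cdot> s = res_arr Y \<cdot> t" using W_lift[OF f cmp_hom[OF t rY]] by blast
    obtain u where u: "u \<in> hom_set C T (res_obj X)" "res_arr X \<cdot> u = s"
      using W_lift[OF res(3)[OF o(1)] rX s(1)] by blast
    have "f' \<cdot> u = t"
      using W_cancel[OF res(3)[OF o(2)] rY cmp_hom[OF u(1) h] t] sq[OF u(1)] u(2) s(2) by simp
    then show "\<exists>u \<in> hom_set C T (res_obj X). f' \<cdot> u = t" using u(1) by blast
  qed
qed

lemma resolve_inverts:
  assumes "w \<in> W"
  shows "iso_arr AQ (ArrMap resolve w)"
proof -
  have w: "w \<in> hom_set C (Dom C w) (Cod C w)" using assms W_arr arr_in_hom by blast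
  obtain w' where w': "w' \<in> lifts w" using lift_exists[OF w] by blast
  then have h: "w' \<in> hom_set C (res_obj (Dom C w)) (res_obj (Cod C w))" using lifts_iff[OF w] by simp
  show ?thesis
    using W_iso_in_quotient[OF lift_in_W[OF assms w w'] h] res(1) hom_objs[OF w] resolve_arr[OF w w'] by simp
qed

subsection \<open>The equivalence\<close>

definition induces :: "('o, 'm set, 'o, ('o \<times> 'm letter list \<times> 'o) set) fctr \<Rightarrow> bool" where
  "induces G \<longleftrightarrow> is_functor AQ CW G \<and> functor_comp A G (quotient_functor A R) = functor_comp A LW (inclusion A)"

lemma inclusion_A: "is_functor A C (inclusion A)"
  by (rule inclusion_functor[OF category_axioms]) (auto intro: cone_objs_obj)

lemma inclusion_simps:
  "X \<in> cone_objs C T \<Longrightarrow> ObjMap (inclusion A) X = X" "f \<in> Arr A \<Longrightarrow> ArrMap (inclusion A) f = f"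
  by (simp_all add: inclusion_def)

lemma induced_unique: "\<exists>!G. induces G"
  unfolding induces_def
proof (rule AR.quotient_universal[OF is_functor_comp[OF inclusion_A localised.L_functor]])
  fix f g assume fg: "(f, g) \<in> R"
  then have "f \<in> Arr A" "g \<in> Arr A" "f \<sim> g" using AR.cong_arr R_iff by blast+
  then show "ArrMap (functor_comp A LW (inclusion A)) f = ArrMap (functor_comp A LW (inclusion A)) g"
    using localisation_identifies[of f g] by (simp add: functor_comp_simps inclusion_simps)
qed

lemma inverse_functor_exists: "\<exists>K. is_functor CW AQ K \<and> functor_comp C K LW = resolve"
proof -
  interpret r: is_functor C AQ resolve by (rule resolve_functor)
  interpret inverting_functor C W AQ resolve by unfold_locales (rule resolve_inverts)
  show ?thesis by (rule extends_to_localisation)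
qed

lemma induced_simps:
  assumes "induces G"
  shows "P \<in> cone_objs C T \<Longrightarrow> ObjMap G P = P"
    and "f \<in> Arr A \<Longrightarrow> ArrMap G (R `` {f}) = ArrMap LW f"
proof -
  have eq: "functor_comp A G (quotient_functor A R) = functor_comp A LW (inclusion A)"
    using assms by (simp add: induces_def)
  show "ObjMap G P = P" if P: "P \<in> cone_objs C T"
    using arg_cong[OF eq, of "\<lambda>F. ObjMap F P"] P cone_objs_obj[OF P]
    by (simp add: functor_comp_simps AR.quotient_functor_simps inclusion_simps localised.L_simps)
  show "ArrMap G (R `` {f}) = ArrMap LW f" if f: "f \<in> Arr A"
    using arg_cong[OF eq, of "\<lambda>F. ArrMap F f"] f
    by (simp add: functor_comp_simps AR.quotient_functor_simps inclusion_simps)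
qed

text \<open>The functors are compared on arrows \<open>f\<close> between objects with a presentation. As the resolutions of
  these objects are identities, \<open>f\<close> is a lift of itself.\<close>

lemma retraction:
  assumes G: "induces G" and K: "is_functor CW AQ K" and KL: "functor_comp C K LW = resolve"
  shows "functor_comp AQ K G = id_functor AQ"
proof (rule AR.quotient_functor_unique)
  have GF: "is_functor AQ CW G" using G by (simp add: induces_def)
  show KG: "is_functor AQ AQ (functor_comp AQ K G)" by (rule is_functor_comp[OF GF K])
  show id: "is_functor AQ AQ (id_functor AQ)" by (rule id_functor_is_functor[OF AR.category_quotient])
  have q: "is_functor A AQ (quotient_functor A R)" by (rule AR.quotient_functor)
  show "functor_comp A (functor_comp AQ K G) (quotient_functor A R) = functor_comp A (id_functor AQ) (quotient_functor A R)"
  proof (rule functor_eqI[OF is_functor_comp[OF q KG] is_functor_comp[OF q id]])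
    fix P assume "P \<in> Obj A"
    then have P: "P \<in> cone_objs C T" by simp
    have "ObjMap K P = P"
      using arg_cong[OF KL, of "\<lambda>F. ObjMap F P"] cone_objs_obj[OF P] res_self[OF P]
      by (simp add: functor_comp_simps localised.L_simps resolve_obj)
    then show "ObjMap (functor_comp A (functor_comp AQ K G) (quotient_functor A R)) P
        = ObjMap (functor_comp A (id_functor AQ) (quotient_functor A R)) P"
      using P induced_simps(1)[OF G P]
      by (simp add: functor_comp_simps AR.quotient_functor_simps AR.quotient_simps inclusion_def)
  next
    fix f assume fA: "f \<in> Arr A"
    then have f: "f \<in> hom_set C (Dom C f) (Cod C f)" and o: "Dom C f \<in> cone_objs C T" "Cod C f \<in> cone_objs C T"
      by (auto simp: hom_set_def)
    have "f \<in> lifts f"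
      using lifts_iff[OF f] f res_self[OF o(1)] res_self[OF o(2)] idn_cmp[OF f] cmp_idn[OF f]
        same_refl[OF hom_setD(1)[OF f]] by simp
    then have "ArrMap K (ArrMap LW f) = R `` {f}"
      using arg_cong[OF KL, of "\<lambda>F. ArrMap F f"] resolve_arr[OF f] hom_setD(1)[OF f]
      by (simp add: functor_comp_simps)
    moreover have "R `` {f} \<in> Arr AQ" using class_hom_AQ[OF f o] by (simp add: hom_set_def)
    ultimately show "ArrMap (functor_comp A (functor_comp AQ K G) (quotient_functor A R)) f
        = ArrMap (functor_comp A (id_functor AQ) (quotient_functor A R)) f"
      using fA induced_simps(2)[OF G fA]
      by (simp add: functor_comp_simps AR.quotient_functor_simps inclusion_def)
  qed
qed

text \<open>It suffices to check naturality for the image of an arrow of \<open>C\<close>. There it is the square of a lift,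
  which commutes up to \<open>\<sim>\<close> and thus commutes in the localisation.\<close>

lemma counit:
  assumes G: "induces G" and K: "is_functor CW AQ K" and KL: "functor_comp C K LW = resolve"
  shows "natural_iso CW CW (functor_comp CW G K) (id_functor CW) (\<lambda>X. ArrMap LW (res_arr X))"
proof -
  have GF: "is_functor AQ CW G" using G by (simp add: induces_def)
  have GK: "is_functor CW CW (functor_comp CW G K)" by (rule is_functor_comp[OF K GF])
  have id: "is_functor CW CW (id_functor CW)" by (rule id_functor_is_functor[OF localised.loc.category_axioms])
  have GKX: "ObjMap (functor_comp CW G K) X = res_obj X" if X: "X \<in> Obj C" for X
    using arg_cong[OF KL, of "\<lambda>F. ObjMap F X"] X induced_simps(1)[OF G res(1)[OF X]]
    by (simp add: functor_comp_simps localised.L_simps resolve_obj localised.localisation_obj)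
  have hom: "ArrMap LW (res_arr X) \<in> hom_set CW (ObjMap (functor_comp CW G K) X) (ObjMap (id_functor CW) X)"
    if X: "X \<in> Obj C" for X
    using localised.L_hom[OF res(2)[OF X]] GKX[OF X] X by (simp add: inclusion_def localised.localisation_obj)
  have sq: "ArrMap LW (res_arr Y) \<cdot>\<^bsub>CW\<^esub> ArrMap (functor_comp CW G K) (ArrMap LW f)
      = ArrMap (id_functor CW) (ArrMap LW f) \<cdot>\<^bsub>CW\<^esub> ArrMap LW (res_arr X)" if f: "f \<in> hom_set C X Y" for f X Y
  proof -
    note o = hom_objs[OF f]
    have Lf: "ArrMap LW f \<in> Arr CW" using hom_setD(1)[OF localised.L_hom[OF f]] .
    obtain f' where f': "f' \<in> lifts f" using lift_exists[OF f] by blast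
    then have h: "f' \<in> hom_set C (res_obj X) (res_obj Y)" and eq: "res_arr Y \<cdot> f' \<sim> f \<cdot> res_arr X"
      using lifts_iff[OF f] by auto
    have "ArrMap K (ArrMap LW f) = R `` {f'}"
      using arg_cong[OF KL, of "\<lambda>F. ArrMap F f"] resolve_arr[OF f f'] hom_setD(1)[OF f]
      by (simp add: functor_comp_simps)
    moreover have "f' \<in> Arr A" using hom_setD[OF h] res(1) o by simp
    ultimately have "ArrMap (functor_comp CW G K) (ArrMap LW f) = ArrMap LW f'"
      using induced_simps(2)[OF G] Lf by (simp add: functor_comp_simps)
    then show ?thesis
      using localisation_identifies[OF eq] localised.L.map_cmp[OF h res(2)[OF o(2)]] localised.L.map_cmp[OF res(2)[OF o(1)] f] Lf
      by (simp add: inclusion_def)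
  qed
  show ?thesis
    unfolding natural_iso_def
  proof (intro conjI ballI)
    fix X assume "X \<in> Obj CW"
    then have X: "X \<in> Obj C" by (simp add: localised.localisation_obj)
    show "ArrMap LW (res_arr X) \<in> hom_set CW (ObjMap (functor_comp CW G K) X) (ObjMap (id_functor CW) X)"
      by (rule hom[OF X])
    show "iso_arr CW (ArrMap LW (res_arr X))" by (rule localised.L_inverts[OF res(3)[OF X]])
  next
    fix a assume a: "a \<in> Arr CW"
    show "ArrMap LW (res_arr (Cod CW a)) \<cdot>\<^bsub>CW\<^esub> ArrMap (functor_comp CW G K) a
        = ArrMap (id_functor CW) a \<cdot>\<^bsub>CW\<^esub> ArrMap LW (res_arr (Dom CW a))"
      by (rule localised.natural_on_localisation[OF GK id hom sq a])
  qed
qed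

lemma induced_equivalence:
  assumes G: "induces G"
  shows "is_equivalence AQ CW G"
proof -
  obtain K where K: "is_functor CW AQ K" and KL: "functor_comp C K LW = resolve"
    using inverse_functor_exists by blast
  have "natural_iso AQ AQ (id_functor AQ) (functor_comp AQ K G) (\<lambda>X. Idn AQ (ObjMap (id_functor AQ) X))"
    unfolding retraction[OF G K KL] by (rule natural_iso_refl[OF id_functor_is_functor[OF AR.category_quotient]])
  then show ?thesis
    unfolding is_equivalence_def using G K counit[OF G K KL] by (auto simp: induces_def)
qed

text \<open>A hom-set of the localisation embeds into one of the quotient, since the functor \<open>K\<close> is faithful,
  and that one is an image of a hom-set of \<open>C\<close>.\<close>

lemma localisation_locally_small:
  assumes small: "locally_small U C"
  shows "locally_small U CW"
  unfolding locally_small_def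
proof (intro ballI)
  fix X Y assume XY: "X \<in> Obj CW" "Y \<in> Obj CW"
  obtain K where K: "is_functor CW AQ K" and KL: "functor_comp C K LW = resolve"
    using inverse_functor_exists by blast
  obtain G where G: "induces G" using induced_unique by blast
  interpret K: is_functor CW AQ K by (rule K)
  have GF: "is_functor AQ CW G" using G by (simp add: induces_def)
  define P Q where "P = ObjMap K X" and "Q = ObjMap K Y"
  have PQ: "P \<in> cone_objs C T" "Q \<in> cone_objs C T"
    using K.map_obj XY by (simp_all add: P_def Q_def AR.quotient_simps)
  have "inj_on (ArrMap K) (hom_set CW X Y)"
    using faithful_if_natural_iso[OF K GF counit[OF G K KL]] by (intro inj_onI)
  moreover have "ArrMap K ` hom_set CW X Y \<subseteq> hom_set AQ P Q" using K.map_hom by (auto simp: P_def Q_def)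
  ultimately have "hom_set CW X Y \<lesssim> hom_set AQ P Q" unfolding lepoll_def by blast
  moreover have "hom_set AQ P Q \<subseteq> (\<lambda>f. R `` {f}) ` hom_set C P Q"
  proof
    fix c assume "c \<in> hom_set AQ P Q"
    then obtain f where "f \<in> hom_set A P Q" "c = R `` {f}" by (rule AR.hom_class)
    then show "c \<in> (\<lambda>f. R `` {f}) ` hom_set C P Q" using A_hom[OF PQ] by blast
  qed
  then have "hom_set AQ P Q \<lesssim> hom_set C P Q"
    by (rule lepoll_trans[OF subset_imp_lepoll image_lepoll])
  moreover have "hom_set C P Q \<prec> U" using small PQ cone_objs_obj by (simp add: locally_small_def)
  ultimately show "hom_set CW X Y \<prec> U" by (rule lesspoll_trans1[OF lepoll_trans])
qed

end

theorem corollary0p8: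
  fixes C :: "('o, 'm, 'z) tri_cat_scheme" and T :: 'o and U :: "'u set"
  assumes "triangulated_category C" and "locally_small U C"
    and "T \<in> Obj C" and "rigid C T" and "contravariantly_finite C T"
  shows
    "let W = localising_class C T;
         D = localisation C W;
         L = localisation_functor C W;
         A = full_subcat C (cone_objs C T);
         R = ideal_congruence A (factoring C (add_objs C (shift_obj C T)));
         induced = (\<lambda>G. is_functor (quotient_cat A R) D G \<and>
           functor_comp A G (quotient_functor A R) = functor_comp A L (inclusion A))
     in (\<exists>!G. induced G) \<and> (\<forall>G. induced G \<longrightarrow> is_equivalence (quotient_cat A R) D G) \<and>
        is_localisation TYPE('p) TYPE('n) C W D L \<and> locally_small U D"
proof -
  interpret rigid_object C T
    using assms(1,3-5) by (simp add: rigid_object_def rigid_object_axioms_def)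
  show ?thesis
    unfolding Let_def
    using induced_unique induced_equivalence localised.localisation_is_localisation
      localisation_locally_small[OF assms(2)]
    unfolding induces_def by blast
qed

end
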